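(* Let $\ell \ge 1$ and $\mathfrak g = sp_{2\ell}(\mathbb C)$. For every $m,n\in\mathbb N=\{1,2,\dots\}$ with $m\le \ell$, set $k_{m,n} = n-\frac{m+1}{2}$. Then $(\Delta_m(-1))^n\mathbf 1$ is a singular vector in the generalized Verma module $N_{k_{m,n}}(\mathfrak g)$.
   Context: Realization of $\mathfrak g=sp_{2\ell}(\mathbb C)$: let $W(A)$ be the Weyl algebra, i.e. the associative unital $\mathbb C$-algebra generated by $A=\mathrm{span}\{a_1,\dots,a_\ell,a_1^*,\dots,a_\ell^*\}$ with relations $[a_i,a_j]=[a_i^*,a_j^*]=0$, $[a_i,a_j^*]=\delta_{i,j}$. Put $:xy:\,=\frac12(xy+yx)$ for $x,y\in A$. The elements $:xy:$ span, under the commutator, a Lie algebra isomorphic to $sp_{2\ell}(\mathbb C)$, which is taken as $\mathfrak g$. The Cartan subalgebra $\mathfrak h$ has basis $h_i=-:a_ia_i^*:$, with dual basis $\epsilon_i\in\mathfrak h^*$. Simple roots are $\alpha_i=\epsilon_i-\epsilon_{i+1}$ ($1\le i<\ell$), $\alpha_\ell=2\epsilon_\ell$; the highest root is $\theta=2\epsilon_1$. Root vectors: $X_{\epsilon_i-\epsilon_j}=\,:a_ia_j^*:$ ($i\neq j$), $X_{\epsilon_i+\epsilon_j}=\,:a_ia_j:$, $X_{-(\epsilon_i+\epsilon_j)}=\,:a_i^*a_j^*:$ (with $i=j$ allowed in the last two). $\mathfrak n_+$ is the sum of the positive root spaces. Affine Lie algebra: $\hat{\mathfrak g}=\mathfrak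 g\otimes\mathbb C[t,t^{-1}]\oplus\mathbb Cc\oplus\mathbb Cd$, with $c$ central, $[x\otimes t^n,y\otimes t^m]=[x,y]\otimes t^{n+m}+n(x,y)\delta_{n+m,0}c$, $[d,x\otimes t^n]=n\,x\otimes t^n$, where $(\cdot,\cdot)$ is the invariant symmetric bilinear form on $\mathfrak g$ normalized by $(\theta,\theta)=2$. Write $x(n)=x\otimes t^n$. Generalized Verma module: for $k\in\mathbb C$, $N_k(\mathfrak g)=U(\hat{\mathfrak g})\otimes_{U(P)}\mathbb Cv_k$, where $P=\mathfrak g\otimes\mathbb C[t]\oplus\mathbb Cc\oplus\mathbb Cd$, and $\mathbb Cv_k$ is the one-dimensional $P$-module on which $\mathfrak g\otimes\mathbb C[t]+\mathbb Cd$ acts trivially and $c$ acts as $k$. Put $\mathbf 1=1\otimes v_k$. A singular vector in $N_k(\mathfrak g)$ is a nonzero weight vector annihilated by $\mathfrak n_+\otimes 1$ and by $\mathfrak g\otimes t\mathbb C[t]$. For $1\le m\le\ell$, $\Delta_m(-1)=\sum_{\sigma\in Sym_m}\mathrm{sgn}(\sigma)\prod_{i=1}^m X_{\epsilon_i+\epsilon_{\sigma(i)}}(-1)\in U(\hat{\mathfrak g})$, i.e. the determinant of the symmetric $m\times m$ matrix with $(i,j)$ entry $X_{\epsilon_i+\epsilon_j}(-1)$ (these entries commute with one another). *)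

theory Defs
  imports Complex_Main "HOL-Library.Cardinality" "HOL-Library.Poly_Mapping" "HOL-Combinatorics.Permutations"
begin

section \<open>Complex vector spaces and algebras\<close>

class cvector = ab_group_add +
  fixes scaleC :: "complex \<Rightarrow> 'a \<Rightarrow> 'a"  (infixr \<open>*\<^sub>C\<close> 75)
  assumes scaleC_add_right: "a *\<^sub>C (x + y) = a *\<^sub>C x + a *\<^sub>C y"
    and scaleC_add_left: "(a + b) *\<^sub>C x = a *\<^sub>C x + b *\<^sub>C x"
    and scaleC_scaleC: "a *\<^sub>C b *\<^sub>C x = (a * b) *\<^sub>C x"
    and scaleC_one: "1 *\<^sub>C x = x"

global_interpretation cvec: vector_space "scaleC :: complex \<Rightarrow> 'a \<Rightarrow> 'a::cvector"
  defines cspan = cvec.span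
  by unfold_locales (rule scaleC_add_right scaleC_add_left scaleC_scaleC scaleC_one)+

(* The class ring_1 is avoided because it contains 0 ~= 1, which for an algebra given by
   generators and relations is a theorem. *)
class calgebra = cvector + ring + monoid_mult +
  assumes scaleC_mult_left: "(a *\<^sub>C x) * y = a *\<^sub>C (x * y)"
    and scaleC_mult_right: "x * (a *\<^sub>C y) = a *\<^sub>C (x * y)"

instantiation complex :: calgebra
begin
definition scaleC_complex :: "complex \<Rightarrow> complex \<Rightarrow> complex" where
  "scaleC_complex = (*)"
instance by standard (auto simp: scaleC_complex_def algebra_simps)
end

instantiation poly_mapping :: (type, cvector) cvector
begin
lift_definition scaleC_poly_mapping :: "complex \<Rightarrow> ('a \<Rightarrow>\<^sub>0 'b) \<Rightarrow> ('a \<Rightarrow>\<^sub>0 'b)"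
  is "\<lambda>c f k. c *\<^sub>C f k"
  by (erule rev_finite_subset) auto
instance
  by standard (transfer; simp add: fun_eq_iff scaleC_add_right scaleC_add_left scaleC_scaleC scaleC_one)+
end

lemma lookup_scaleC: "Poly_Mapping.lookup (c *\<^sub>C p) k = c *\<^sub>C Poly_Mapping.lookup p k"
  by transfer simp

section \<open>Free algebras and quotients by two-sided ideals\<close>

datatype 'x free_monoid = Word (letters: "'x list")

instantiation free_monoid :: (type) monoid_add
begin
definition zero_free_monoid :: "'a free_monoid" where "0 = Word []"
definition plus_free_monoid :: "'a free_monoid \<Rightarrow> 'a free_monoid \<Rightarrow> 'a free_monoid" where
  "v + w = Word (letters v @ letters w)"
instance by standard (auto simp: zero_free_monoid_def plus_free_monoid_def)
end

(* The free unital associative algebra; its product is the convolution of the library. *)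
type_synonym 'x free_algebra = "'x free_monoid \<Rightarrow>\<^sub>0 complex"

lemma scaleC_conv_times: "c *\<^sub>C p = Poly_Mapping.single 0 c * p"
  for p :: "'x::monoid_add \<Rightarrow>\<^sub>0 complex"
proof -
  have "Poly_Mapping.single 0 c * p = Poly_Mapping.map ((*) c) p"
    by (simp add: mult_map_scale_conv_mult)
  also have "\<dots> = c *\<^sub>C p"
    by (rule poly_mapping_eqI) (simp add: lookup_scaleC Poly_Mapping.map.rep_eq scaleC_complex_def when_def)
  finally show ?thesis by simp
qed

lemma scaleC_conv_times': "c *\<^sub>C p = p * Poly_Mapping.single 0 c"
  for p :: "'x::monoid_add \<Rightarrow>\<^sub>0 complex"
proof (rule poly_mapping_eqI)
  fix k
  have inner: "(\<Sum>q. (c when 0 = q) when k = l + q) = (c when k = l)" for l :: 'x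
  proof -
    have "((c when 0 = q) when k = l + q) = ((c when k = l) when q = 0)" for q
      by (auto simp: when_def)
    then show ?thesis by simp
  qed
  have outer: "(Poly_Mapping.lookup p l * (c when k = l)) = ((Poly_Mapping.lookup p l * c) when l = k)" for l
    by (auto simp: when_def)
  have "Poly_Mapping.lookup (p * Poly_Mapping.single 0 c) k = Poly_Mapping.lookup p k * c"
    unfolding lookup_mult lookup_single inner outer by simp
  then show "Poly_Mapping.lookup (c *\<^sub>C p) k = Poly_Mapping.lookup (p * Poly_Mapping.single 0 c) k"
    by (simp add: lookup_scaleC scaleC_complex_def)
qed

lemma free_algebra_scaleC_mult_left: "(c *\<^sub>C p) * q = c *\<^sub>C (p * q)"
  for p q :: "'x::monoid_add \<Rightarrow>\<^sub>0 complex"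
  by (simp add: scaleC_conv_times mult.assoc)

lemma free_algebra_scaleC_mult_right: "p * (c *\<^sub>C q) = c *\<^sub>C (p * q)"
  for p q :: "'x::monoid_add \<Rightarrow>\<^sub>0 complex"
  by (simp add: scaleC_conv_times' mult.assoc)

definition gen :: "'x \<Rightarrow> 'x free_algebra" where
  "gen x = Poly_Mapping.single (Word [x]) 1"

definition eval_free :: "('x \<Rightarrow> 'r::calgebra) \<Rightarrow> 'x free_algebra \<Rightarrow> 'r" where
  "eval_free f p =
     (\<Sum>w\<in>Poly_Mapping.keys p. Poly_Mapping.lookup p w *\<^sub>C prod_list (map f (letters w)))"

definition ideal_gen :: "'x free_algebra set \<Rightarrow> 'x free_algebra set" where
  "ideal_gen S = cspan {p * s * q | p s q. s \<in> S}"

definition cong_mod :: "'a::ab_group_add set \<Rightarrow> 'a \<Rightarrow> 'a \<Rightarrow> bool" where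
  "cong_mod I p q \<longleftrightarrow> p - q \<in> I"

lemma ideal_gen_mult_left: "r * x \<in> ideal_gen S" if "x \<in> ideal_gen S"
  using that unfolding ideal_gen_def
proof (induction rule: cvec.span_induct_alt)
  case base
  then show ?case by (simp add: cvec.span_zero)
next
  case (step c x y)
  then obtain p s q where x: "x = p * s * q" "s \<in> S" by auto
  have "r * x = (r * p) * s * q" by (simp add: x mult.assoc)
  then have "r * x \<in> cspan {p * s * q | p s q. s \<in> S}"
    by (intro cvec.span_base) (use x in blast)
  with step show ?case
    by (simp add: distrib_left free_algebra_scaleC_mult_right cvec.span_add cvec.span_scale)
qed

lemma ideal_gen_mult_right: "x * r \<in> ideal_gen S" if "x \<in> ideal_gen S"
  using that unfolding ideal_gen_def
proof (induction rule: cvec.span_induct_alt)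
  case base
  then show ?case by (simp add: cvec.span_zero)
next
  case (step c x y)
  then obtain p s q where x: "x = p * s * q" "s \<in> S" by auto
  have "x * r = p * s * (q * r)" by (simp add: x mult.assoc)
  then have "x * r \<in> cspan {p * s * q | p s q. s \<in> S}"
    by (intro cvec.span_base) (use x in blast)
  with step show ?case
    by (simp add: distrib_right free_algebra_scaleC_mult_left cvec.span_add cvec.span_scale)
qed

lemma equivp_cong_mod_span: "equivp (cong_mod (cspan S))"
proof (rule equivpI)
  show "reflp (cong_mod (cspan S))"
    by (simp add: reflp_def cong_mod_def cvec.span_zero)
  show "symp (cong_mod (cspan S))"
    unfolding symp_def cong_mod_def by (metis cvec.span_neg minus_diff_eq)
  show "transp (cong_mod (cspan S))"
  proof (rule transpI)
    fix x y z assume "cong_mod (cspan S) x y" "cong_mod (cspan S) y z"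
    then have "(x - y) + (y - z) \<in> cspan S" unfolding cong_mod_def by (rule cvec.span_add)
    then show "cong_mod (cspan S) x z" by (simp add: cong_mod_def)
  qed
qed

lemma equivp_cong_mod_ideal: "equivp (cong_mod (ideal_gen S))"
  unfolding ideal_gen_def by (rule equivp_cong_mod_span)

lemma cong_mod_span_add: "cong_mod (cspan S) (x + y) (x' + y')"
  if "cong_mod (cspan S) x x'" "cong_mod (cspan S) y y'"
  using cvec.span_add[OF that[unfolded cong_mod_def]] by (simp add: cong_mod_def algebra_simps)

lemma cong_mod_span_diff: "cong_mod (cspan S) (x - y) (x' - y')"
  if "cong_mod (cspan S) x x'" "cong_mod (cspan S) y y'"
  using cvec.span_diff[OF that[unfolded cong_mod_def]] by (simp add: cong_mod_def algebra_simps)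

lemma cong_mod_span_uminus: "cong_mod (cspan S) (- x) (- x')"
  if "cong_mod (cspan S) x x'"
  using cvec.span_neg[OF that[unfolded cong_mod_def]] by (simp add: cong_mod_def algebra_simps)

lemma cong_mod_span_scaleC: "cong_mod (cspan S) (c *\<^sub>C x) (c *\<^sub>C x')"
  if "cong_mod (cspan S) x x'"
  using cvec.span_scale[OF that[unfolded cong_mod_def], of c]
  by (simp add: cong_mod_def cvec.scale_right_diff_distrib)

lemma cong_mod_ideal_add: "cong_mod (ideal_gen S) (x + y) (x' + y')"
  if "cong_mod (ideal_gen S) x x'" "cong_mod (ideal_gen S) y y'"
  using that unfolding ideal_gen_def by (rule cong_mod_span_add)

lemma cong_mod_ideal_diff: "cong_mod (ideal_gen S) (x - y) (x' - y')"
  if "cong_mod (ideal_gen S) x x'" "cong_mod (ideal_gen S) y y'"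
  using that unfolding ideal_gen_def by (rule cong_mod_span_diff)

lemma cong_mod_ideal_uminus: "cong_mod (ideal_gen S) (- x) (- x')"
  if "cong_mod (ideal_gen S) x x'"
  using that unfolding ideal_gen_def by (rule cong_mod_span_uminus)

lemma cong_mod_ideal_scaleC: "cong_mod (ideal_gen S) (c *\<^sub>C x) (c *\<^sub>C x')"
  if "cong_mod (ideal_gen S) x x'"
  using that unfolding ideal_gen_def by (rule cong_mod_span_scaleC)

lemma cong_mod_ideal_mult: "cong_mod (ideal_gen S) (x * y) (x' * y')"
  if "cong_mod (ideal_gen S) x x'" "cong_mod (ideal_gen S) y y'"
proof -
  have "(x - x') * y \<in> ideal_gen S" "x' * (y - y') \<in> ideal_gen S"
    using that by (auto simp: cong_mod_def ideal_gen_mult_left ideal_gen_mult_right)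
  then have "(x - x') * y + x' * (y - y') \<in> ideal_gen S"
    unfolding ideal_gen_def by (rule cvec.span_add)
  then show ?thesis by (simp add: cong_mod_def algebra_simps)
qed

section \<open>The Weyl algebra\<close>

(* The rank l is CARD('l); Ann i and Cre i stand for a_i and a_i^*. *)
datatype 'l weyl_gen = Ann 'l | Cre 'l

definition weyl_rels :: "'l weyl_gen free_algebra set" where
  "weyl_rels =
     {gen (Ann i) * gen (Ann j) - gen (Ann j) * gen (Ann i) | i j. True}
   \<union> {gen (Cre i) * gen (Cre j) - gen (Cre j) * gen (Cre i) | i j. True}
   \<union> {gen (Ann i) * gen (Cre j) - gen (Cre j) * gen (Ann i) - (if i = j then 1 else 0) | i j. True}"

quotient_type 'l weyl = "'l weyl_gen free_algebra" / "cong_mod (ideal_gen weyl_rels)"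
  by (rule equivp_cong_mod_ideal)

instantiation weyl :: (type) calgebra
begin
lift_definition zero_weyl :: "'a weyl" is 0 .
lift_definition one_weyl :: "'a weyl" is 1 .
lift_definition plus_weyl :: "'a weyl \<Rightarrow> 'a weyl \<Rightarrow> 'a weyl" is "(+)" by (rule cong_mod_ideal_add)
lift_definition minus_weyl :: "'a weyl \<Rightarrow> 'a weyl \<Rightarrow> 'a weyl" is "(-)" by (rule cong_mod_ideal_diff)
lift_definition uminus_weyl :: "'a weyl \<Rightarrow> 'a weyl" is uminus by (rule cong_mod_ideal_uminus)
lift_definition times_weyl :: "'a weyl \<Rightarrow> 'a weyl \<Rightarrow> 'a weyl" is "(*)" by (rule cong_mod_ideal_mult)
lift_definition scaleC_weyl :: "complex \<Rightarrow> 'a weyl \<Rightarrow> 'a weyl" is scaleC by (rule cong_mod_ideal_scaleC)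
instance
  by standard
    (transfer; simp add: algebra_simps equivp_reflp[OF equivp_cong_mod_ideal]
      scaleC_add_right scaleC_add_left scaleC_scaleC scaleC_one
      free_algebra_scaleC_mult_left free_algebra_scaleC_mult_right)+
end

lift_definition weyl_of :: "'l weyl_gen \<Rightarrow> 'l weyl" is gen .

definition weyl_A :: "'l weyl set" where
  "weyl_A = cspan (range weyl_of)"

definition normal_ord :: "'l weyl \<Rightarrow> 'l weyl \<Rightarrow> 'l weyl" where
  "normal_ord x y = (1/2) *\<^sub>C (x * y + y * x)"

section \<open>The symplectic Lie algebra\<close>

(* Axiom-free: the universal enveloping algebra below is defined from the bracket alone. *)
class lie_bracket = cvector +
  fixes lie :: "'a \<Rightarrow> 'a \<Rightarrow> 'a"

typedef (overloaded) 'l sp = "cspan {normal_ord x y | x y. x \<in> weyl_A \<and> y \<in> weyl_A} :: 'l weyl set"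
  using cvec.span_zero by blast

setup_lifting type_definition_sp

lemma commutator_scaleC_left: "(c *\<^sub>C x) * y - y * (c *\<^sub>C x) = c *\<^sub>C (x * y - y * x)"
  for x y :: "'a::calgebra"
  by (simp add: scaleC_mult_left scaleC_mult_right cvec.scale_right_diff_distrib)

lemma weyl_of_commutator: "\<exists>c. weyl_of g * weyl_of h - weyl_of h * weyl_of g = c *\<^sub>C 1"
proof -
  have rel: "cong_mod (ideal_gen weyl_rels) p q" if "p - q \<in> weyl_rels" for p q :: "'a weyl_gen free_algebra"
  proof -
    have "1 * (p - q) * 1 \<in> ideal_gen weyl_rels"
      unfolding ideal_gen_def by (intro cvec.span_base) (use that in blast)
    then show ?thesis by (simp add: cong_mod_def)
  qed
  have AA: "weyl_of (Ann i) * weyl_of (Ann j) - weyl_of (Ann j) * weyl_of (Ann i) = 0" for i j :: 'a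
    by transfer (rule rel, auto simp: weyl_rels_def)
  have CC: "weyl_of (Cre i) * weyl_of (Cre j) - weyl_of (Cre j) * weyl_of (Cre i) = 0" for i j :: 'a
    by transfer (rule rel, auto simp: weyl_rels_def)
  have AC: "weyl_of (Ann i) * weyl_of (Cre j) - weyl_of (Cre j) * weyl_of (Ann i)
      = (if i = j then 1 else 0)" for i j :: 'a
  proof (cases "i = j")
    case True
    then show ?thesis
      apply simp
      apply transfer
      apply (rule rel)
      apply (force simp: weyl_rels_def)
      done
  next
    case False
    then show ?thesis
      apply simp
      apply transfer
      apply (rule rel)
      apply (force simp: weyl_rels_def)
      done
  qed
  have CA: "weyl_of (Cre j) * weyl_of (Ann i) - weyl_of (Ann i) * weyl_of (Cre j)
      = (if i = j then -1 else 0)" for i j :: 'a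
    using AC[of i j] by (auto simp: algebra_simps split: if_splits)
  have ex: "\<exists>c. 0 = c *\<^sub>C (1::'a weyl)" "\<exists>c. c *\<^sub>C (1::'a weyl) = 1"
    "\<exists>c. - 1 = c *\<^sub>C (1::'a weyl)"
    by (auto intro: exI[of _ 0] exI[of _ 1] exI[of _ "-1"])
  show ?thesis
    by (cases g; cases h) (simp_all add: AA CC AC CA ex)
qed

lemma weyl_A_commutator:
  assumes "x \<in> weyl_A" "y \<in> weyl_A"
  shows "\<exists>c. x * y - y * x = c *\<^sub>C 1"
  using assms(1) unfolding weyl_A_def
proof (induction rule: cvec.span_induct_alt)
  case base
  show ?case by (auto intro: exI[of _ 0])
next
  case (step a g z)
  then obtain g' c where g: "g = weyl_of g'" and c: "z * y - y * z = c *\<^sub>C 1" by auto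
  have "\<exists>c. g * y - y * g = c *\<^sub>C 1"
    using assms(2) unfolding weyl_A_def
  proof (induction rule: cvec.span_induct_alt)
    case base
    show ?case by (auto intro: exI[of _ 0])
  next
    case (step b h w)
    then obtain h' d where h: "h = weyl_of h'" and d: "g * w - w * g = d *\<^sub>C 1" by auto
    obtain e where e: "g * h - h * g = e *\<^sub>C 1" using weyl_of_commutator g h by blast
    have "g * (b *\<^sub>C h + w) - (b *\<^sub>C h + w) * g = b *\<^sub>C (g * h - h * g) + (g * w - w * g)"
      by (simp add: algebra_simps scaleC_mult_left scaleC_mult_right cvec.scale_right_diff_distrib)
    then show ?case unfolding d e by (metis cvec.scale_left_distrib cvec.scale_scale)
  qed
  then obtain d where d: "g * y - y * g = d *\<^sub>C 1" by blast
  have "(a *\<^sub>C g + z) * y - y * (a *\<^sub>C g + z) = a *\<^sub>C (g * y - y * g) + (z * y - y * z)"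
    by (simp add: algebra_simps scaleC_mult_left scaleC_mult_right cvec.scale_right_diff_distrib)
  then show ?case unfolding c d by (metis cvec.scale_left_distrib cvec.scale_scale)
qed

lemma normal_ord_bracket_A:
  assumes "x \<in> weyl_A" "y \<in> weyl_A" "z \<in> weyl_A"
  shows "normal_ord x y * z - z * normal_ord x y \<in> weyl_A"
proof -
  obtain c where c: "y * z - z * y = c *\<^sub>C 1" using weyl_A_commutator assms by blast
  obtain d where d: "x * z - z * x = d *\<^sub>C 1" using weyl_A_commutator assms by blast
  have "normal_ord x y * z - z * normal_ord x y
      = (1/2) *\<^sub>C (x * (y * z - z * y) + (x * z - z * x) * y + y * (x * z - z * x) + (y * z - z * y) * x)"
    unfolding normal_ord_def commutator_scaleC_left by (simp add: algebra_simps)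
  also have "\<dots> = (1/2) *\<^sub>C (c *\<^sub>C x + d *\<^sub>C y + d *\<^sub>C y + c *\<^sub>C x)"
    by (simp add: c d scaleC_mult_left scaleC_mult_right)
  also have "\<dots> \<in> weyl_A"
    using assms unfolding weyl_A_def by (intro cvec.span_scale cvec.span_add) auto
  finally show ?thesis .
qed

lemma sp_commutator_closed:
  fixes x y :: "'l weyl"
  defines "S \<equiv> {normal_ord x y | x y. x \<in> weyl_A \<and> y \<in> weyl_A} :: 'l weyl set"
  assumes "x \<in> cspan S" "y \<in> cspan S"
  shows "x * y - y * x \<in> cspan S"
proof -
  have gens: "p * q - q * p \<in> cspan S" if pq: "p \<in> S" "q \<in> S" for p q
  proof -
    obtain a b where p: "p = normal_ord a b" "a \<in> weyl_A" "b \<in> weyl_A" using pq S_def by blast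
    obtain u v where q: "q = normal_ord u v" "u \<in> weyl_A" "v \<in> weyl_A" using pq S_def by blast
    have "p * q - q * p = normal_ord (p * u - u * p) v + normal_ord u (p * v - v * p)"
      unfolding q(1) normal_ord_def cvec.scale_right_distrib[symmetric]
      by (simp add: scaleC_mult_left scaleC_mult_right cvec.scale_right_diff_distrib[symmetric] algebra_simps)
    moreover have "normal_ord (p * u - u * p) v \<in> S" "normal_ord u (p * v - v * p) \<in> S"
      using normal_ord_bracket_A p q unfolding S_def by blast+
    ultimately show ?thesis by (simp add: cvec.span_add cvec.span_base)
  qed
  have "p * y - y * p \<in> cspan S" if p: "p \<in> S" for p
    using assms(3)
  proof (induction rule: cvec.span_induct_alt)
    case base
    show ?case by (simp add: cvec.span_zero)
  next
    case (step c q z)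
    have "p * (c *\<^sub>C q + z) - (c *\<^sub>C q + z) * p = c *\<^sub>C (p * q - q * p) + (p * z - z * p)"
      by (simp add: algebra_simps scaleC_mult_left scaleC_mult_right cvec.scale_right_diff_distrib)
    with step gens[OF p] show ?case by (simp add: cvec.span_add cvec.span_scale)
  qed
  with assms(2) show ?thesis
  proof (induction rule: cvec.span_induct_alt)
    case base
    show ?case by (simp add: cvec.span_zero)
  next
    case (step c q z)
    have "(c *\<^sub>C q + z) * y - y * (c *\<^sub>C q + z) = c *\<^sub>C (q * y - y * q) + (z * y - y * z)"
      by (simp add: algebra_simps scaleC_mult_left scaleC_mult_right cvec.scale_right_diff_distrib)
    with step show ?case by (simp add: cvec.span_add cvec.span_scale)
  qed
qed

instantiation sp :: (type) lie_bracket
begin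
lift_definition zero_sp :: "'a sp" is 0 by (rule cvec.span_zero)
lift_definition plus_sp :: "'a sp \<Rightarrow> 'a sp \<Rightarrow> 'a sp" is "(+)" by (rule cvec.span_add)
lift_definition minus_sp :: "'a sp \<Rightarrow> 'a sp \<Rightarrow> 'a sp" is "(-)" by (rule cvec.span_diff)
lift_definition uminus_sp :: "'a sp \<Rightarrow> 'a sp" is uminus by (rule cvec.span_neg)
lift_definition scaleC_sp :: "complex \<Rightarrow> 'a sp \<Rightarrow> 'a sp" is scaleC by (rule cvec.span_scale)
lift_definition lie_sp :: "'a sp \<Rightarrow> 'a sp \<Rightarrow> 'a sp" is "\<lambda>x y. x * y - y * x"
  by (rule sp_commutator_closed)
instance
  by standard (transfer; simp add: algebra_simps scaleC_add_right scaleC_add_left scaleC_scaleC scaleC_one)+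
end

(* The element :gh: of sp for generators g, h of the Weyl algebra. *)
lift_definition sp_of :: "'l weyl_gen \<Rightarrow> 'l weyl_gen \<Rightarrow> 'l sp"
  is "\<lambda>g h. normal_ord (weyl_of g) (weyl_of h)"
  unfolding weyl_A_def by (intro cvec.span_base) (blast intro: cvec.span_base)

(* X_{eps_i + eps_j} *)
definition X_plus :: "'l \<Rightarrow> 'l \<Rightarrow> 'l sp" where
  "X_plus i j = sp_of (Ann i) (Ann j)"

definition cartan_h :: "'l \<Rightarrow> 'l sp" where
  "cartan_h i = - sp_of (Ann i) (Cre i)"

definition cartan :: "'l sp set" where
  "cartan = cspan (range cartan_h)"

subsection \<open>Roots\<close>

(* The index set {1..l} is identified with the finite linear order 'l. *)
definition idx :: "nat \<Rightarrow> 'l::{finite,linorder}" where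
  "idx i = sorted_list_of_set UNIV ! (i - 1)"

(* Elements of the dual of the Cartan subalgebra are given by their coordinates in the dual
   basis eps_i, that is, by their values on the basis elements h_i. *)
type_synonym 'l weight = "'l \<Rightarrow> complex"

definition eps :: "'l \<Rightarrow> 'l weight" where
  "eps i = (\<lambda>j. if j = i then 1 else 0)"

definition simple_root :: "nat \<Rightarrow> 'l::{finite,linorder} weight" where
  "simple_root i =
     (if i < CARD('l) then (\<lambda>j. eps (idx i) j - eps (idx (i + 1)) j)
      else (\<lambda>j. 2 * eps (idx CARD('l)) j))"

definition highest_root :: "'l::{finite,linorder} weight" where
  "highest_root = (\<lambda>j. 2 * eps (idx 1) j)"

definition root_space :: "'l weight \<Rightarrow> 'l sp set" where
  "root_space \<alpha> = {x. \<forall>i. lie (cartan_h i) x = \<alpha> i *\<^sub>C x}"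

definition positive_root :: "'l::{finite,linorder} weight \<Rightarrow> bool" where
  "positive_root \<alpha> \<longleftrightarrow> \<alpha> \<noteq> (\<lambda>_. 0) \<and> root_space \<alpha> \<noteq> {0} \<and>
     (\<exists>c :: nat \<Rightarrow> nat. \<alpha> = (\<lambda>j. \<Sum>i=1..CARD('l). of_nat (c i) * simple_root i j))"

definition n_plus :: "'l::{finite,linorder} sp set" where
  "n_plus = cspan (\<Union>\<alpha>\<in>Collect positive_root. root_space \<alpha>)"

subsection \<open>The normalized invariant form\<close>

definition invariant_form :: "('l sp \<Rightarrow> 'l sp \<Rightarrow> complex) \<Rightarrow> bool" where
  "invariant_form B \<longleftrightarrow>
     (\<forall>x. Vector_Spaces.linear scaleC scaleC (B x)) \<and>
     (\<forall>x y. B x y = B y x) \<and>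
     (\<forall>x y z. B (lie x y) z = B x (lie y z))"

(* (theta, theta) refers to the form on the dual of the Cartan subalgebra transported along
   t |-> (t, _), so the element t representing theta has to satisfy (t, t) = 2. *)
definition normalized_form :: "('l::{finite,linorder} sp \<Rightarrow> 'l sp \<Rightarrow> complex) \<Rightarrow> bool" where
  "normalized_form B \<longleftrightarrow>
     (\<exists>t\<in>cartan. (\<forall>i. B t (cartan_h i) = highest_root i) \<and> B t t = 2)"

definition sp_form :: "'l::{finite,linorder} sp \<Rightarrow> 'l sp \<Rightarrow> complex" where
  "sp_form = (THE B. invariant_form B \<and> normalized_form B)"

section \<open>The affine Lie algebra\<close>

(* Affine f a b is the sum of all f(n) (x) t^n, plus a c + b d. *)
datatype 'l affine = Affine (loop: "int \<Rightarrow>\<^sub>0 'l sp") (c_coeff: complex) (d_coeff: complex)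

definition loop_lie :: "(int \<Rightarrow>\<^sub>0 'l sp) \<Rightarrow> (int \<Rightarrow>\<^sub>0 'l sp) \<Rightarrow> (int \<Rightarrow>\<^sub>0 'l sp)" where
  "loop_lie f g = (\<Sum>n\<in>Poly_Mapping.keys f. \<Sum>m\<in>Poly_Mapping.keys g.
     Poly_Mapping.single (n + m) (lie (Poly_Mapping.lookup f n) (Poly_Mapping.lookup g m)))"

definition loop_cocycle :: "(int \<Rightarrow>\<^sub>0 'l::{finite,linorder} sp) \<Rightarrow> (int \<Rightarrow>\<^sub>0 'l sp) \<Rightarrow> complex" where
  "loop_cocycle f g = (\<Sum>n\<in>Poly_Mapping.keys f.
     of_int n * sp_form (Poly_Mapping.lookup f n) (Poly_Mapping.lookup g (- n)))"

definition loop_deriv :: "(int \<Rightarrow>\<^sub>0 'l sp) \<Rightarrow> (int \<Rightarrow>\<^sub>0 'l sp)" where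
  "loop_deriv f = (\<Sum>n\<in>Poly_Mapping.keys f.
     Poly_Mapping.single n (of_int n *\<^sub>C Poly_Mapping.lookup f n))"

instantiation affine :: ("{finite,linorder}") lie_bracket
begin
definition zero_affine :: "'a affine" where "0 = Affine 0 0 0"
definition plus_affine :: "'a affine \<Rightarrow> 'a affine \<Rightarrow> 'a affine" where
  "x + y = Affine (loop x + loop y) (c_coeff x + c_coeff y) (d_coeff x + d_coeff y)"
definition minus_affine :: "'a affine \<Rightarrow> 'a affine \<Rightarrow> 'a affine" where
  "x - y = Affine (loop x - loop y) (c_coeff x - c_coeff y) (d_coeff x - d_coeff y)"
definition uminus_affine :: "'a affine \<Rightarrow> 'a affine" where
  "- x = Affine (- loop x) (- c_coeff x) (- d_coeff x)"
definition scaleC_affine :: "complex \<Rightarrow> 'a affine \<Rightarrow> 'a affine" where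
  "a *\<^sub>C x = Affine (a *\<^sub>C loop x) (a * c_coeff x) (a * d_coeff x)"
definition lie_affine :: "'a affine \<Rightarrow> 'a affine \<Rightarrow> 'a affine" where
  "lie x y = Affine
     (loop_lie (loop x) (loop y) + d_coeff x *\<^sub>C loop_deriv (loop y) - d_coeff y *\<^sub>C loop_deriv (loop x))
     (loop_cocycle (loop x) (loop y))
     0"
instance
  by standard
    (auto simp: zero_affine_def plus_affine_def minus_affine_def uminus_affine_def scaleC_affine_def
      algebra_simps scaleC_add_right scaleC_add_left scaleC_scaleC scaleC_one)
end

(* x(n) = x (x) t^n *)
definition loop_elem :: "'l sp \<Rightarrow> int \<Rightarrow> 'l affine" where
  "loop_elem x n = Affine (Poly_Mapping.single n x) 0 0"

definition affine_cartan :: "'l affine set" where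
  "affine_cartan = {Affine (Poly_Mapping.single 0 h) a b | h a b. h \<in> cartan}"

(* g (x) t C[t] *)
definition affine_pos :: "'l affine set" where
  "affine_pos = {Affine f 0 0 | f. Poly_Mapping.keys f \<subseteq> {1..}}"

typedef (overloaded) 'l parabolic = "{x :: 'l affine. Poly_Mapping.keys (loop x) \<subseteq> {0..}}"
  by (rule exI[of _ "Affine 0 0 0"]) simp

setup_lifting type_definition_parabolic

lemma keys_scaleC_subset: "Poly_Mapping.keys (c *\<^sub>C f) \<subseteq> Poly_Mapping.keys f"
  by (auto simp: in_keys_iff lookup_scaleC)

lemma keys_loop_lie:
  "Poly_Mapping.keys f \<subseteq> {0..} \<Longrightarrow> Poly_Mapping.keys g \<subseteq> {0..} \<Longrightarrow>
   Poly_Mapping.keys (loop_lie f g) \<subseteq> {0..}"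
  unfolding loop_lie_def
  by (intro order_trans[OF Poly_Mapping.keys_sum] UN_least) (force split: if_splits)

lemma keys_loop_deriv: "Poly_Mapping.keys (loop_deriv f) \<subseteq> Poly_Mapping.keys f"
  unfolding loop_deriv_def
  by (intro order_trans[OF Poly_Mapping.keys_sum] UN_least) (auto split: if_splits)

lemma keys_diff_subset: "Poly_Mapping.keys (f - g) \<subseteq> Poly_Mapping.keys f \<union> Poly_Mapping.keys g"
  for f g :: "'a \<Rightarrow>\<^sub>0 'b::ab_group_add"
  by (auto simp: in_keys_iff lookup_minus)

instantiation parabolic :: ("{finite,linorder}") lie_bracket
begin
lift_definition zero_parabolic :: "'a parabolic" is 0 by (simp add: zero_affine_def)
lift_definition plus_parabolic :: "'a parabolic \<Rightarrow> 'a parabolic \<Rightarrow> 'a parabolic" is "(+)"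
  unfolding plus_affine_def by (auto dest!: subsetD[OF Poly_Mapping.keys_add])
lift_definition minus_parabolic :: "'a parabolic \<Rightarrow> 'a parabolic \<Rightarrow> 'a parabolic" is "(-)"
  unfolding minus_affine_def by (auto dest!: subsetD[OF keys_diff_subset])
lift_definition uminus_parabolic :: "'a parabolic \<Rightarrow> 'a parabolic" is uminus
  unfolding uminus_affine_def by (simp add: keys_minus)
lift_definition scaleC_parabolic :: "complex \<Rightarrow> 'a parabolic \<Rightarrow> 'a parabolic" is scaleC
  unfolding scaleC_affine_def by (auto dest!: subsetD[OF keys_scaleC_subset])
lift_definition lie_parabolic :: "'a parabolic \<Rightarrow> 'a parabolic \<Rightarrow> 'a parabolic" is lie
  unfolding lie_affine_def
  by (auto dest!: subsetD[OF Poly_Mapping.keys_add] subsetD[OF keys_diff_subset]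
      subsetD[OF keys_scaleC_subset] subsetD[OF keys_loop_deriv] dest: subsetD[OF keys_loop_lie])
instance
  by standard (transfer; simp add: algebra_simps scaleC_add_right scaleC_add_left scaleC_scaleC scaleC_one)+
end

section \<open>Universal enveloping algebras\<close>

definition uea_rels :: "'a::lie_bracket free_algebra set" where
  "uea_rels =
     {gen (x + y) - gen x - gen y | x y. True}
   \<union> {gen (c *\<^sub>C x) - c *\<^sub>C gen x | c x. True}
   \<union> {gen x * gen y - gen y * gen x - gen (lie x y) | x y. True}"

quotient_type (overloaded) 'a uea = "'a::lie_bracket free_algebra" / "cong_mod (ideal_gen uea_rels)"
  by (rule equivp_cong_mod_ideal)

instantiation uea :: (lie_bracket) calgebra
begin
lift_definition zero_uea :: "'a uea" is 0 .
lift_definition one_uea :: "'a uea" is 1 .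
lift_definition plus_uea :: "'a uea \<Rightarrow> 'a uea \<Rightarrow> 'a uea" is "(+)" by (rule cong_mod_ideal_add)
lift_definition minus_uea :: "'a uea \<Rightarrow> 'a uea \<Rightarrow> 'a uea" is "(-)" by (rule cong_mod_ideal_diff)
lift_definition uminus_uea :: "'a uea \<Rightarrow> 'a uea" is uminus by (rule cong_mod_ideal_uminus)
lift_definition times_uea :: "'a uea \<Rightarrow> 'a uea \<Rightarrow> 'a uea" is "(*)" by (rule cong_mod_ideal_mult)
lift_definition scaleC_uea :: "complex \<Rightarrow> 'a uea \<Rightarrow> 'a uea" is scaleC by (rule cong_mod_ideal_scaleC)
instance
  by standard
    (transfer; simp add: algebra_simps equivp_reflp[OF equivp_cong_mod_ideal]
      scaleC_add_right scaleC_add_left scaleC_scaleC scaleC_one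
      free_algebra_scaleC_mult_left free_algebra_scaleC_mult_right)+
end

lift_definition uea_of :: "'a::lie_bracket \<Rightarrow> 'a uea" is gen .

(* The algebra homomorphism extending f; meaningful when f is linear and sends brackets to
   commutators, since then the value does not depend on the representative of u. *)
definition uea_lift :: "('a::lie_bracket \<Rightarrow> 'r::calgebra) \<Rightarrow> 'a uea \<Rightarrow> 'r" where
  "uea_lift f u = eval_free f (rep_uea u)"

section \<open>Generalized Verma modules\<close>

definition tensor_rels ::
  "('a::cvector \<Rightarrow> 'r \<Rightarrow> 'a) \<Rightarrow> ('r \<Rightarrow> 'b::cvector \<Rightarrow> 'b) \<Rightarrow> ('a \<times> 'b \<Rightarrow>\<^sub>0 complex) set" where
  "tensor_rels ract lact =
     {Poly_Mapping.single (u + u', z) 1 - Poly_Mapping.single (u, z) 1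
        - Poly_Mapping.single (u', z) 1 | u u' z. True}
   \<union> {Poly_Mapping.single (u, z + z') 1 - Poly_Mapping.single (u, z) 1
        - Poly_Mapping.single (u, z') 1 | u z z'. True}
   \<union> {Poly_Mapping.single (c *\<^sub>C u, z) 1 - c *\<^sub>C Poly_Mapping.single (u, z) 1 | c u z. True}
   \<union> {Poly_Mapping.single (u, c *\<^sub>C z) 1 - c *\<^sub>C Poly_Mapping.single (u, z) 1 | c u z. True}
   \<union> {Poly_Mapping.single (ract u p, z) 1 - Poly_Mapping.single (u, lact p z) 1 | u p z. True}"

definition parabolic_incl :: "'l::{finite,linorder} parabolic uea \<Rightarrow> 'l affine uea" where
  "parabolic_incl = uea_lift (\<lambda>x. uea_of (Rep_parabolic x))"

(* The action of U(P) on the one-dimensional module C v_k, with v_k = 1. *)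
definition vk_act :: "complex \<Rightarrow> 'l::{finite,linorder} parabolic uea \<Rightarrow> complex \<Rightarrow> complex" where
  "vk_act k p z = uea_lift (\<lambda>x. k * c_coeff (Rep_parabolic x)) p * z"

(* Formal combinations of pairs (u, z), with u in U(g^) and z in C v_k. *)
type_synonym 'l verma_pre = "'l affine uea \<times> complex \<Rightarrow>\<^sub>0 complex"

definition verma_eq :: "complex \<Rightarrow> ('l::{finite,linorder} verma_pre \<times> 'l verma_pre) set" where
  "verma_eq k = {(v, w).
     cong_mod (cspan (tensor_rels (\<lambda>u p. u * parabolic_incl p) (vk_act k))) v w}"

definition verma :: "complex \<Rightarrow> 'l::{finite,linorder} verma_pre set set" where
  "verma k = UNIV // verma_eq k"

definition verma_zero :: "complex \<Rightarrow> 'l::{finite,linorder} verma_pre set" where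
  "verma_zero k = verma_eq k `` {0}"

definition verma_scale ::
  "complex \<Rightarrow> complex \<Rightarrow> 'l::{finite,linorder} verma_pre set \<Rightarrow> 'l verma_pre set" where
  "verma_scale k a C = (\<Union>w\<in>C. verma_eq k `` {a *\<^sub>C w})"

definition verma_pre_act :: "'l::{finite,linorder} affine uea \<Rightarrow> 'l verma_pre \<Rightarrow> 'l verma_pre" where
  "verma_pre_act u w = (\<Sum>(u', z)\<in>Poly_Mapping.keys w.
     Poly_Mapping.single (u * u', z) (Poly_Mapping.lookup w (u', z)))"

definition verma_act ::
  "complex \<Rightarrow> 'l::{finite,linorder} affine uea \<Rightarrow> 'l verma_pre set \<Rightarrow> 'l verma_pre set" where
  "verma_act k u C = (\<Union>w\<in>C. verma_eq k `` {verma_pre_act u w})"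

(* 1 (x) v_k *)
definition vacuum :: "complex \<Rightarrow> 'l::{finite,linorder} verma_pre set" where
  "vacuum k = verma_eq k `` {Poly_Mapping.single (1, 1) 1}"

(* The eigenvalue function mu need not be assumed linear: for v ~= 0 it is so automatically. *)
definition weight_vector :: "complex \<Rightarrow> 'l::{finite,linorder} verma_pre set \<Rightarrow> bool" where
  "weight_vector k v \<longleftrightarrow> (\<exists>\<mu> :: 'l affine \<Rightarrow> complex.
     \<forall>h\<in>affine_cartan. verma_act k (uea_of h) v = verma_scale k (\<mu> h) v)"

definition singular_vector :: "complex \<Rightarrow> 'l::{finite,linorder} verma_pre set \<Rightarrow> bool" where
  "singular_vector k v \<longleftrightarrow>
     v \<in> verma k \<and> v \<noteq> verma_zero k \<and> weight_vector k v \<and>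
     (\<forall>x\<in>n_plus. verma_act k (uea_of (loop_elem x 0)) v = verma_zero k) \<and>
     (\<forall>y\<in>affine_pos. verma_act k (uea_of y) v = verma_zero k)"

(* Delta_m(-1); the factors are multiplied in the order i = 1, ..., m (they commute). *)
definition Delta :: "nat \<Rightarrow> 'l::{finite,linorder} affine uea" where
  "Delta m = (\<Sum>\<sigma> | \<sigma> permutes {1..m}.
     of_int (sign \<sigma>) *\<^sub>C
       prod_list (map (\<lambda>i. uea_of (loop_elem (X_plus (idx i) (idx (\<sigma> i))) (- 1))) [1..<m + 1]))"

definition k_level :: "nat \<Rightarrow> nat \<Rightarrow> complex" where
  "k_level m n = of_nat n - (of_nat m + 1) / 2"

end

(*
The vector Delta_m(-1)^n 1 is annihilated because everything in sight reduces to two commutators with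
the determinant. The elements X_{eps_p - eps_q}(0) act on the commuting variables X_ij(-1) by row and
column operations, so they send the determinant to zero or to a multiple of itself. The element
F = X_{-theta}(1) acts as a second order operator; commuting it past one factor produces the cofactor
C of the (1,1) entry with the coefficient 8s - 4k - 2(m-1), where s is the number of factors of Delta
to the right. Hence F Delta^n 1 = n (4(n-1) - 4k - 2(m-1)) C Delta^(n-1) 1, which vanishes at
k = n - (m+1)/2. The remaining positive root vectors are brackets of these or vanish for degree reasons.

That the vector is nonzero requires a part of the Poincare-Birkhoff-Witt theorem: a functional on the
enveloping algebra that is a character of the parabolic subalgebra from the right, and multiplicative
on words in the X_ij(-1). It is defined on sorted words in a basis, extended by straightening, and
evaluates the symmetric matrix (X_ij(-1)) at the identity matrix, where the determinant is 1.
*)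
theory Submission
  imports Defs
begin

section \<open>Linear extension and algebra homomorphisms\<close>

text \<open>Three obstacles shape the development. The bracket class carries no axioms and the
  invariant form is a definite description, so the Lie axioms of the affine algebra and the values
  of the form come before any central term; coordinates on the symplectic algebra, available because
  1 \<noteq> 0 in the Weyl algebra, make the form explicit. Next, the entries X_ij(-1) commute but
  sit in a noncommutative algebra. Row operations are carried out in a commutative subring, which F
  leaves: its commutators with the entries have degree 0 and must be moved right until they meet a
  power of the determinant, on which they act by scalars. This reordering is the origin of the term
  -2(m-1). Finally, the module is a quotient of formal combinations of tensors, so equations become
  membership in the left ideal annihilating the vacuum, and non-membership is witnessed by a
  functional. One linear function \<zeta> serves as the character of the parabolic subalgebra and
  gives the values on the X_ij(-1); the prescriptions do not conflict, since the two subspaces meet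
  in 0 and the second is abelian.\<close>

abbreviation clinear :: "('a::cvector \<Rightarrow> 'b::cvector) \<Rightarrow> bool" where
  "clinear \<equiv> Vector_Spaces.linear scaleC scaleC"

lemma clinear_iff:
  "clinear f \<longleftrightarrow> (\<forall>x y. f (x + y) = f x + f y) \<and> (\<forall>c x. f (c *\<^sub>C x) = c *\<^sub>C f x)"
  by (simp add: Vector_Spaces.linear_iff cvec.vector_space_axioms)

lemma clinearI:
  "(\<And>x y. f (x + y) = f x + f y) \<Longrightarrow> (\<And>c x. f (c *\<^sub>C x) = c *\<^sub>C f x) \<Longrightarrow> clinear f"
  by (simp add: clinear_iff)

lemma clinear_add: "clinear f \<Longrightarrow> f (x + y) = f x + f y"
  and clinear_scaleC: "clinear f \<Longrightarrow> f (c *\<^sub>C x) = c *\<^sub>C f x"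
  by (auto simp: clinear_iff)

lemma clinear_0: assumes "clinear f" shows "f 0 = 0"
  using clinear_scaleC[OF assms, of 0 0] by simp

lemma clinear_uminus: assumes "clinear f" shows "f (- x) = - f x"
  using clinear_scaleC[OF assms, of "-1" x] by simp

lemma clinear_diff: assumes "clinear f" shows "f (x - y) = f x - f y"
  using clinear_add[OF assms, of x "- y"] by (simp add: clinear_uminus[OF assms])

lemma clinear_sum: assumes "clinear f" shows "f (sum g A) = (\<Sum>a\<in>A. f (g a))"
  by (induction A rule: infinite_finite_induct) (simp_all add: clinear_0 clinear_add assms)

lemma scaleC_complex [simp]: "c *\<^sub>C (z :: complex) = c * z"
  by (simp add: scaleC_complex_def)

lemma clinear_vanish_span:
  assumes "clinear f" "\<And>x. x \<in> S \<Longrightarrow> f x = 0" "x \<in> cspan S"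
  shows "f x = 0"
  using assms(3)
  by (induction rule: cvec.span_induct_alt)
    (simp_all add: assms(1,2) clinear_0 clinear_add clinear_scaleC)

lemma clinear_eq_on_span:
  assumes "clinear f" "clinear g" "\<And>x. x \<in> S \<Longrightarrow> f x = g x" "x \<in> cspan S"
  shows "f x = g x"
  using assms(4)
  by (induction rule: cvec.span_induct_alt)
    (simp_all add: assms(1,2,3) clinear_0 clinear_add clinear_scaleC)

lemma clinear_compose: "clinear f \<Longrightarrow> clinear g \<Longrightarrow> clinear (\<lambda>x. f (g x))"
  by (simp add: clinear_iff)

lemma clinear_ident: "clinear (\<lambda>x. x)"
  by (simp add: clinear_iff)

lemma clinear_const_scaleC: "clinear f \<Longrightarrow> clinear (\<lambda>x. c *\<^sub>C f x)"
  by (simp add: clinear_iff scaleC_add_right scaleC_scaleC mult.commute)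

lemma clinear_scaleC_const: "clinear (f :: _ \<Rightarrow> complex) \<Longrightarrow> clinear (\<lambda>x. f x *\<^sub>C v)"
  by (simp add: clinear_iff scaleC_add_left scaleC_scaleC)

lemma clinear_sumI: "(\<And>i. i \<in> A \<Longrightarrow> clinear (f i)) \<Longrightarrow> clinear (\<lambda>x. \<Sum>i\<in>A. f i x)"
  by (simp add: clinear_iff sum.distrib cvec.scale_sum_right)

lemma clinear_addI: "clinear f \<Longrightarrow> clinear g \<Longrightarrow> clinear (\<lambda>x. f x + g x)"
  by (simp add: clinear_iff scaleC_add_right)

lemma clinear_diffI: "clinear f \<Longrightarrow> clinear g \<Longrightarrow> clinear (\<lambda>x. f x - g x)"
  by (simp add: clinear_iff cvec.scale_right_diff_distrib)

lemma clinear_times_left: "clinear f \<Longrightarrow> clinear (\<lambda>x. f x * (c :: 'r::calgebra))"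
  and clinear_times_right: "clinear f \<Longrightarrow> clinear (\<lambda>x. (c :: 'r::calgebra) * f x)"
  by (simp_all add: clinear_iff distrib_left distrib_right scaleC_mult_left scaleC_mult_right)

section \<open>Linear maps out of free vector spaces\<close>

definition lin_ext :: "('b \<Rightarrow> 'c::cvector) \<Rightarrow> ('b \<Rightarrow>\<^sub>0 complex) \<Rightarrow> 'c" where
  "lin_ext F p = (\<Sum>k\<in>Poly_Mapping.keys p. Poly_Mapping.lookup p k *\<^sub>C F k)"

lemma lin_ext_superset:
  "finite S \<Longrightarrow> Poly_Mapping.keys p \<subseteq> S \<Longrightarrow>
    lin_ext F p = (\<Sum>k\<in>S. Poly_Mapping.lookup p k *\<^sub>C F k)"
  unfolding lin_ext_def by (rule sum.mono_neutral_left) (auto simp: in_keys_iff)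

lemma clinear_lin_ext: "clinear (lin_ext F)"
proof (rule clinearI)
  fix p q :: "'a \<Rightarrow>\<^sub>0 complex" and c
  let ?S = "Poly_Mapping.keys p \<union> Poly_Mapping.keys q"
  have "Poly_Mapping.keys (p + q) \<subseteq> ?S" by (rule Poly_Mapping.keys_add)
  then show "lin_ext F (p + q) = lin_ext F p + lin_ext F q"
    by (simp add: lin_ext_superset[of ?S] lookup_add scaleC_add_left sum.distrib)
  have "lin_ext F (c *\<^sub>C p) = (\<Sum>k\<in>Poly_Mapping.keys p. Poly_Mapping.lookup (c *\<^sub>C p) k *\<^sub>C F k)"
    by (rule lin_ext_superset) (simp_all add: keys_scaleC_subset)
  then show "lin_ext F (c *\<^sub>C p) = c *\<^sub>C lin_ext F p"
    by (simp add: lin_ext_def lookup_scaleC scaleC_scaleC cvec.scale_sum_right)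
qed

lemma lin_ext_single [simp]: "lin_ext F (Poly_Mapping.single k c) = c *\<^sub>C F k"
  by (simp add: lin_ext_def)

lemma scaleC_single: "c *\<^sub>C Poly_Mapping.single k x = Poly_Mapping.single k (c *\<^sub>C x)"
  by (rule poly_mapping_eqI) (simp add: lookup_scaleC lookup_single when_def)

lemma poly_mapping_linear_induct [case_names zero add single]:
  fixes p :: "'b \<Rightarrow>\<^sub>0 'c::ab_group_add"
  assumes "P 0" "\<And>p q. P p \<Longrightarrow> P q \<Longrightarrow> P (p + q)" "\<And>k x. P (Poly_Mapping.single k x)"
  shows "P p"
proof -
  have "P (\<Sum>k\<in>A. Poly_Mapping.single k (Poly_Mapping.lookup p k))" for A
    by (induction A rule: infinite_finite_induct) (auto intro: assms)
  moreover have "(\<Sum>k\<in>Poly_Mapping.keys p. Poly_Mapping.single k (Poly_Mapping.lookup p k)) = p"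
    by (rule poly_mapping_eqI) (auto simp: lookup_sum lookup_single when_def in_keys_iff sum.delta)
  ultimately show ?thesis by metis
qed

lemma clinear_eq_poly_mapping:
  fixes f g :: "('b \<Rightarrow>\<^sub>0 complex) \<Rightarrow> 'c::cvector"
  assumes "clinear f" "clinear g" "\<And>k. f (Poly_Mapping.single k 1) = g (Poly_Mapping.single k 1)"
  shows "f p = g p"
proof (induction p rule: poly_mapping_linear_induct)
  case (single k x)
  have "Poly_Mapping.single k x = x *\<^sub>C Poly_Mapping.single k 1" by (simp add: scaleC_single)
  then show ?case by (simp only: clinear_scaleC[OF assms(1)] clinear_scaleC[OF assms(2)] assms(3))
qed (simp_all add: assms clinear_0 clinear_add)

text \<open>\<open>eval_free\<close> needs a target type of class \<open>calgebra\<close>, so linear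
  operators are packaged as a type before the Weyl algebra can be represented on
  polynomials.\<close>

typedef (overloaded) 'v endo = "{f :: 'v::cvector \<Rightarrow> 'v. clinear f}"
  by (rule exI[of _ "\<lambda>x. x"]) (simp add: clinear_ident)

setup_lifting type_definition_endo

instantiation endo :: (cvector) calgebra
begin
lift_definition zero_endo :: "'a endo" is "\<lambda>_. 0" by (simp add: clinear_iff)
lift_definition one_endo :: "'a endo" is "\<lambda>x. x" by (rule clinear_ident)
lift_definition plus_endo :: "'a endo \<Rightarrow> 'a endo \<Rightarrow> 'a endo" is "\<lambda>f g x. f x + g x"
  by (rule clinear_addI)
lift_definition minus_endo :: "'a endo \<Rightarrow> 'a endo \<Rightarrow> 'a endo" is "\<lambda>f g x. f x - g x"
  by (rule clinear_diffI)
lift_definition uminus_endo :: "'a endo \<Rightarrow> 'a endo" is "\<lambda>f x. - f x"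
  by (simp add: clinear_iff)
lift_definition times_endo :: "'a endo \<Rightarrow> 'a endo \<Rightarrow> 'a endo" is "\<lambda>f g x. f (g x)"
  by (rule clinear_compose)
lift_definition scaleC_endo :: "complex \<Rightarrow> 'a endo \<Rightarrow> 'a endo" is "\<lambda>c f x. c *\<^sub>C f x"
  by (rule clinear_const_scaleC)
instance
  by standard
    (transfer; simp add: fun_eq_iff clinear_iff scaleC_add_right scaleC_add_left scaleC_scaleC scaleC_one
      algebra_simps)+
end

section \<open>Evaluation homomorphisms of free algebras\<close>

lemma eval_free_lin_ext: "eval_free f = lin_ext (\<lambda>w. prod_list (map f (letters w)))"
  by (simp add: fun_eq_iff eval_free_def lin_ext_def)

lemma clinear_eval_free: "clinear (eval_free f)"
  unfolding eval_free_lin_ext by (rule clinear_lin_ext)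

lemma eval_free_gen [simp]: "eval_free f (gen x) = f x"
  by (simp add: eval_free_lin_ext gen_def)

lemma eval_free_1 [simp]: "eval_free f 1 = 1"
proof -
  have "eval_free f (Poly_Mapping.single 0 1) = 1"
    unfolding eval_free_lin_ext lin_ext_single by (simp add: zero_free_monoid_def)
  then show ?thesis by simp
qed

lemma clinear_mult_free: "clinear (\<lambda>q. p * (q :: 'x::monoid_add \<Rightarrow>\<^sub>0 complex))"
  "clinear (\<lambda>p. p * (q :: 'x::monoid_add \<Rightarrow>\<^sub>0 complex))"
  by (simp_all add: clinear_iff distrib_left distrib_right free_algebra_scaleC_mult_left
      free_algebra_scaleC_mult_right)

lemma eval_free_mult: "eval_free f (p * q) = eval_free f p * eval_free f q"
proof -
  have "eval_free f (Poly_Mapping.single w 1 * q) = eval_free f (Poly_Mapping.single w 1) * eval_free f q" for w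
    by (rule clinear_eq_poly_mapping[OF clinear_compose[OF clinear_eval_free clinear_mult_free(1)]
          clinear_times_right[OF clinear_eval_free]])
      (simp add: mult_single eval_free_lin_ext plus_free_monoid_def)
  then show ?thesis
    by (rule clinear_eq_poly_mapping[OF clinear_compose[OF clinear_eval_free clinear_mult_free(2)]
          clinear_times_left[OF clinear_eval_free]])
qed

lemma eval_free_ideal:
  assumes "\<And>s. s \<in> S \<Longrightarrow> eval_free f s = 0" "p \<in> ideal_gen S"
  shows "eval_free f p = 0"
  using assms(2) unfolding ideal_gen_def
  by (rule clinear_vanish_span[OF clinear_eval_free, rotated]) (auto simp: eval_free_mult assms(1))

lemma eval_free_cong_mod:
  assumes "\<And>s. s \<in> S \<Longrightarrow> eval_free f s = 0" "cong_mod (ideal_gen S) p q"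
  shows "eval_free f p = eval_free f q"
  using eval_free_ideal[OF assms(1), of S "p - q"] assms(2)
  by (simp add: cong_mod_def clinear_diff[OF clinear_eval_free])

text \<open>A homomorphism out of the free algebra is determined on the generators. Applied to the
  quotient map, this writes each element of an enveloping algebra as a combination of products of
  \<open>uea_of\<close>.\<close>

lemma eval_free_abs:
  fixes A :: "'x free_algebra \<Rightarrow> 'q::calgebra"
  assumes "clinear A" "A 1 = 1" "\<And>p q. A (p * q) = A p * A q"
  shows "eval_free (\<lambda>x. A (gen x)) p = A p"
proof (rule clinear_eq_poly_mapping[OF clinear_eval_free assms(1)])
  fix w
  have gen_mult: "gen x * Poly_Mapping.single (Word xs) 1 = Poly_Mapping.single (Word (x # xs)) 1"
    for x :: 'x and xs
    by (simp add: gen_def mult_single plus_free_monoid_def)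
  have "prod_list (map (\<lambda>x. A (gen x)) xs) = A (Poly_Mapping.single (Word xs) 1)" for xs
  proof (induction xs)
    case Nil
    show ?case using assms(2) unfolding single_one[symmetric] by (simp add: zero_free_monoid_def)
  next
    case (Cons x xs)
    then show ?case by (simp add: assms(3)[symmetric] gen_mult)
  qed
  from this[of "letters w"]
  show "eval_free (\<lambda>x. A (gen x)) (Poly_Mapping.single w 1) = A (Poly_Mapping.single w 1)"
    by (simp add: eval_free_lin_ext)
qed

section \<open>Universal enveloping algebras\<close>

lemma cong_mod_ideal_base: "s \<in> S \<Longrightarrow> p - q = s \<Longrightarrow> cong_mod (ideal_gen S) p q"
proof -
  assume s: "s \<in> S" "p - q = s"
  have "1 * s * 1 \<in> ideal_gen S" unfolding ideal_gen_def by (intro cvec.span_base) (use s in blast)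
  then show ?thesis by (simp add: cong_mod_def s)
qed

lemma clinear_uea_of: "clinear uea_of"
proof (rule clinearI)
  fix x y :: 'a and c
  show "uea_of (x + y) = uea_of x + uea_of y"
    by transfer (rule cong_mod_ideal_base[OF _ refl], unfold uea_rels_def diff_diff_eq[symmetric], blast)
  show "uea_of (c *\<^sub>C x) = c *\<^sub>C uea_of x"
    by transfer (rule cong_mod_ideal_base[OF _ refl], unfold uea_rels_def, blast)
qed

lemma uea_of_lie: "uea_of x * uea_of y - uea_of y * uea_of x = uea_of (lie x y)"
  by transfer (rule cong_mod_ideal_base[OF _ refl], unfold uea_rels_def, blast)

definition lie_hom :: "('a::lie_bracket \<Rightarrow> 'r::calgebra) \<Rightarrow> bool" where
  "lie_hom f \<longleftrightarrow> clinear f \<and> (\<forall>x y. f x * f y - f y * f x = f (lie x y))"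

lemma lie_hom_eval_rels: assumes "lie_hom f" "s \<in> uea_rels" shows "eval_free f s = 0"
  using assms unfolding uea_rels_def lie_hom_def
  by (auto simp: clinear_diff[OF clinear_eval_free] clinear_scaleC[OF clinear_eval_free] eval_free_mult
      clinear_add clinear_scaleC)

lemma abs_uea_surj: "\<exists>p. u = abs_uea p"
  by (rule exI[of _ "rep_uea u"]) (simp add: Quotient3_abs_rep[OF Quotient3_uea])

context
  fixes f :: "'a::lie_bracket \<Rightarrow> 'r::calgebra"
  assumes hom: "lie_hom f"
begin

text \<open>\<open>uea_lift\<close> evaluates some representative; its choice is immaterial because
  a Lie homomorphism sends the defining relations to 0.\<close>

lemma uea_lift_abs: "uea_lift f (abs_uea p) = eval_free f p"
proof -
  have "cong_mod (ideal_gen uea_rels) (rep_uea (abs_uea p)) p"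
    by (rule Quotient3_rep_abs[OF Quotient3_uea equivp_reflp[OF equivp_cong_mod_ideal]])
  then show ?thesis
    unfolding uea_lift_def by (intro eval_free_cong_mod lie_hom_eval_rels hom)
qed

lemma uea_lift_of: "uea_lift f (uea_of x) = f x"
  by (simp add: uea_of.abs_eq uea_lift_abs)

lemma uea_lift_1: "uea_lift f 1 = 1"
  by (simp add: one_uea.abs_eq uea_lift_abs)

lemma uea_lift_mult: "uea_lift f (u * v) = uea_lift f u * uea_lift f v"
proof -
  obtain p q where "u = abs_uea p" "v = abs_uea q"
    using abs_uea_surj by blast
  then show ?thesis
    by (simp add: times_uea.abs_eq uea_lift_abs eval_free_mult)
qed

lemma clinear_uea_lift: "clinear (uea_lift f)"
proof (rule clinearI)
  fix u v :: "'a uea" and c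
  obtain p q where "u = abs_uea p" "v = abs_uea q"
    using abs_uea_surj by blast
  then show "uea_lift f (u + v) = uea_lift f u + uea_lift f v"
    "uea_lift f (c *\<^sub>C u) = c *\<^sub>C uea_lift f u"
    by (simp_all add: plus_uea.abs_eq scaleC_uea.abs_eq uea_lift_abs clinear_add[OF clinear_eval_free]
        clinear_scaleC[OF clinear_eval_free])
qed

end

lemma clinear_abs_uea: "clinear (abs_uea :: 'a::lie_bracket free_algebra \<Rightarrow> _)"
  by (simp add: clinear_iff plus_uea.abs_eq scaleC_uea.abs_eq)

lemma abs_uea_eval_free: "abs_uea p = eval_free uea_of p"
  using eval_free_abs[OF clinear_abs_uea, of p]
  by (simp add: one_uea.abs_eq times_uea.abs_eq uea_of.abs_eq[abs_def])

lemma uea_span: "u \<in> cspan (range (\<lambda>xs. prod_list (map uea_of xs)))"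
proof -
  obtain p where p: "u = abs_uea p" using abs_uea_surj by blast
  show ?thesis
    unfolding p abs_uea_eval_free eval_free_def
    by (intro cvec.span_sum cvec.span_scale cvec.span_base) blast
qed

lemma uea_induct [case_names one gen add scale mult]:
  assumes "P 1" "\<And>x. P (uea_of x)" "\<And>u v. P u \<Longrightarrow> P v \<Longrightarrow> P (u + v)"
    "\<And>c u. P u \<Longrightarrow> P (c *\<^sub>C u)" "\<And>u v. P u \<Longrightarrow> P v \<Longrightarrow> P (u * v)"
  shows "P u"
  using uea_span[of u]
proof (induction rule: cvec.span_induct_alt)
  case base
  show ?case using assms(4)[OF assms(1), of 0] by simp
next
  case (step c x y)
  then obtain xs where xs: "x = prod_list (map uea_of xs)" by blast
  have "P (prod_list (map uea_of xs))" by (induction xs) (auto intro: assms)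
  then show ?case using step xs by (auto intro: assms)
qed

section \<open>The symplectic Lie algebra and its invariant form\<close>

text \<open>The symplectic form on A that is given by the commutator and preserved by the Lie
  algebra.\<close>

fun symp :: "'l weyl_gen \<Rightarrow> 'l weyl_gen \<Rightarrow> complex" where
  "symp (Ann i) (Cre j) = (if i = j then 1 else 0)"
| "symp (Cre i) (Ann j) = (if i = j then -1 else 0)"
| "symp _ _ = 0"

lemma symp_antisym: "symp h g = - symp g h"
  by (cases g; cases h) auto

text \<open>The scalar has to be explicit: the structure constants and the values of the invariant
  form are computed from it.\<close>

lemma weyl_of_rel: "weyl_of g * weyl_of h - weyl_of h * weyl_of g = symp g h *\<^sub>C 1"
proof -
  have AA: "weyl_of (Ann i) * weyl_of (Ann j) - weyl_of (Ann j) * weyl_of (Ann i) = 0" for i j :: 'a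
    by transfer (rule cong_mod_ideal_base[OF _ diff_zero], unfold weyl_rels_def, blast)
  have CC: "weyl_of (Cre i) * weyl_of (Cre j) - weyl_of (Cre j) * weyl_of (Cre i) = 0" for i j :: 'a
    by transfer (rule cong_mod_ideal_base[OF _ diff_zero], unfold weyl_rels_def, blast)
  have AC: "weyl_of (Ann i) * weyl_of (Cre j) - weyl_of (Cre j) * weyl_of (Ann i)
      = (if i = j then 1 else 0)" for i j :: 'a
  proof (cases "i = j")
    case True
    then show ?thesis
      by (simp only: if_True, transfer)
        (rule cong_mod_ideal_base[OF _ refl], force simp: weyl_rels_def)
  next
    case False
    then show ?thesis
      by (simp only: if_False, transfer)
        (rule cong_mod_ideal_base[OF _ diff_zero], force simp: weyl_rels_def)
  qed
  have CA: "weyl_of (Cre j) * weyl_of (Ann i) - weyl_of (Ann i) * weyl_of (Cre j)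
      = (if i = j then - 1 else 0)" for i j :: 'a
    using AC[of i j] by (auto simp: algebra_simps split: if_splits)
  show ?thesis
    by (cases g; cases h) (auto simp: AA CC AC CA)
qed

text \<open>The polynomial representation serves only to show that \<open>1 \<noteq> 0\<close> in the Weyl algebra.\<close>

lift_definition weyl_op :: "'l weyl_gen \<Rightarrow> (('l \<Rightarrow> nat) \<Rightarrow>\<^sub>0 complex) endo" is
  "\<lambda>g. case g of
     Ann i \<Rightarrow> lin_ext (\<lambda>f. Poly_Mapping.single (f(i := f i - 1)) (of_nat (f i)))
   | Cre i \<Rightarrow> lin_ext (\<lambda>f. Poly_Mapping.single (f(i := Suc (f i))) 1)"
  by (auto split: weyl_gen.split intro: clinear_lin_ext)

lemma endo_eqI:
  fixes S T :: "('b \<Rightarrow>\<^sub>0 complex) endo"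
  assumes "\<And>k. Rep_endo S (Poly_Mapping.single k 1) = Rep_endo T (Poly_Mapping.single k 1)"
  shows "S = T"
proof -
  have "Rep_endo S p = Rep_endo T p" for p
    by (rule clinear_eq_poly_mapping) (use Rep_endo assms in auto)
  then show ?thesis by (simp add: Rep_endo_inject[symmetric] fun_eq_iff)
qed

lemma weyl_op_simps:
  "Rep_endo (weyl_op (Ann i)) (Poly_Mapping.single f c) =
    Poly_Mapping.single (f(i := f i - 1)) (c * of_nat (f i))"
  "Rep_endo (weyl_op (Cre i)) (Poly_Mapping.single f c) = Poly_Mapping.single (f(i := Suc (f i))) c"
  by (simp_all add: weyl_op.rep_eq scaleC_single)

lemma weyl_op_rel: "s \<in> weyl_rels \<Longrightarrow> eval_free weyl_op s = 0"
proof -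
  \<comment> \<open>For \<open>k j = 0\<close> the truncated subtraction does no harm, because the
    coefficient is 0 as well.\<close>
  have upd: "Poly_Mapping.single (k(j := Suc (k j - Suc 0))) (of_nat (k j))
      = Poly_Mapping.single k (of_nat (k j) :: complex)" for k :: "'a \<Rightarrow> nat" and j
    by (cases "k j") (auto simp: fun_upd_idem)
  assume "s \<in> weyl_rels"
  then show ?thesis
    unfolding weyl_rels_def
    by (auto simp: clinear_diff[OF clinear_eval_free] eval_free_mult clinear_0[OF clinear_eval_free]
        intro!: endo_eqI simp: minus_endo.rep_eq times_endo.rep_eq zero_endo.rep_eq one_endo.rep_eq
        weyl_op_simps fun_upd_twist upd)
      (auto simp: fun_upd_twist upd single_add[symmetric] algebra_simps)
qed

text \<open>The vacuum expectation value: apply the operator to the constant polynomial 1 and read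
  off the constant term. It recovers c from c times 1.\<close>

definition weyl_const :: "'l weyl \<Rightarrow> complex" where
  "weyl_const u = Poly_Mapping.lookup
     (Rep_endo (eval_free weyl_op (rep_weyl u)) (Poly_Mapping.single (\<lambda>_. 0) 1)) (\<lambda>_. 0)"

lemma weyl_const_abs: "weyl_const (abs_weyl p) = Poly_Mapping.lookup
     (Rep_endo (eval_free weyl_op p) (Poly_Mapping.single (\<lambda>_. 0) 1)) (\<lambda>_. 0)"
proof -
  have "cong_mod (ideal_gen weyl_rels) (rep_weyl (abs_weyl p)) p"
    by (rule Quotient3_rep_abs[OF Quotient3_weyl equivp_reflp[OF equivp_cong_mod_ideal]])
  then have "eval_free weyl_op (rep_weyl (abs_weyl p)) = eval_free weyl_op p"
    by (intro eval_free_cong_mod weyl_op_rel)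
  then show ?thesis by (simp add: weyl_const_def)
qed

lemma abs_weyl_surj: "\<exists>p. u = abs_weyl p"
  by (rule exI[of _ "rep_weyl u"]) (simp add: Quotient3_abs_rep[OF Quotient3_weyl])

lemma clinear_weyl_const: "clinear weyl_const"
proof (rule clinearI)
  fix u v :: "'a weyl" and c
  obtain p q where "u = abs_weyl p" "v = abs_weyl q" using abs_weyl_surj by blast
  then show "weyl_const (u + v) = weyl_const u + weyl_const v"
    "weyl_const (c *\<^sub>C u) = c *\<^sub>C weyl_const u"
    by (simp_all add: plus_weyl.abs_eq scaleC_weyl.abs_eq weyl_const_abs clinear_add[OF clinear_eval_free]
        clinear_scaleC[OF clinear_eval_free] plus_endo.rep_eq scaleC_endo.rep_eq lookup_add lookup_scaleC)
qed

lemma weyl_const_1: "weyl_const 1 = 1"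
  by (simp add: one_weyl.abs_eq weyl_const_abs one_endo.rep_eq)

section \<open>Brackets of normally ordered products\<close>

lemma normal_ord_commutator:
  fixes x y z :: "'l weyl"
  assumes "x * z - z * x = c *\<^sub>C 1" "y * z - z * y = d *\<^sub>C 1"
  shows "normal_ord x y * z - z * normal_ord x y = d *\<^sub>C x + c *\<^sub>C y"
proof -
  have "normal_ord x y * z - z * normal_ord x y
      = (1/2) *\<^sub>C (x * (y * z - z * y) + (x * z - z * x) * y + y * (x * z - z * x) + (y * z - z * y) * x)"
    unfolding normal_ord_def commutator_scaleC_left by (simp add: algebra_simps)
  \<comment> \<open>Each of the two terms occurs twice in the sum; writing the factor 1 as 1/2 + 1/2
    matches them.\<close>
  also have "\<dots> = (1/2 + 1/2) *\<^sub>C (d *\<^sub>C x + c *\<^sub>C y)"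
    unfolding assms scaleC_add_left by (simp add: scaleC_mult_left scaleC_mult_right scaleC_add_right)
  finally show ?thesis by simp
qed

lemma clinear_normal_ord:
  "clinear (\<lambda>x. normal_ord x y)" "clinear (\<lambda>y. normal_ord x y)"
  unfolding normal_ord_def
  by (auto simp: clinear_iff scaleC_mult_left scaleC_mult_right distrib_left distrib_right
      scaleC_add_right scaleC_scaleC mult.commute)

lemma sp_of_commute: "sp_of g h = sp_of h g"
  by transfer (simp add: normal_ord_def add.commute)

text \<open>The commutator with \<open>:pq:\<close> is a derivation of the normally ordered product
  and maps A to A, so r and s are replaced in turn by their commutators with \<open>:pq:\<close>.
  All brackets of root vectors below are instances.\<close>

lemma lie_sp_of:
  "lie (sp_of p q) (sp_of r s) =
     symp q r *\<^sub>C sp_of p s + symp p r *\<^sub>C sp_of q s + symp q s *\<^sub>C sp_of p r + symp p s *\<^sub>C sp_of q r"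
proof (transfer, goal_cases)
  case (1 p q r s)
  let ?N = "normal_ord (weyl_of p) (weyl_of q)"
  have N: "?N * weyl_of z - weyl_of z * ?N = symp q z *\<^sub>C weyl_of p + symp p z *\<^sub>C weyl_of q" for z
    by (rule normal_ord_commutator) (rule weyl_of_rel)+
  have "?N * normal_ord (weyl_of r) (weyl_of s) - normal_ord (weyl_of r) (weyl_of s) * ?N =
     normal_ord (?N * weyl_of r - weyl_of r * ?N) (weyl_of s)
     + normal_ord (weyl_of r) (?N * weyl_of s - weyl_of s * ?N)"
    unfolding normal_ord_def[of "weyl_of r"] normal_ord_def[of _ "weyl_of s"] cvec.scale_right_distrib[symmetric]
    by (simp add: scaleC_mult_left scaleC_mult_right cvec.scale_right_diff_distrib[symmetric] algebra_simps
        normal_ord_def)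
  also have "\<dots> = symp q r *\<^sub>C normal_ord (weyl_of p) (weyl_of s) + symp p r *\<^sub>C normal_ord (weyl_of q) (weyl_of s)
     + symp q s *\<^sub>C normal_ord (weyl_of p) (weyl_of r) + symp p s *\<^sub>C normal_ord (weyl_of q) (weyl_of r)"
    unfolding N
    by (simp add: clinear_normal_ord[THEN clinear_add] clinear_normal_ord[THEN clinear_scaleC])
      (simp add: normal_ord_def add.commute)
  finally show ?case .
qed

lemma clinear_lie_sp: "clinear (\<lambda>x. lie x (y :: 'l sp))" "clinear (\<lambda>y. lie x (y :: 'l sp))"
  by (simp_all add: clinear_iff)
    (transfer; simp add: algebra_simps scaleC_mult_left scaleC_mult_right cvec.scale_right_diff_distrib)+

lemma lie_sp_antisym: "lie y x = - lie x (y :: 'l sp)"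
  by transfer simp

lemma lie_sp_jacobi: "lie x (lie y z) = lie (lie x y) z + lie y (lie x (z :: 'l sp))"
  by transfer (simp add: algebra_simps)

lemma clinear_Rep_sp: "clinear Rep_sp"
  by (simp add: clinear_iff plus_sp.rep_eq scaleC_sp.rep_eq)

text \<open>Bilinearity of the normally ordered product reduces its arguments to generators one at a
  time. The argument runs in the Weyl algebra, where the type was carved out, and \<open>G\<close>
  carries the span over from \<open>sp\<close>.\<close>

lemma sp_span: "x \<in> cspan {sp_of g h | g h. True}"
proof -
  let ?S = "{sp_of g h | g h. True} :: 'a sp set"
  define G where "G = {w. \<exists>x\<in>cspan ?S. Rep_sp x = w}"
  have sub: "cvec.subspace G"
  proof (rule cvec.subspaceI)
    show "0 \<in> G" unfolding G_def using cvec.span_zero zero_sp.rep_eq by blast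
  next
    fix v w assume "v \<in> G" "w \<in> G"
    then obtain x y where "x \<in> cspan ?S" "y \<in> cspan ?S" "v = Rep_sp x" "w = Rep_sp y"
      unfolding G_def by blast
    then show "v + w \<in> G"
      unfolding G_def by (auto intro!: bexI[of _ "x + y"] cvec.span_add simp: plus_sp.rep_eq)
  next
    fix c v assume "v \<in> G"
    then obtain x where "x \<in> cspan ?S" "v = Rep_sp x" unfolding G_def by blast
    then show "c *\<^sub>C v \<in> G"
      unfolding G_def by (auto intro!: bexI[of _ "c *\<^sub>C x"] cvec.span_scale simp: scaleC_sp.rep_eq)
  qed
  have gens: "normal_ord (weyl_of g) (weyl_of h) \<in> G" for g h
    unfolding G_def using sp_of.rep_eq[of g h] by (blast intro: cvec.span_base)
  have left: "normal_ord (weyl_of g) y \<in> G" if "y \<in> weyl_A" for g y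
    using that unfolding weyl_A_def
  proof (induction rule: cvec.span_induct_alt)
    case base
    show ?case using sub by (simp add: clinear_0[OF clinear_normal_ord(2)] cvec.subspace_0)
  next
    case (step c x y)
    then show ?case using sub gens
      by (auto simp: clinear_add[OF clinear_normal_ord(2)] clinear_scaleC[OF clinear_normal_ord(2)]
          intro!: cvec.subspace_add cvec.subspace_scale)
  qed
  have both: "normal_ord x y \<in> G" if "x \<in> weyl_A" "y \<in> weyl_A" for x y
    using that(1) unfolding weyl_A_def
  proof (induction rule: cvec.span_induct_alt)
    case base
    show ?case using sub by (simp add: clinear_0[OF clinear_normal_ord(1)] cvec.subspace_0)
  next
    case (step c x z)
    then show ?case using sub left[OF that(2)]
      by (auto simp: clinear_add[OF clinear_normal_ord(1)] clinear_scaleC[OF clinear_normal_ord(1)]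
          intro!: cvec.subspace_add cvec.subspace_scale)
  qed
  have "Rep_sp x \<in> cspan {normal_ord x y | x y. x \<in> weyl_A \<and> y \<in> weyl_A}"
    by (rule Rep_sp)
  then have "Rep_sp x \<in> G"
    by (rule subsetD[OF cvec.span_minimal[OF _ sub], rotated]) (use both in blast)
  then show ?thesis unfolding G_def by (auto simp: Rep_sp_inject)
qed

lemma scaleC_2: "2 *\<^sub>C x = x + x"
  using scaleC_add_left[of 1 1 x] by simp

lemma scaleC_4: "4 *\<^sub>C x = x + x + x + x"
  using scaleC_add_left[of 2 2 x] by (simp add: scaleC_2 add.assoc)

lemma clinear_sp_eqI:
  assumes "clinear f" "clinear g" "\<And>p q. f (sp_of p q) = g (sp_of p q)"
  shows "f x = g (x :: 'l sp)"
  by (rule clinear_eq_on_span[OF assms(1,2) _ sp_span]) (use assms(3) in blast)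

text \<open>For \<open>x\<close> in the symplectic algebra the iterated commutators \<open>[[x, g], h]\<close> are scalars.\<close>

definition sp_coord :: "'l sp \<Rightarrow> 'l weyl_gen \<Rightarrow> 'l weyl_gen \<Rightarrow> complex" where
  "sp_coord x g h = weyl_const
     ((Rep_sp x * weyl_of g - weyl_of g * Rep_sp x) * weyl_of h
      - weyl_of h * (Rep_sp x * weyl_of g - weyl_of g * Rep_sp x))"

lemma clinear_sp_coord: "clinear (\<lambda>x. sp_coord x g h)"
  unfolding sp_coord_def
  by (rule clinear_compose[OF clinear_weyl_const])
    (intro clinear_diffI clinear_times_left clinear_times_right clinear_Rep_sp)

lemma sp_coord_sp_of: "sp_coord (sp_of p q) g h = symp p g * symp q h + symp q g * symp p h"
proof -
  have N: "Rep_sp (sp_of p q) * weyl_of g - weyl_of g * Rep_sp (sp_of p q)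
      = symp q g *\<^sub>C weyl_of p + symp p g *\<^sub>C weyl_of q"
    unfolding sp_of.rep_eq by (rule normal_ord_commutator) (rule weyl_of_rel)+
  have "(symp q g *\<^sub>C weyl_of p + symp p g *\<^sub>C weyl_of q) * weyl_of h
      - weyl_of h * (symp q g *\<^sub>C weyl_of p + symp p g *\<^sub>C weyl_of q)
    = symp q g *\<^sub>C (weyl_of p * weyl_of h - weyl_of h * weyl_of p)
      + symp p g *\<^sub>C (weyl_of q * weyl_of h - weyl_of h * weyl_of q)"
    by (simp add: algebra_simps scaleC_mult_left scaleC_mult_right cvec.scale_right_diff_distrib)
  then show ?thesis
    unfolding sp_coord_def N
    by (simp add: weyl_of_rel clinear_add[OF clinear_weyl_const] clinear_scaleC[OF clinear_weyl_const]
        weyl_const_1)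
qed

lemma sp_coord_sym: "sp_coord x g h = sp_coord x h g"
  by (rule clinear_sp_eqI[OF clinear_sp_coord clinear_sp_coord]) (simp add: sp_coord_sp_of)

text \<open>Up to the sign \<open>gen_sign\<close>, conjugation gives the basis of A dual to the
  generators with respect to \<open>symp\<close>; the sums over generators below are contractions
  with it.\<close>

fun conj_gen :: "'l weyl_gen \<Rightarrow> 'l weyl_gen" where
  "conj_gen (Ann i) = Cre i"
| "conj_gen (Cre i) = Ann i"

fun gen_sign :: "'l weyl_gen \<Rightarrow> complex" where
  "gen_sign (Ann i) = 1"
| "gen_sign (Cre i) = - 1"

lemma symp_conj_gen: "symp r (conj_gen g) = (if g = r then gen_sign r else 0)"
  by (cases r; cases g) auto

lemma gen_sign_square: "gen_sign r * (gen_sign r * z) = z"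
  by (cases r) auto

instance weyl_gen :: (finite) finite
proof
  have "(UNIV :: 'a weyl_gen set) = range Ann \<union> range Cre"
    by (rule set_eqI, case_tac x) auto
  moreover have "finite (range Ann \<union> range Cre :: 'a weyl_gen set)" by simp
  ultimately show "finite (UNIV :: 'a weyl_gen set)" by (simp only:)
qed

text \<open>This is the trace of (ad x)(ad y) on the natural module A. The coordinates are those of
  \<open>symp\<close> applied to [x, g] and h; the minus sign arises from the antisymmetry of
  \<open>symp\<close> when the trace is contracted with the dual basis.\<close>

definition sp_trace_form :: "'l::finite sp \<Rightarrow> 'l sp \<Rightarrow> complex" where
  "sp_trace_form x y = - (\<Sum>g\<in>UNIV. \<Sum>h\<in>UNIV. gen_sign g * gen_sign h *
     sp_coord x g h * sp_coord y (conj_gen g) (conj_gen h))"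

lemma clinear_sp_trace_form:
  "clinear (\<lambda>x. sp_trace_form x y)" "clinear (\<lambda>y. sp_trace_form x y)"
  unfolding sp_trace_form_def
  by (simp_all add: clinear_iff clinear_add[OF clinear_sp_coord] clinear_scaleC[OF clinear_sp_coord]
      distrib_left distrib_right sum.distrib sum_distrib_left mult_ac)

lemma sp_trace_form_sp_of: "sp_trace_form x (sp_of r s) = - 2 * sp_coord x r s"
proof -
  have "sp_trace_form x (sp_of r s) = - (sp_coord x r s + sp_coord x s r)"
    unfolding sp_trace_form_def sp_coord_sp_of symp_conj_gen
    by (simp add: if_distrib[of "\<lambda>x. _ * x"] if_distrib[of "\<lambda>x. x * _"] distrib_left sum.distrib
        cong: if_cong)
      (simp add: gen_sign_square mult_ac)
  then show ?thesis by (simp add: sp_coord_sym[of x s r])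
qed

lemma sp_trace_form_sp_of_sp_of:
  "sp_trace_form (sp_of p q) (sp_of r s) = - 2 * (symp p r * symp q s + symp q r * symp p s)"
  by (simp add: sp_trace_form_sp_of sp_coord_sp_of)

lemma clinear_sp_eqI2:
  assumes "\<And>y. clinear (\<lambda>x. f x y)" "\<And>x. clinear (\<lambda>y. f x y)"
    "\<And>y. clinear (\<lambda>x. g x y)" "\<And>x. clinear (\<lambda>y. g x y)"
    "\<And>p q r s. f (sp_of p q) (sp_of r s) = g (sp_of p q) (sp_of r s)"
  shows "f x y = g x (y :: 'l sp)"
  by (rule clinear_sp_eqI[OF assms(1,3)], rule clinear_sp_eqI[OF assms(2,4)], rule assms(5))

lemma sp_trace_form_sym: "sp_trace_form x y = sp_trace_form y x"
proof (rule clinear_sp_eqI2[of sp_trace_form "\<lambda>x y. sp_trace_form y x"])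
  fix p q r s :: "'a weyl_gen"
  show "sp_trace_form (sp_of p q) (sp_of r s) = sp_trace_form (sp_of r s) (sp_of p q)"
    unfolding sp_trace_form_sp_of_sp_of
    by (simp add: symp_antisym[of p r] symp_antisym[of q s] symp_antisym[of q r] symp_antisym[of p s])
qed (rule clinear_sp_trace_form)+

lemma sp_trace_form_invariant: "sp_trace_form (lie x y) z = sp_trace_form x (lie y z)"
proof (rule clinear_sp_eqI2[of "\<lambda>x y. sp_trace_form (lie x y) z" "\<lambda>x y. sp_trace_form x (lie y z)"])
  fix p q r s
  show "sp_trace_form (lie (sp_of p q) (sp_of r s)) z = sp_trace_form (sp_of p q) (lie (sp_of r s) z)"
  proof (rule clinear_sp_eqI[of "\<lambda>z. sp_trace_form (lie (sp_of p q) (sp_of r s)) z"])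
    fix t u
    show "sp_trace_form (lie (sp_of p q) (sp_of r s)) (sp_of t u)
        = sp_trace_form (sp_of p q) (lie (sp_of r s) (sp_of t u))"
      unfolding lie_sp_of
      by (simp add: clinear_sp_trace_form[THEN clinear_add] clinear_sp_trace_form[THEN clinear_scaleC]
          sp_trace_form_sp_of_sp_of symp_antisym[of r p] symp_antisym[of r q]
          symp_antisym[of s p] symp_antisym[of s q] symp_antisym[of r s] algebra_simps)
  qed (rule clinear_sp_trace_form clinear_compose[OF clinear_sp_trace_form(2) clinear_lie_sp(2)])+
qed (rule clinear_sp_trace_form clinear_compose[OF clinear_sp_trace_form(1) clinear_lie_sp(1)]
    clinear_compose[OF clinear_sp_trace_form(1) clinear_lie_sp(2)]
    clinear_compose[OF clinear_sp_trace_form(2) clinear_lie_sp(1)])+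

section \<open>Weights and uniqueness of the invariant form\<close>

fun gen_weight :: "'l weyl_gen \<Rightarrow> 'l weight" where
  "gen_weight (Ann i) j = eps i j"
| "gen_weight (Cre i) j = - eps i j"

lemma lie_cartan_h_sp_of:
  "lie (cartan_h i) (sp_of g h) = (gen_weight g i + gen_weight h i) *\<^sub>C sp_of g h"
  unfolding cartan_h_def clinear_uminus[OF clinear_lie_sp(1)] lie_sp_of
  by (cases g; cases h) (auto simp: eps_def sp_of_commute scaleC_2)

lemma sp_of_weight_zero:
  assumes "\<And>i. gen_weight g i + gen_weight h i = 0"
  shows "\<exists>i. sp_of g h = - cartan_h i"
proof (cases g)
  case (Ann i)
  with assms[of i] obtain j where "h = Cre j" by (cases h) (auto simp: eps_def split: if_splits)
  with Ann assms[of i] show ?thesis by (auto simp: eps_def cartan_h_def split: if_splits)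
next
  case (Cre i)
  with assms[of i] obtain j where "h = Ann j" by (cases h) (auto simp: eps_def split: if_splits)
  with Cre assms[of i] show ?thesis by (auto simp: eps_def cartan_h_def sp_of_commute split: if_splits)
qed

text \<open>An invariant form is determined by its values on the Cartan subalgebra: a weight vector
  \<open>x\<close> of weight \<open>\<alpha> \<noteq> 0\<close> is \<open>[h, x]\<close> for some \<open>h\<close>, so its products are products with \<open>h\<close>.\<close>

lemma invariant_form_zero:
  fixes D :: "'l sp \<Rightarrow> 'l sp \<Rightarrow> complex"
  assumes D: "invariant_form D" and cartan: "\<And>i j. D (cartan_h i) (cartan_h j) = 0"
  shows "D x y = 0"
proof -
  have lin: "clinear (D x)" and sym: "D x y = D y x" and inv: "D (lie x y) z = D x (lie y z)" for x y z
    using D unfolding invariant_form_def by blast+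
  have lin': "clinear (\<lambda>x. D x y)" for y
    using lin[of y] by (simp add: sym[of _ y])
  note D_simps = clinear_0[OF lin] clinear_scaleC[OF lin] clinear_scaleC[OF lin'] clinear_uminus[OF lin]
    clinear_uminus[OF lin']
  have h0: "D (cartan_h i) z = 0" for i z
  proof (rule clinear_sp_eqI[OF lin, of "\<lambda>_. 0" _ z])
    show "clinear (\<lambda>_ :: 'l sp. 0 :: complex)" by (simp add: clinear_iff)
    fix g h
    show "D (cartan_h i) (sp_of g h) = 0"
    proof (cases "\<forall>j. gen_weight g j + gen_weight h j = 0")
      case True
      then obtain j where "sp_of g h = - cartan_h j" using sp_of_weight_zero by blast
      then show ?thesis by (simp add: D_simps cartan)
    next
      case False
      then obtain j where j: "gen_weight g j + gen_weight h j \<noteq> 0" by blast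
      have "lie (cartan_h i) (cartan_h j) = 0"
        unfolding cartan_h_def clinear_uminus[OF clinear_lie_sp(1)] clinear_uminus[OF clinear_lie_sp(2)] lie_sp_of
        by (simp add: sp_of_commute)
      then have "D (lie (cartan_h i) (cartan_h j)) (sp_of g h) = 0"
        by (simp add: clinear_0[OF lin'])
      then have "(gen_weight g j + gen_weight h j) * D (cartan_h i) (sp_of g h) = 0"
        unfolding inv lie_cartan_h_sp_of by (simp add: D_simps)
      with j show ?thesis by simp
    qed
  qed
  show ?thesis
  proof (rule clinear_sp_eqI[OF lin', of "\<lambda>_. 0" _ x])
    show "clinear (\<lambda>_ :: 'l sp. 0 :: complex)" by (simp add: clinear_iff)
    fix g h
    show "D (sp_of g h) y = 0"
    proof (cases "\<forall>j. gen_weight g j + gen_weight h j = 0")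
      case True
      then obtain j where "sp_of g h = - cartan_h j" using sp_of_weight_zero by blast
      then show ?thesis by (simp add: D_simps h0)
    next
      case False
      then obtain j where j: "gen_weight g j + gen_weight h j \<noteq> 0" by blast
      have "D (lie (cartan_h j) (sp_of g h)) y = 0"
        unfolding inv by (rule h0)
      with j show ?thesis unfolding lie_cartan_h_sp_of by (simp add: D_simps)
    qed
  qed
qed

text \<open>Invariance leaves a single scalar free: [X_{2 eps_i}, X_{-2 eps_i}] = -4 h_i makes
  distinct h_i orthogonal, and [X_{eps_i + eps_j}, X_{-(eps_i + eps_j)}] = -h_i - h_j makes their
  lengths equal. The normalization at \<theta> = 2 eps_1 fixes the scalar.\<close>

lemma normalized_form_cartan:
  fixes B :: "'l::{finite,linorder} sp \<Rightarrow> 'l sp \<Rightarrow> complex"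
  assumes B: "invariant_form B" and "normalized_form B"
  shows "B (cartan_h i) (cartan_h j) = (if i = j then 2 else 0)"
proof -
  have lin: "clinear (B x)" and sym: "B x y = B y x" and inv: "B (lie x y) z = B x (lie y z)" for x y z
    using B unfolding invariant_form_def by blast+
  have lin': "clinear (\<lambda>x. B x y)" for y
    using lin[of y] by (simp add: sym[of _ y])
  have offdiag: "B (cartan_h i) (cartan_h j) = 0" if "i \<noteq> j" for i j
  proof -
    have "lie (sp_of (Ann i) (Ann i)) (sp_of (Cre i) (Cre i)) = (- 4) *\<^sub>C cartan_h i"
      unfolding lie_sp_of cartan_h_def by (simp add: scaleC_4)
    moreover have "lie (sp_of (Cre i) (Cre i)) (cartan_h j) = 0"
      using that by (simp add: lie_sp_antisym[of "sp_of _ _"] lie_cartan_h_sp_of eps_def)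
    ultimately have "B ((- 4) *\<^sub>C cartan_h i) (cartan_h j) = 0"
      using inv[of "sp_of (Ann i) (Ann i)" "sp_of (Cre i) (Cre i)" "cartan_h j"] by (simp add: clinear_0[OF lin])
    then show ?thesis by (simp add: clinear_scaleC[OF lin'] clinear_uminus[OF lin'])
  qed
  have diag: "B (cartan_h i) (cartan_h i) = B (cartan_h j) (cartan_h j)" if "i \<noteq> j" for i j
  proof -
    let ?X = "sp_of (Ann i) (Ann j)" and ?Y = "sp_of (Cre i) (Cre j)"
    have XY: "lie ?X ?Y = - cartan_h i - cartan_h j"
      unfolding lie_sp_of cartan_h_def using that by (simp add: add.commute)
    have "lie ?Y (cartan_h i) = ?Y" "lie ?Y (cartan_h j) = ?Y"
      using that by (simp_all add: lie_sp_antisym[of "sp_of _ _"] lie_cartan_h_sp_of eps_def)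
    then have "B (lie ?X ?Y) (cartan_h i) = B (lie ?X ?Y) (cartan_h j)" by (simp add: inv)
    then show ?thesis
      unfolding XY by (simp add: clinear_diff[OF lin'] clinear_uminus[OF lin'] offdiag that that[symmetric])
  qed
  let ?o = "idx 1 :: 'l"
  obtain t where t: "t \<in> cartan" "\<And>i. B t (cartan_h i) = highest_root i" "B t t = 2"
    using assms(2) unfolding normalized_form_def by blast
  obtain u where u: "t = (\<Sum>i\<in>UNIV. u i *\<^sub>C cartan_h i)"
  proof -
    have "t \<in> range (\<lambda>u. \<Sum>i\<in>UNIV. u i *\<^sub>C cartan_h i)"
      using t(1) unfolding cartan_def
    proof (induction rule: cvec.span_induct_alt)
      case base
      show ?case by (rule range_eqI[of _ _ "\<lambda>_. 0"]) simp
    next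
      case (step c x y)
      then obtain i u where "x = cartan_h i" "y = (\<Sum>i\<in>UNIV. u i *\<^sub>C cartan_h i)" by blast
      then show ?case
        by (intro range_eqI[of _ _ "\<lambda>j. (if j = i then c else 0) + u j"])
          (simp add: scaleC_add_left sum.distrib if_distrib[of "\<lambda>x. x *\<^sub>C _"] cong: if_cong)
    qed
    then show ?thesis using that by blast
  qed
  have Bt: "B t z = (\<Sum>i\<in>UNIV. u i * B (cartan_h i) z)" for z
    unfolding u by (simp add: clinear_sum[OF lin'] clinear_scaleC[OF lin'])
  have Bti: "B t (cartan_h i) = u i * B (cartan_h i) (cartan_h i)" for i
  proof -
    have "B t (cartan_h i) = (\<Sum>j\<in>UNIV. if j = i then u i * B (cartan_h i) (cartan_h i) else 0)"
      unfolding Bt by (rule sum.cong) (auto simp: offdiag)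
    then show ?thesis by simp
  qed
  \<comment> \<open>Pairing with t is \<theta>, which is 2 at h_1 and 0 at the other h_i. Hence B(t,
    t) = 2 forces u_1 = 1, and then B(t, h_1) = 2 is the length of h_1.\<close>
  have "B t t = (\<Sum>i\<in>UNIV. u i * B (cartan_h i) t)" by (rule Bt)
  also have "\<dots> = (\<Sum>i\<in>UNIV. u i * highest_root i)" by (simp add: sym[of _ t] t(2))
  also have "\<dots> = 2 * u ?o"
    by (simp add: highest_root_def eps_def if_distrib[of "\<lambda>x. _ * x"] cong: if_cong)
  finally have "u ?o = 1" using t(3) by simp
  with Bti[of ?o] t(2)[of ?o] have "B (cartan_h ?o) (cartan_h ?o) = 2"
    by (simp add: highest_root_def eps_def)
  then have "B (cartan_h i) (cartan_h i) = 2" for i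
    using diag[of i ?o] by (cases "i = ?o") auto
  then show ?thesis by (simp add: offdiag)
qed

lemma invariant_form_sp_trace_form: "invariant_form sp_trace_form"
  unfolding invariant_form_def
  using clinear_sp_trace_form(2) sp_trace_form_sym sp_trace_form_invariant by blast

lemma sp_trace_form_cartan_h:
  "sp_trace_form (cartan_h i) (cartan_h j) = (if i = j then 2 else 0)"
  unfolding cartan_h_def
  by (simp add: clinear_sp_trace_form[THEN clinear_uminus] sp_trace_form_sp_of_sp_of)

text \<open>Evaluates the definite description. For existence, h_1 represents \<theta>; for
  uniqueness, the difference of two candidates is invariant and vanishes on the Cartan
  subalgebra.\<close>

lemma sp_form_eq: "sp_form = (sp_trace_form :: 'l::{finite,linorder} sp \<Rightarrow> _)"
  unfolding sp_form_def
proof (rule the_equality)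
  have "cartan_h (idx 1) \<in> (cartan :: 'l sp set)"
    unfolding cartan_def by (intro cvec.span_base) blast
  then have "normalized_form (sp_trace_form :: 'l sp \<Rightarrow> _)"
    unfolding normalized_form_def
    by (intro bexI[of _ "cartan_h (idx 1)"])
      (auto simp: sp_trace_form_cartan_h highest_root_def eps_def)
  then show "invariant_form (sp_trace_form :: 'l sp \<Rightarrow> _) \<and> normalized_form (sp_trace_form :: 'l sp \<Rightarrow> _)"
    by (simp add: invariant_form_sp_trace_form)
next
  fix B :: "'l sp \<Rightarrow> 'l sp \<Rightarrow> complex"
  assume B: "invariant_form B \<and> normalized_form B"
  have "invariant_form (\<lambda>x y. B x y - sp_trace_form x y)"
    using B invariant_form_sp_trace_form unfolding invariant_form_def
    by (auto intro: clinear_diffI)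
  then have "B x y - sp_trace_form x y = 0" for x y
    by (rule invariant_form_zero) (use B in \<open>simp add: normalized_form_cartan sp_trace_form_cartan_h\<close>)
  then show "B = sp_trace_form" by (simp add: fun_eq_iff)
qed

section \<open>The affine Lie algebra\<close>

lemma sp_form_sp_of:
  "sp_form (sp_of p q) (sp_of r s) =
    - 2 * (symp p r * symp q s + symp q r * symp p (s :: 'l::{finite,linorder} weyl_gen))"
  by (simp add: sp_form_eq sp_trace_form_sp_of_sp_of)

lemma clinear_sp_form:
  fixes y :: "'l::{finite,linorder} sp"
  shows "clinear (\<lambda>x. sp_form x y)" "clinear (\<lambda>x. sp_form y x)"
  by (simp_all add: sp_form_eq clinear_sp_trace_form)

lemma sp_form_sym: "sp_form x y = sp_form y (x :: 'l::{finite,linorder} sp)"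
  by (simp add: sp_form_eq sp_trace_form_sym)

lemma sp_form_invariant: "sp_form (lie x y) z = sp_form x (lie y (z :: 'l::{finite,linorder} sp))"
  by (simp add: sp_form_eq sp_trace_form_invariant)

lemmas lie_sp_0 = clinear_0[OF clinear_lie_sp(1)] clinear_0[OF clinear_lie_sp(2)]
lemmas sp_form_0 = clinear_0[OF clinear_sp_form(1)] clinear_0[OF clinear_sp_form(2)]

text \<open>The sums in the definition range over the supports of the arguments; additivity requires
  a common index set.\<close>

lemma loop_lie_superset:
  assumes "finite S" "finite T" "Poly_Mapping.keys f \<subseteq> S" "Poly_Mapping.keys g \<subseteq> T"
  shows "loop_lie f g = (\<Sum>n\<in>S. \<Sum>m\<in>T.
    Poly_Mapping.single (n + m) (lie (Poly_Mapping.lookup f n) (Poly_Mapping.lookup g m)))"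
proof -
  have "loop_lie f g = (\<Sum>n\<in>Poly_Mapping.keys f. \<Sum>m\<in>T.
    Poly_Mapping.single (n + m) (lie (Poly_Mapping.lookup f n) (Poly_Mapping.lookup g m)))"
    unfolding loop_lie_def
    by (intro sum.cong refl sum.mono_neutral_left)
      (use assms in \<open>auto simp: in_keys_iff lie_sp_0\<close>)
  also have "\<dots> = (\<Sum>n\<in>S. \<Sum>m\<in>T.
    Poly_Mapping.single (n + m) (lie (Poly_Mapping.lookup f n) (Poly_Mapping.lookup g m)))"
    by (intro sum.mono_neutral_left) (use assms in \<open>auto simp: in_keys_iff lie_sp_0\<close>)
  finally show ?thesis .
qed

lemma clinear_loop_lie:
  fixes f g :: "int \<Rightarrow>\<^sub>0 'l sp"
  shows "clinear (\<lambda>f. loop_lie f g)" "clinear (\<lambda>g. loop_lie f g)"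
proof -
  have keys: "Poly_Mapping.keys (x + y) \<subseteq> Poly_Mapping.keys x \<union> Poly_Mapping.keys y"
    for x y :: "int \<Rightarrow>\<^sub>0 'l sp" by (rule Poly_Mapping.keys_add)
  have add1: "loop_lie (x + y) g = loop_lie x g + loop_lie y g" for x y g :: "int \<Rightarrow>\<^sub>0 'l sp"
    by (simp add: loop_lie_superset[of "Poly_Mapping.keys x \<union> Poly_Mapping.keys y" "Poly_Mapping.keys g"]
        keys lookup_add clinear_add[OF clinear_lie_sp(1)] single_add sum.distrib)
  have add2: "loop_lie g (x + y) = loop_lie g x + loop_lie g y" for x y g :: "int \<Rightarrow>\<^sub>0 'l sp"
    by (simp add: loop_lie_superset[of "Poly_Mapping.keys g" "Poly_Mapping.keys x \<union> Poly_Mapping.keys y"]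
        keys lookup_add clinear_add[OF clinear_lie_sp(2)] single_add sum.distrib)
  have scale1: "loop_lie (c *\<^sub>C x) g = c *\<^sub>C loop_lie x g" for c and x g :: "int \<Rightarrow>\<^sub>0 'l sp"
    unfolding loop_lie_superset[OF finite_keys finite_keys keys_scaleC_subset order_refl]
    by (simp add: lookup_scaleC clinear_scaleC[OF clinear_lie_sp(1)] loop_lie_def cvec.scale_sum_right
        scaleC_single)
  have scale2: "loop_lie g (c *\<^sub>C x) = c *\<^sub>C loop_lie g x" for c and x g :: "int \<Rightarrow>\<^sub>0 'l sp"
    unfolding loop_lie_superset[OF finite_keys finite_keys order_refl keys_scaleC_subset]
    by (simp add: lookup_scaleC clinear_scaleC[OF clinear_lie_sp(2)] loop_lie_def cvec.scale_sum_right
        scaleC_single)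
  show "clinear (\<lambda>f. loop_lie f g)" "clinear (\<lambda>g. loop_lie f g)"
    by (simp_all add: clinear_iff add1 add2 scale1 scale2)
qed

lemma loop_lie_single:
  "loop_lie (Poly_Mapping.single n x) (Poly_Mapping.single m y) = Poly_Mapping.single (n + m) (lie x y)"
  by (subst loop_lie_superset[of "{n}" "{m}"]) auto

lemma loop_cocycle_superset:
  assumes "finite S" "Poly_Mapping.keys f \<subseteq> S"
  shows "loop_cocycle f g =
    (\<Sum>n\<in>S. of_int n * sp_form (Poly_Mapping.lookup f n) (Poly_Mapping.lookup g (- n)))"
  unfolding loop_cocycle_def
  by (intro sum.mono_neutral_left) (use assms in \<open>auto simp: in_keys_iff sp_form_0\<close>)

lemma clinear_loop_cocycle:
  fixes f g :: "int \<Rightarrow>\<^sub>0 'l::{finite,linorder} sp"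
  shows "clinear (\<lambda>f. loop_cocycle f g)" "clinear (\<lambda>g. loop_cocycle f g)"
proof -
  have keys: "Poly_Mapping.keys (x + y) \<subseteq> Poly_Mapping.keys x \<union> Poly_Mapping.keys y"
    for x y :: "int \<Rightarrow>\<^sub>0 'l sp" by (rule Poly_Mapping.keys_add)
  have add1: "loop_cocycle (x + y) g = loop_cocycle x g + loop_cocycle y g"
    for x y g :: "int \<Rightarrow>\<^sub>0 'l sp"
    by (simp add: loop_cocycle_superset[of "Poly_Mapping.keys x \<union> Poly_Mapping.keys y"]
        keys lookup_add clinear_add[OF clinear_sp_form(1)] sum.distrib distrib_left)
  have scale1: "loop_cocycle (c *\<^sub>C x) g = c * loop_cocycle x g" for c and x g :: "int \<Rightarrow>\<^sub>0 'l sp"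
    unfolding loop_cocycle_superset[OF finite_keys keys_scaleC_subset]
    by (simp add: lookup_scaleC clinear_scaleC[OF clinear_sp_form(1)] loop_cocycle_def sum_distrib_left mult_ac)
  show "clinear (\<lambda>f. loop_cocycle f g)" by (simp add: clinear_iff add1 scale1)
  show "clinear (\<lambda>g. loop_cocycle f g)"
    by (simp add: clinear_iff loop_cocycle_def lookup_add lookup_scaleC clinear_add[OF clinear_sp_form(2)]
        clinear_scaleC[OF clinear_sp_form(2)] distrib_left sum.distrib sum_distrib_left mult_ac)
qed

lemma loop_cocycle_single:
  "loop_cocycle (Poly_Mapping.single n x) (Poly_Mapping.single m y) =
    (if n + m = 0 then of_int n * sp_form x y else 0)"
  by (subst loop_cocycle_superset[of "{n}"]) (auto simp: lookup_single when_def sp_form_0)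

lemma lookup_loop_deriv: "Poly_Mapping.lookup (loop_deriv f) n = of_int n *\<^sub>C Poly_Mapping.lookup f n"
  unfolding loop_deriv_def lookup_sum
  by (auto simp: lookup_single when_def in_keys_iff sum.delta)

lemma clinear_loop_deriv: "clinear loop_deriv"
  by (simp add: clinear_iff poly_mapping_eq_iff fun_eq_iff lookup_loop_deriv lookup_add lookup_scaleC
      scaleC_add_right scaleC_scaleC mult.commute)

lemma loop_deriv_single: "loop_deriv (Poly_Mapping.single n x) = of_int n *\<^sub>C Poly_Mapping.single n x"
  by (rule poly_mapping_eqI) (simp add: lookup_loop_deriv lookup_scaleC lookup_single when_def)

lemma clinear_loop: "clinear loop" and clinear_c_coeff: "clinear c_coeff" and clinear_d_coeff: "clinear d_coeff"
  by (simp_all add: clinear_iff plus_affine_def scaleC_affine_def)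

lemma clinear_lie_affine: "clinear (\<lambda>x. lie x (y :: 'l::{finite,linorder} affine))"
  "clinear (\<lambda>y. lie x (y :: 'l::{finite,linorder} affine))"
  by (simp_all add: clinear_iff lie_affine_def plus_affine_def scaleC_affine_def
      clinear_loop_lie[THEN clinear_add] clinear_loop_lie[THEN clinear_scaleC]
      clinear_loop_cocycle[THEN clinear_add] clinear_loop_cocycle[THEN clinear_scaleC]
      clinear_add[OF clinear_loop_deriv] clinear_scaleC[OF clinear_loop_deriv]
      algebra_simps scaleC_add_left scaleC_add_right scaleC_scaleC cvec.scale_right_diff_distrib)

section \<open>Homogeneous generators and the Lie algebra axioms\<close>

definition aff_c :: "'l affine" where "aff_c = Affine 0 1 0"
definition aff_d :: "'l affine" where "aff_d = Affine 0 0 1"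

lemma clinear_loop_elem: "clinear (\<lambda>x. loop_elem x n :: 'l::{finite,linorder} affine)"
  by (simp add: clinear_iff loop_elem_def plus_affine_def scaleC_affine_def single_add scaleC_single)

lemma lie_aff_c: "lie aff_c (x :: 'l::{finite,linorder} affine) = 0"
  "lie (x :: 'l::{finite,linorder} affine) aff_c = 0"
  by (simp_all add: lie_affine_def aff_c_def zero_affine_def clinear_loop_lie[THEN clinear_0]
      clinear_loop_cocycle[THEN clinear_0] clinear_0[OF clinear_loop_deriv])

lemma lie_loop_elem:
  "lie (loop_elem x n) (loop_elem y m :: 'l::{finite,linorder} affine) =
    loop_elem (lie x y) (n + m) + (if n + m = 0 then of_int n * sp_form x y else 0) *\<^sub>C aff_c"
  by (simp add: lie_affine_def loop_elem_def aff_c_def plus_affine_def scaleC_affine_def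
      loop_lie_single loop_cocycle_single)

lemma lie_aff_d:
  "lie aff_d (loop_elem x n :: 'l::{finite,linorder} affine) = of_int n *\<^sub>C loop_elem x n"
  "lie (loop_elem x n :: 'l::{finite,linorder} affine) aff_d = (- of_int n) *\<^sub>C loop_elem x n"
  "lie aff_d (aff_d :: 'l::{finite,linorder} affine) = 0"
  by (simp_all add: lie_affine_def aff_d_def zero_affine_def loop_elem_def clinear_loop_lie[THEN clinear_0]
      clinear_loop_cocycle[THEN clinear_0] clinear_0[OF clinear_loop_deriv] loop_deriv_single
      scaleC_affine_def uminus_affine_def)

lemma affine_expand:
  "Affine f a b = (\<Sum>n\<in>Poly_Mapping.keys f. loop_elem (Poly_Mapping.lookup f n) n)
    + a *\<^sub>C aff_c + b *\<^sub>C (aff_d :: 'l::{finite,linorder} affine)"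
proof -
  let ?s = "\<Sum>n\<in>Poly_Mapping.keys f. loop_elem (Poly_Mapping.lookup f n) n :: 'l affine"
  have "loop ?s = (\<Sum>n\<in>Poly_Mapping.keys f. Poly_Mapping.single n (Poly_Mapping.lookup f n))"
    by (simp add: clinear_sum[OF clinear_loop] loop_elem_def)
  also have "\<dots> = f"
    by (rule poly_mapping_eqI) (auto simp: lookup_sum lookup_single when_def in_keys_iff sum.delta)
  finally have "loop ?s = f" .
  moreover have "c_coeff ?s = 0" "d_coeff ?s = 0"
    by (simp_all add: clinear_sum[OF clinear_c_coeff] clinear_sum[OF clinear_d_coeff] loop_elem_def)
  ultimately have "?s = Affine f 0 0" by (metis affine.collapse)
  then show ?thesis by (simp add: aff_c_def aff_d_def plus_affine_def scaleC_affine_def)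
qed

lemma affine_span:
  "x \<in> cspan ({loop_elem y n | y n. True} \<union> {aff_c, aff_d :: 'l::{finite,linorder} affine})"
proof (cases x)
  case (Affine f a b)
  show ?thesis
    unfolding Affine affine_expand
    by (intro cvec.span_add cvec.span_sum cvec.span_scale cvec.span_base) auto
qed

lemma clinear_affine_eqI:
  assumes "clinear f" "clinear g" "\<And>y n. f (loop_elem y n) = g (loop_elem y n)"
    "f aff_c = g aff_c" "f aff_d = g aff_d"
  shows "f x = g (x :: 'l::{finite,linorder} affine)"
  by (rule clinear_eq_on_span[OF assms(1,2) _ affine_span]) (use assms(3-) in auto)

lemma clinear_uminusI: "clinear f \<Longrightarrow> clinear (\<lambda>x. - f x)"
  by (simp add: clinear_iff)

lemma lie_affine_antisym: "lie y x = - lie x (y :: 'l::{finite,linorder} affine)"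
proof (rule clinear_affine_eqI[of "\<lambda>y. lie y x" "\<lambda>y. - lie x y"])
  have loop: "lie (loop_elem y n) x = - lie x (loop_elem y n)" for y n
  proof (rule clinear_affine_eqI[of "\<lambda>x. lie (loop_elem y n) x" "\<lambda>x. - lie x (loop_elem y n)"])
    fix z m
    have "of_int n * sp_form y z = - (of_int m * sp_form z y)" if "n + m = 0"
    proof -
      have "of_int n = - (of_int m :: complex)" using that by (metis add_eq_0_iff2 of_int_minus)
      then show ?thesis by (simp add: sp_form_sym[of y])
    qed
    then show "lie (loop_elem y n) (loop_elem z m) = - lie (loop_elem z m) (loop_elem y n)"
      unfolding lie_loop_elem
      by (simp add: add.commute[of m n] lie_sp_antisym[of y z] clinear_uminus[OF clinear_loop_elem])
  qed (simp_all add: clinear_lie_affine clinear_uminusI lie_aff_c lie_aff_d)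
  then show "lie (loop_elem y n) x = - lie x (loop_elem y n)" for y n .
  show "lie aff_d x = - lie x aff_d"
    by (rule clinear_affine_eqI[of "\<lambda>x. lie aff_d x" "\<lambda>x. - lie x aff_d"])
      (simp_all add: clinear_lie_affine clinear_uminusI lie_aff_c lie_aff_d)
qed (simp_all add: clinear_lie_affine clinear_uminusI lie_aff_c)

text \<open>By trilinearity it suffices to treat a(n), b(m), c(p) and the derivation d. With F = (a,
  [b, c]), invariance turns all three central terms into multiples of F, and they match because n =
  (n + m) - m.\<close>

lemma lie_affine_jacobi:
  "lie x (lie y z) = lie (lie x y) z + lie y (lie x (z :: 'l::{finite,linorder} affine))"
proof -
  have lin: "clinear (\<lambda>x. lie x (lie y z))" "clinear (\<lambda>x. lie (lie x y) z + lie y (lie x z))"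
    "clinear (\<lambda>y. lie x (lie y z))" "clinear (\<lambda>y. lie (lie x y) z + lie y (lie x z))"
    "clinear (\<lambda>z. lie x (lie y z))" "clinear (\<lambda>z. lie (lie x y) z + lie y (lie x z))"
    for x y z :: "'l affine"
    by (simp_all add: clinear_iff clinear_lie_affine[THEN clinear_add] clinear_lie_affine[THEN clinear_scaleC]
        scaleC_add_right)
  note simps = lie_loop_elem lie_aff_c lie_aff_d clinear_lie_affine[THEN clinear_add]
    clinear_lie_affine[THEN clinear_scaleC] clinear_lie_affine[THEN clinear_uminus] clinear_lie_affine[THEN clinear_0]
  have loops: "lie (loop_elem a n) (lie (loop_elem b m) (loop_elem c p)) =
      lie (lie (loop_elem a n) (loop_elem b m)) (loop_elem c p)
      + lie (loop_elem b m) (lie (loop_elem a n) (loop_elem c p :: 'l affine))" for a b c n m p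
  proof -
    have inv: "sp_form (lie a b) c = sp_form a (lie b c)" "sp_form b (lie a c) = - sp_form a (lie b c)"
      using sp_form_invariant[of a b c] sp_form_invariant[of b a c]
      by (simp_all add: lie_sp_antisym[of b a] clinear_uminus[OF clinear_sp_form(1)])
    let ?F = "sp_form a (lie b c)" and ?k = "\<lambda>r :: complex. (if n + m + p = 0 then r else 0) *\<^sub>C (aff_c :: 'l affine)"
    have "lie (loop_elem a n) (lie (loop_elem b m) (loop_elem c p)) =
        loop_elem (lie a (lie b c)) (n + m + p) + ?k (of_int n * ?F)"
      by (simp add: simps add.assoc)
    moreover have "lie (lie (loop_elem a n) (loop_elem b m)) (loop_elem c p) =
        loop_elem (lie (lie a b) c) (n + m + p) + ?k (of_int (n + m) * ?F)"
      by (simp add: simps inv)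
    moreover have "lie (loop_elem b m) (lie (loop_elem a n) (loop_elem c p)) =
        loop_elem (lie b (lie a c)) (n + m + p) + ?k (- of_int m * ?F)"
    proof -
      have eq: "m + (n + p) = n + m + p" by simp
      show ?thesis by (simp add: simps inv eq)
    qed
    moreover have "?k (of_int n * ?F) = ?k (of_int (n + m) * ?F) + ?k (- of_int m * ?F)"
      by (simp add: scaleC_add_left[symmetric] distrib_right del: cvec.scale_minus_left)
    ultimately show ?thesis
      by (simp only: lie_sp_jacobi[of a b c] clinear_add[OF clinear_loop_elem] ac_simps)
  qed
  have dloops: "lie aff_d (lie (loop_elem b m) (loop_elem c p)) =
      lie (lie aff_d (loop_elem b m)) (loop_elem c p)
      + lie (loop_elem b m) (lie aff_d (loop_elem c p :: 'l affine))" for b c m p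
  proof -
    let ?L = "loop_elem (lie b c) (m + p) :: 'l affine" and
      ?K = "(if m + p = 0 then of_int m * sp_form b c else 0) *\<^sub>C (aff_c :: 'l affine)"
    \<comment> \<open>The bracket with d loses the central term, which is consistent: that term is
      present only when m + p = 0.\<close>
    have K: "(of_int m + of_int p) *\<^sub>C ?K = 0"
      unfolding of_int_add[symmetric] scaleC_scaleC by (simp del: of_int_add)
    have "lie aff_d (lie (loop_elem b m) (loop_elem c p)) = (of_int m + of_int p) *\<^sub>C ?L"
      by (simp add: simps)
    also have "\<dots> = (of_int m + of_int p) *\<^sub>C (?L + ?K)"
      unfolding scaleC_add_right K by simp
    also have "\<dots> = lie (lie aff_d (loop_elem b m)) (loop_elem c p)
        + lie (loop_elem b m) (lie aff_d (loop_elem c p))"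
      unfolding scaleC_add_left by (simp only: simps)
    finally show ?thesis .
  qed
  have d: "lie aff_d (lie y z) = lie (lie aff_d y) z + lie y (lie aff_d z)" for y z :: "'l affine"
  proof (rule clinear_affine_eqI[OF lin(3,4)])
    fix b m
    show "lie aff_d (lie (loop_elem b m) z) =
        lie (lie aff_d (loop_elem b m)) z + lie (loop_elem b m) (lie aff_d z)"
      by (rule clinear_affine_eqI[OF lin(5,6)]) (simp_all add: dloops, simp_all add: simps)
  qed (simp_all add: simps)
  note anti = lie_affine_antisym[of _ aff_d]
  show ?thesis
  proof (rule clinear_affine_eqI[OF lin(1,2)])
    fix a n
    let ?a = "loop_elem a n :: 'l affine"
    show "lie ?a (lie y z) = lie (lie ?a y) z + lie y (lie ?a z)"
    proof (rule clinear_affine_eqI[OF lin(3,4)])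
      fix b m
      let ?b = "loop_elem b m :: 'l affine"
      show "lie ?a (lie ?b z) = lie (lie ?a ?b) z + lie ?b (lie ?a z)"
      proof (rule clinear_affine_eqI[OF lin(5,6)])
        show "lie ?a (lie ?b aff_d) = lie (lie ?a ?b) aff_d + lie ?b (lie ?a aff_d)"
          (is "?C = ?A + ?B")
        proof -
          \<comment> \<open>This is the derivation rule \<open>d\<close> for the pair
            \<open>?a\<close>, \<open>?b\<close>, with every bracket turned so that
            \<open>aff_d\<close> stands on the right.\<close>
          have "- ?A = ?B - ?C"
            using d[of ?a ?b] lie_affine_antisym[of "lie aff_d ?a" ?b]
            by (simp add: anti[THEN sym] lie_affine_antisym[of aff_d] clinear_lie_affine[THEN clinear_uminus])
          then have "?C - ?B = ?A" by (metis minus_diff_eq minus_minus)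
          then show ?thesis by (simp add: diff_eq_eq)
        qed
      qed (rule loops, simp add: simps)
    next
      show "lie ?a (lie aff_d z) = lie (lie ?a aff_d) z + lie aff_d (lie ?a z)"
        using d[of ?a z] by (simp add: lie_affine_antisym[of aff_d ?a] clinear_lie_affine[THEN clinear_uminus])
    qed (simp add: simps)
  qed (simp_all add: d simps)
qed

section \<open>Functionals on enveloping algebras, after Poincare, Birkhoff and Witt\<close>

text \<open>The Lie axioms are hypotheses because the class provides only the bracket.
  \<open>\<phi>0\<close> prescribes the functional on sorted words in the basis.\<close>

locale lie_basis =
  fixes B :: "'a::lie_bracket set" and lt :: "'a \<Rightarrow> 'a \<Rightarrow> bool" and \<phi>0 :: "'a list \<Rightarrow> complex"
  assumes clinear_lie_left: "\<And>y. clinear (\<lambda>x. lie x (y :: 'a))"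
    and clinear_lie_right: "\<And>x. clinear (\<lambda>y. lie x (y :: 'a))"
    and lie_antisym: "\<And>x y. lie y x = - lie x (y :: 'a)"
    and lie_jacobi: "\<And>x y z. lie x (lie y z) = lie (lie x y) z + lie y (lie x (z :: 'a))"
    and indep: "cvec.independent B" and span: "cspan B = UNIV"
    and lt_irrefl: "\<And>a. \<not> lt a a"
    and lt_trans: "\<And>a b c. lt a b \<Longrightarrow> lt b c \<Longrightarrow> lt a c"
    and lt_total: "\<And>a b. a \<noteq> b \<Longrightarrow> lt a b \<or> lt b a"
begin

definition coord :: "'a \<Rightarrow> 'a \<Rightarrow> complex" where
  "coord x = cvec.representation B x"

definition basis_ext :: "('a \<Rightarrow> complex) \<Rightarrow> 'a \<Rightarrow> complex" where
  "basis_ext \<psi> x = (\<Sum>b | coord x b \<noteq> 0. coord x b * \<psi> b)"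

lemma finite_coord: "finite {b. coord x b \<noteq> 0}"
  unfolding coord_def by (rule cvec.finite_representation)

lemma coord_in: "coord x b \<noteq> 0 \<Longrightarrow> b \<in> B"
  unfolding coord_def by (rule cvec.representation_ne_zero)

lemma coord_add: "coord (x + y) b = coord x b + coord y b"
  and coord_scale: "coord (c *\<^sub>C x) b = c * coord x b"
  unfolding coord_def
  by (simp_all add: cvec.representation_add[OF indep] cvec.representation_scale[OF indep] span)

lemma basis_ext_superset:
  "finite S \<Longrightarrow> {b. coord x b \<noteq> 0} \<subseteq> S \<Longrightarrow> basis_ext \<psi> x = (\<Sum>b\<in>S. coord x b * \<psi> b)"
  unfolding basis_ext_def by (rule sum.mono_neutral_left) auto

lemma clinear_basis_ext: "clinear (basis_ext \<psi>)"
proof (rule clinearI)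
  fix x y c
  let ?S = "{b. coord x b \<noteq> 0} \<union> {b. coord y b \<noteq> 0}"
  have "{b. coord (x + y) b \<noteq> 0} \<subseteq> ?S" by (auto simp: coord_add)
  then show "basis_ext \<psi> (x + y) = basis_ext \<psi> x + basis_ext \<psi> y"
    by (simp add: basis_ext_superset[of ?S] finite_coord coord_add distrib_right sum.distrib)
  have "basis_ext \<psi> (c *\<^sub>C x) = (\<Sum>b | coord x b \<noteq> 0. coord (c *\<^sub>C x) b * \<psi> b)"
    by (rule basis_ext_superset) (auto simp: finite_coord coord_scale)
  then show "basis_ext \<psi> (c *\<^sub>C x) = c *\<^sub>C basis_ext \<psi> x"
    by (simp add: coord_scale basis_ext_def sum_distrib_left mult.assoc)
qed

lemma basis_ext_basis: assumes "b \<in> B" shows "basis_ext \<psi> b = \<psi> b"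
proof -
  have "coord b = (\<lambda>b'. if b' = b then 1 else 0)"
    unfolding coord_def by (rule cvec.representation_basis[OF indep assms])
  then show ?thesis by (simp add: basis_ext_def)
qed

lemma basis_ext_clinear: assumes "clinear f" shows "basis_ext f x = f x"
  by (rule clinear_eq_on_span[OF clinear_basis_ext assms basis_ext_basis, of B]) (auto simp: span)

lemma basis_ext_cong: "(\<And>b. coord x b \<noteq> 0 \<Longrightarrow> \<psi> b = \<psi>' b) \<Longrightarrow> basis_ext \<psi> x = basis_ext \<psi>' x"
  unfolding basis_ext_def by (rule sum.cong) auto

lemma basis_ext_add: "basis_ext (\<lambda>b. \<psi> b + \<psi>' b) x = basis_ext \<psi> x + basis_ext \<psi>' x"
  by (simp add: basis_ext_def distrib_left sum.distrib)

lemma basis_ext_mult: "basis_ext (\<lambda>b. \<psi> b * c) x = basis_ext \<psi> x * c"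
  by (simp add: basis_ext_def sum_distrib_right mult.assoc)

lemma basis_ext_swap:
  "basis_ext (\<lambda>e. basis_ext (\<lambda>e'. \<psi> e e') y) x = basis_ext (\<lambda>e'. basis_ext (\<lambda>e. \<psi> e e') x) y"
  unfolding basis_ext_def sum_distrib_left by (subst sum.swap) (simp add: mult_ac)

lemma clinear_basis_eqI:
  "clinear f \<Longrightarrow> clinear g \<Longrightarrow> (\<And>b. b \<in> B \<Longrightarrow> f b = g b) \<Longrightarrow> f x = g x"
  by (rule clinear_eq_on_span[of f g B]) (auto simp: span)

section \<open>Straightening of words in the basis\<close>

fun inversions :: "'a list \<Rightarrow> nat" where
  "inversions [] = 0"
| "inversions (x # xs) = length (filter (\<lambda>y. lt y x) xs) + inversions xs"

lemma lt_asym: "lt a b \<Longrightarrow> \<not> lt b a"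
  using lt_trans lt_irrefl by blast

lemma inversions_swap: "lt c b \<Longrightarrow> inversions (u @ c # b # v) < inversions (u @ b # c # v)"
  by (induction u) (auto simp: lt_asym)

definition is_descent :: "'a list \<Rightarrow> 'a list \<times> 'a \<times> 'a \<times> 'a list \<Rightarrow> bool" where
  "is_descent w d \<longleftrightarrow> (case d of (u, b, c, v) \<Rightarrow> w = u @ b # c # v \<and> lt c b)"

text \<open>Applies bc = cb + [b, c] at some descent until the words are sorted. The bracket terms
  are shorter and the swapped word has fewer inversions, whence the lexicographic measure. The
  descent is chosen arbitrarily; that the result does not depend on it is the content of
  \<open>straighten_descent\<close>.\<close>

function straighten :: "'a list \<Rightarrow> complex" where
  "straighten w = (if \<exists>d. is_descent w d then
     (case (SOME d. is_descent w d) of (u, b, c, v) \<Rightarrow> straighten (u @ c # b # v) +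
       (\<Sum>e | coord (lie b c) e \<noteq> 0. coord (lie b c) e * straighten (u @ e # v)))
     else \<phi>0 w)"
  by pat_completeness auto
termination
proof -
  have split: "w = u @ b # c # v \<and> lt c b"
    if "\<exists>d. is_descent w d" "(u, d1) = (SOME d. is_descent w d)" "(b, d2) = d1" "(c, v) = d2"
    for w u b c v d1 d2
    using someI_ex[OF that(1)] that(2-) by (auto simp: is_descent_def)
  show ?thesis
  proof (relation "measures [length, inversions]")
    fix w u d1 b d2 c v
    assume "Ex (is_descent w)" "(u, d1) = Eps (is_descent w)" "(b, d2) = d1" "(c, v) = d2"
    then have "w = u @ b # c # v" "lt c b" using split by blast+
    then show "(u @ c # b # v, w) \<in> measures [length, inversions]" "(u @ e # v, w) \<in> measures [length, inversions]" for e
      by (simp_all add: inversions_swap)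
  qed simp
qed

declare straighten.simps [simp del]

lemma straighten_sorted: "(\<And>d. \<not> is_descent w d) \<Longrightarrow> straighten w = \<phi>0 w"
  by (subst straighten.simps) auto

definition rewritten :: "'a list \<Rightarrow> 'a \<Rightarrow> 'a \<Rightarrow> 'a list \<Rightarrow> complex" where
  "rewritten u b c v = straighten (u @ c # b # v) + basis_ext (\<lambda>e. straighten (u @ e # v)) (lie b c)"

lemma straighten_some_descent:
  assumes "is_descent w d"
  obtains u b c v where "w = u @ b # c # v" "lt c b" "straighten w = rewritten u b c v"
proof -
  obtain u b c v where d: "(SOME d. is_descent w d) = (u, b, c, v)" by (metis prod_cases4)
  with someI[of "is_descent w", OF assms] have "w = u @ b # c # v" "lt c b"
    by (auto simp: is_descent_def)
  moreover have "straighten w = rewritten u b c v"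
  proof -
    have "Ex (is_descent w)" using assms by blast
    then show ?thesis by (subst straighten.simps) (simp only: d if_True prod.case rewritten_def basis_ext_def)
  qed
  ultimately show thesis by (rule that)
qed

lemma lie_self: "lie x x = (0 :: 'a)"
proof -
  have "(2 :: complex) *\<^sub>C lie x x = lie x x + lie x x" by (rule scaleC_2)
  also have "\<dots> = 0" using lie_antisym[of x x] by (metis add.right_inverse)
  finally show ?thesis by simp
qed

text \<open>Antisymmetry reads the rule backwards, so that it has to be proved at descents
  only.\<close>

lemma rewritten_flip:
  "straighten (u @ c # b # v) = rewritten u c b v \<Longrightarrow> straighten (u @ b # c # v) = rewritten u b c v"
  by (simp add: rewritten_def lie_antisym[of b c] clinear_uminus[OF clinear_basis_ext])

lemma rewritten_refl: "straighten (u @ b # b # v) = rewritten u b b v"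
  by (simp add: rewritten_def lie_self clinear_0[OF clinear_basis_ext])

text \<open>The diamond lemma: the two ways of starting the rewriting of a word agree. Disjoint descents
  commute; for overlapping ones the difference vanishes by the Jacobi identity.\<close>

lemma straighten_descent:
  assumes "set (u @ b # c # v) \<subseteq> B"
  shows "straighten (u @ b # c # v) = rewritten u b c v"
  using assms
proof (induction "length u + length v" arbitrary: u b c v rule: less_induct)
  case (less u v b c)
  have shorter: "straighten (u' @ b' # c' # v') = rewritten u' b' c' v'"
    if "length u' + length v' < length u + length v" "set (u' @ b' # c' # v') \<subseteq> B" for u' b' c' v'
    using less.hyps that by blast
  \<comment> \<open>The outer induction covers shorter words; among words of the same length a
    second induction on the number of inversions is used.\<close>
  have descent: "straighten (u' @ b' # c' # v') = rewritten u' b' c' v'"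
    if "length u' + length v' = length u + length v" "set (u' @ b' # c' # v') \<subseteq> B" "lt c' b'" for u' b' c' v'
    using that
  proof (induction "inversions (u' @ b' # c' # v')" arbitrary: u' b' c' v' rule: less_induct)
    case (less u' b' c' v')
    have same: "straighten (x @ p # q # y) = rewritten x p q y"
      if "length x + length y = length u + length v" "set (x @ p # q # y) \<subseteq> B" "lt q p"
        "inversions (x @ p # q # y) < inversions (u' @ b' # c' # v')" for x p q y
      using less.hyps that by blast
    \<comment> \<open>The first descent starts to the left of the second. The list \<open>ts\<close>
      between their first letters is empty exactly when they overlap, that is, when q = p'.\<close>
    have diamond: "rewritten x p q y = rewritten x' p' q' y'"
      if w: "u' @ b' # c' # v' = x @ p # q # y" "u' @ b' # c' # v' = x' @ p' # q' # y'"
        and lts: "lt q p" "lt q' p'" and len: "length x < length x'" for x p q y x' p' q' y'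
    proof -
      from w have eq: "x @ p # q # y = x' @ p' # q' # y'" by simp
      have "x = take (length x) x'" using arg_cong[OF eq, of "take (length x)"] len by simp
      then obtain t where t: "x' = x @ t" by (metis append_take_drop_id)
      with len obtain t0 ts where ts: "t = t0 # ts" by (cases t) auto
      from eq t ts have t0: "t0 = p" and rest: "q # y = ts @ p' # q' # y'" by auto
      have lens: "length x + length y = length u + length v"
        using less.prems(1) arg_cong[OF w(1), of length] by simp
      have setB: "set (x @ p # q # y) \<subseteq> B" using less.prems(2) w(1) by simp
      show ?thesis
      proof (cases ts)
        case Nil
        then have x': "x' = x @ [p]" "q = p'" "y = q' # y'" using t ts t0 rest by auto
        \<comment> \<open>\<open>Q\<close> extends the straightening bilinearly in two adjacent
          letters of the shortened word and \<open>L\<close> linearly in one letter, so that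
          brackets may be inserted as letters.\<close>
        define Q where "Q r s = basis_ext (\<lambda>e. basis_ext (\<lambda>e'. straighten (x @ e # e' # y')) s) r" for r s
        define L where "L r = basis_ext (\<lambda>e. straighten (x @ e # y')) r" for r
        have Q1: "clinear (\<lambda>r. Q r s)" for s unfolding Q_def by (rule clinear_basis_ext)
        have Q2: "clinear (\<lambda>s. Q r s)" for r
          unfolding Q_def by (subst basis_ext_swap) (rule clinear_basis_ext)
        have L: "clinear L" unfolding L_def by (rule clinear_basis_ext)
        have QB1: "Q r s = basis_ext (\<lambda>e'. straighten (x @ r # e' # y')) s" if "r \<in> B" for r s
          unfolding Q_def by (rule basis_ext_basis[OF that])
        have QB2: "Q r s = basis_ext (\<lambda>e. straighten (x @ e # s # y')) r" if "s \<in> B" for r s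
          unfolding Q_def by (simp add: basis_ext_basis[OF that])
        \<comment> \<open>The words with two letters in place of the three are shorter, so the outer
          induction hypothesis applies on basis elements and extends to all r, s by
          bilinearity.\<close>
        have comm: "Q r s = Q s r + L (lie r s)" for r s
        proof (rule clinear_basis_eqI[of "\<lambda>r. Q r s" "\<lambda>r. Q s r + L (lie r s)"])
          show "clinear (\<lambda>r. Q s r + L (lie r s))"
            by (intro clinear_addI Q2 clinear_compose[OF L clinear_lie_left])
          fix r' assume r': "r' \<in> B"
          show "Q r' s = Q s r' + L (lie r' s)"
          proof (rule clinear_basis_eqI[of "\<lambda>s. Q r' s" "\<lambda>s. Q s r' + L (lie r' s)"])
            show "clinear (\<lambda>s. Q s r' + L (lie r' s))"
              by (intro clinear_addI Q1 clinear_compose[OF L clinear_lie_right])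
            fix s' assume s': "s' \<in> B"
            have "straighten (x @ r' # s' # y') = rewritten x r' s' y'"
              by (rule shorter) (use lens setB x' r' s' in auto)
            then show "Q r' s' = Q s' r' + L (lie r' s')"
              by (simp add: QB1[OF r'] QB1[OF s'] basis_ext_basis r' s' rewritten_def L_def)
          qed (rule Q2)
        qed (rule Q1)
        have B: "p \<in> B" "q \<in> B" "q' \<in> B" using setB x' by auto
        have lt3: "lt q p" "lt q' q" "lt q' p" using lts x' lt_trans by auto
        have wp: "u' @ b' # c' # v' = x @ p # q # q' # y'" using w(1) x' by simp
        have e1: "inversions (x @ q # p # q' # y') < inversions (u' @ b' # c' # v')"
          unfolding wp by (rule inversions_swap[OF lt3(1)])
        have e2: "inversions (x @ p # q' # q # y') < inversions (u' @ b' # c' # v')"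
          unfolding wp using inversions_swap[OF lt3(2), of "x @ [p]" y'] by simp
        have e3: "inversions (x @ q # q' # p # y') < inversions (u' @ b' # c' # v')"
          using inversions_swap[OF lt3(3), of "x @ [q]" y'] e1 by simp
        have e4: "inversions (x @ q' # p # q # y') < inversions (u' @ b' # c' # v')"
          using inversions_swap[OF lt3(3), of x "q # y'"] e2 by simp
        have "straighten (x @ q # p # q' # y') = rewritten (x @ [q]) p q' y'"
          using same[of "x @ [q]" y' p q'] lens setB x' lt3 e1 by simp
        moreover have "straighten (x @ q # q' # p # y') = rewritten x q q' (p # y')"
          using same[of x "p # y'" q q'] lens setB x' lt3 e3 by simp
        moreover have "straighten (x @ p # q' # q # y') = rewritten x p q' (q # y')"
          using same[of x "q # y'" p q'] lens setB x' lt3 e2 by simp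
        moreover have "straighten (x @ q' # p # q # y') = rewritten (x @ [q']) p q y'"
          using same[of "x @ [q']" y' p q] lens setB x' lt3 e4 by simp
        \<comment> \<open>Both routes reverse the triple p, q, q' completely; they differ by three
          products of a letter with a bracket, in opposite orders. By \<open>comm\<close> the
          differences are double brackets, which add up to 0.\<close>
        ultimately have
          "rewritten x p q y = straighten (x @ q' # q # p # y') + Q (lie q q') p + Q q (lie p q') + Q (lie p q) q'"
          "rewritten x' p' q' y' = straighten (x @ q' # q # p # y') + Q q' (lie p q) + Q (lie p q') q + Q p (lie q q')"
          by (simp_all add: rewritten_def x'(1,3) x'(2)[symmetric] QB1 QB2 B)
        moreover have "Q (lie q q') p + Q q (lie p q') + Q (lie p q) q'
            = Q q' (lie p q) + Q (lie p q') q + Q p (lie q q')"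
        proof -
          have "lie (lie q q') p + lie q (lie p q') + lie (lie p q) q' = 0"
          proof -
            have "lie q (lie p q') + lie (lie p q) q' = - lie (lie q q') p"
              using lie_jacobi[of p q q'] lie_antisym[of "lie q q'" p] by (simp add: add.commute)
            then show ?thesis by (simp add: add.assoc)
          qed
          then have "L (lie (lie q q') p) + L (lie q (lie p q')) + L (lie (lie p q) q') = 0"
            by (simp add: clinear_add[OF L, symmetric] clinear_0[OF L])
          then show ?thesis
            using comm[of "lie q q'" p] comm[of q "lie p q'"] comm[of "lie p q" q'] by (simp add: algebra_simps)
        qed
        ultimately show ?thesis by (simp only: add.assoc)
      next
        case (Cons t1 m)
        then have x': "x' = x @ p # q # m" and y: "y = m @ p' # q' # y'" using t ts t0 rest by auto
        have wp: "u' @ b' # c' # v' = x @ p # q # m @ p' # q' # y'" using w(1) y by simp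
        have e1: "inversions (x @ q # p # m @ p' # q' # y') < inversions (u' @ b' # c' # v')"
          unfolding wp by (rule inversions_swap[OF lts(1)])
        have e2: "inversions (x @ p # q # m @ q' # p' # y') < inversions (u' @ b' # c' # v')"
          unfolding wp using inversions_swap[OF lts(2), of "x @ p # q # m" y'] by simp
        have "straighten (x @ q # p # m @ p' # q' # y') = rewritten (x @ q # p # m) p' q' y'"
          using same[of "x @ q # p # m" y' p' q'] lens setB y lts e1 by simp
        moreover have "straighten (x @ p # q # m @ q' # p' # y') = rewritten x p q (m @ q' # p' # y')"
          using same[of x "m @ q' # p' # y'" p q] lens setB y lts e2 by simp
        moreover have "basis_ext (\<lambda>e. straighten (x @ e # m @ p' # q' # y')) (lie p q)
          = basis_ext (\<lambda>e. straighten (x @ e # m @ q' # p' # y')) (lie p q)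
            + basis_ext (\<lambda>e. basis_ext (\<lambda>e'. straighten (x @ e # m @ e' # y')) (lie p' q')) (lie p q)"
          unfolding basis_ext_add[symmetric]
        proof (rule basis_ext_cong)
          fix e assume "coord (lie p q) e \<noteq> 0"
          then have "e \<in> B" by (rule coord_in)
          then show "straighten (x @ e # m @ p' # q' # y') = straighten (x @ e # m @ q' # p' # y') +
              basis_ext (\<lambda>e'. straighten (x @ e # m @ e' # y')) (lie p' q')"
            using shorter[of "x @ e # m" y' p' q'] lens setB y by (simp add: rewritten_def)
        qed
        moreover have "basis_ext (\<lambda>e'. straighten (x @ p # q # m @ e' # y')) (lie p' q')
          = basis_ext (\<lambda>e'. straighten (x @ q # p # m @ e' # y')) (lie p' q')
            + basis_ext (\<lambda>e'. basis_ext (\<lambda>e. straighten (x @ e # m @ e' # y')) (lie p q)) (lie p' q')"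
          unfolding basis_ext_add[symmetric]
        proof (rule basis_ext_cong)
          fix e assume "coord (lie p' q') e \<noteq> 0"
          then have "e \<in> B" by (rule coord_in)
          then show "straighten (x @ p # q # m @ e # y') = straighten (x @ q # p # m @ e # y') +
              basis_ext (\<lambda>e'. straighten (x @ e' # m @ e # y')) (lie p q)"
            using shorter[of x "m @ e # y'" p q] lens setB y by (simp add: rewritten_def)
        qed
        ultimately show ?thesis
          by (simp add: rewritten_def x' y)
            (simp add: basis_ext_swap[of "\<lambda>e e'. straighten (x @ e # m @ e' # y')" "lie p' q'" "lie p q"])
      qed
    qed
    have "is_descent (u' @ b' # c' # v') (u', b', c', v')"
      using less.prems(3) by (simp add: is_descent_def)
    then obtain x p q y where x: "u' @ b' # c' # v' = x @ p # q # y" "lt q p"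
      "straighten (u' @ b' # c' # v') = rewritten x p q y" by (rule straighten_some_descent)
    consider "length x < length u'" | "length u' < length x" | "length x = length u'" by linarith
    then have "rewritten x p q y = rewritten u' b' c' v'"
    proof cases
      case 1
      then show ?thesis using diamond[of x p q y u' b' c' v'] x less.prems(3) by simp
    next
      case 2
      then show ?thesis using diamond[of u' b' c' v' x p q y] x less.prems(3) by simp
    next
      case 3
      then show ?thesis using x(1) by simp
    qed
    with x(3) show ?case by simp
  qed
  consider "lt c b" | "lt b c" | "b = c" using lt_total by blast
  then show ?case
  proof cases
    case 1
    then show ?thesis by (rule descent[OF refl less.prems])
  next
    case 2
    then have "straighten (u @ c # b # v) = rewritten u c b v"
      by (intro descent[OF refl]) (use less.prems in auto)
    then show ?thesis by (rule rewritten_flip)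
  next
    case 3
    then show ?thesis using rewritten_refl by simp
  qed
qed

section \<open>Multilinear extension to words in arbitrary letters\<close>

fun multi_ext :: "'a list \<Rightarrow> ('a list \<Rightarrow> complex) \<Rightarrow> complex" where
  "multi_ext [] \<psi> = \<psi> []"
| "multi_ext (x # xs) \<psi> = basis_ext (\<lambda>b. multi_ext xs (\<lambda>w. \<psi> (b # w))) x"

lemma multi_ext_append: "multi_ext (u @ v) \<psi> = multi_ext u (\<lambda>a. multi_ext v (\<lambda>b. \<psi> (a @ b)))"
  by (induction u arbitrary: \<psi>) simp_all

lemma multi_ext_cong:
  assumes "\<And>x b. x \<in> set xs \<Longrightarrow> coord x b \<noteq> 0 \<Longrightarrow> b \<in> C" "\<And>w. set w \<subseteq> C \<Longrightarrow> \<psi> w = \<psi>' w"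
  shows "multi_ext xs \<psi> = multi_ext xs \<psi>'"
  using assms
proof (induction xs arbitrary: \<psi> \<psi>')
  case (Cons x xs)
  show ?case
    unfolding multi_ext.simps
  proof (rule basis_ext_cong)
    fix b assume "coord x b \<noteq> 0"
    then have b: "b \<in> C" using Cons.prems(1)[of x b] by simp
    show "multi_ext xs (\<lambda>w. \<psi> (b # w)) = multi_ext xs (\<lambda>w. \<psi>' (b # w))"
    proof (rule Cons.IH)
      show "b' \<in> C" if "y \<in> set xs" "coord y b' \<noteq> 0" for y b'
        using Cons.prems(1)[of y b'] that by simp
      show "\<psi> (b # w) = \<psi>' (b # w)" if "set w \<subseteq> C" for w
        using Cons.prems(2)[of "b # w"] b that by simp
    qed
  qed
qed simp

lemma multi_ext_cong_basis: "(\<And>w. set w \<subseteq> B \<Longrightarrow> \<psi> w = \<psi>' w) \<Longrightarrow> multi_ext xs \<psi> = multi_ext xs \<psi>'"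
  by (rule multi_ext_cong[of _ B]) (auto dest: coord_in)

lemma multi_ext_add: "multi_ext xs (\<lambda>w. \<psi> w + \<psi>' w) = multi_ext xs \<psi> + multi_ext xs \<psi>'"
  by (induction xs arbitrary: \<psi> \<psi>') (simp_all add: basis_ext_add)

lemma multi_ext_mult: "multi_ext xs (\<lambda>w. \<psi> w * c) = multi_ext xs \<psi> * c"
  by (induction xs arbitrary: \<psi>) (simp_all add: basis_ext_mult)

lemma clinear_basis_ext_arg: "(\<And>b. clinear (\<lambda>x. F x b)) \<Longrightarrow> clinear (\<lambda>x. basis_ext (F x) y)"
  by (simp add: clinear_iff basis_ext_def distrib_left sum.distrib sum_distrib_left mult_ac)

lemma clinear_multi_ext: "clinear (\<lambda>x. multi_ext (u @ x # v) \<psi>)"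
  by (induction u arbitrary: \<psi>) (simp_all add: clinear_basis_ext clinear_basis_ext_arg)

text \<open>For basis letters this is \<open>straighten_descent\<close>. Linearity in x and then in
  y gives arbitrary letters, and the prefix u is absorbed by extending over words a in the
  basis.\<close>

lemma multi_ext_lie:
  "multi_ext (u @ x # y # v) straighten =
    multi_ext (u @ y # x # v) straighten + multi_ext (u @ lie x y # v) straighten"
proof -
  have "multi_ext (x # y # v) (\<lambda>w. straighten (a @ w))
      = multi_ext (y # x # v) (\<lambda>w. straighten (a @ w)) + multi_ext (lie x y # v) (\<lambda>w. straighten (a @ w))"
    if a: "set a \<subseteq> B" for a
  proof -
    let ?m = "\<lambda>w. multi_ext w (\<lambda>w. straighten (a @ w))"
    have m1: "clinear (\<lambda>x. ?m (x # w))" for w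
      using clinear_multi_ext[of "[]" w "\<lambda>w. straighten (a @ w)"] by (simp only: append_Nil)
    have m2: "clinear (\<lambda>y. ?m (x # y # v))" for x
      using clinear_multi_ext[of "[x]" v "\<lambda>w. straighten (a @ w)"] by (simp only: append_Nil append_Cons)
    have lin1: "clinear (\<lambda>x. ?m (y # x # v) + ?m (lie x y # v))" for y
      by (rule clinear_addI[OF m2 clinear_compose[OF m1 clinear_lie_left]])
    have lin2: "clinear (\<lambda>y. ?m (y # x # v) + ?m (lie x y # v))" for x
      by (rule clinear_addI[OF m1 clinear_compose[OF m1 clinear_lie_right]])
    show ?thesis
    proof (rule clinear_basis_eqI[of "\<lambda>x. ?m (x # y # v)" "\<lambda>x. ?m (y # x # v) + ?m (lie x y # v)",
          OF m1 lin1])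
      fix b assume b: "b \<in> B"
      show "?m (b # y # v) = ?m (y # b # v) + ?m (lie b y # v)"
      proof (rule clinear_basis_eqI[of "\<lambda>y. ?m (b # y # v)" "\<lambda>y. ?m (y # b # v) + ?m (lie b y # v)",
            OF m2 lin2])
        fix c assume c: "c \<in> B"
        have "multi_ext v (\<lambda>w. straighten (a @ b # c # w)) =
            multi_ext v (\<lambda>w. straighten (a @ c # b # w) + basis_ext (\<lambda>e. straighten (a @ e # w)) (lie b c))"
        proof (rule multi_ext_cong_basis)
          fix w assume "set w \<subseteq> B"
          then have "straighten (a @ b # c # w) = rewritten a b c w"
            by (intro straighten_descent) (use a b c in auto)
          then show "straighten (a @ b # c # w) =
              straighten (a @ c # b # w) + basis_ext (\<lambda>e. straighten (a @ e # w)) (lie b c)"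
            by (simp add: rewritten_def)
        qed
        moreover have "multi_ext v (\<lambda>w. basis_ext (\<lambda>e. straighten (a @ e # w)) r)
            = basis_ext (\<lambda>e. multi_ext v (\<lambda>w. straighten (a @ e # w))) r" for r
        proof -
          have "multi_ext v (\<lambda>w. basis_ext (\<lambda>e. \<psi> e w) r) = basis_ext (\<lambda>e. multi_ext v (\<psi> e)) r" for \<psi>
            by (induction v arbitrary: \<psi>) (simp_all add: basis_ext_swap[of _ r])
          then show ?thesis .
        qed
        ultimately show "?m (b # c # v) = ?m (c # b # v) + ?m (lie b c # v)"
          by (simp add: basis_ext_basis b c multi_ext_add)
      qed
    qed
  qed
  then show ?thesis
    unfolding multi_ext_append[of u] multi_ext_add[symmetric] by (intro multi_ext_cong_basis) blast
qed

section \<open>Descent of the functional to the enveloping algebra\<close>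

definition free_functional :: "'a free_algebra \<Rightarrow> complex" where
  "free_functional = lin_ext (\<lambda>w. multi_ext (letters w) straighten)"

text \<open>With p and q reduced to words, the first two kinds of relations express multilinearity
  and the third is \<open>multi_ext_lie\<close>.\<close>

lemma free_functional_rels:
  assumes "s \<in> uea_rels"
  shows "free_functional (p * s * q) = 0"
proof -
  let ?w = "\<lambda>w. Poly_Mapping.single w 1 :: 'a free_algebra"
  have lin: "clinear free_functional" unfolding free_functional_def by (rule clinear_lin_ext)
  have z: "clinear (\<lambda>_ :: 'a free_algebra. 0 :: complex)" by (simp add: clinear_iff)
  have words: "free_functional (?w a * s * ?w b) = 0" for a b
  proof -
    have 1: "free_functional (?w a * gen x * ?w b) = multi_ext (letters a @ x # letters b) straighten" for x
      by (simp add: gen_def mult_single plus_free_monoid_def free_functional_def)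
    have 2: "free_functional (?w a * (gen x * gen y) * ?w b)
        = multi_ext (letters a @ x # y # letters b) straighten" for x y
      by (simp add: gen_def mult_single plus_free_monoid_def free_functional_def)
    note ext = clinear_multi_ext[of "letters a" "letters b" straighten]
    note simps = right_diff_distrib left_diff_distrib clinear_diff[OF lin] 1 2 clinear_add[OF ext]
      clinear_scaleC[OF ext] free_algebra_scaleC_mult_left free_algebra_scaleC_mult_right
      clinear_scaleC[OF lin]
    from assms consider x y where "s = gen (x + y) - gen x - gen y"
      | c x where "s = gen (c *\<^sub>C x) - c *\<^sub>C gen x"
      | x y where "s = gen x * gen y - gen y * gen x - gen (lie x y)"
      unfolding uea_rels_def by blast
    then show ?thesis
    proof cases
      case (3 x y)
      then show ?thesis
        using multi_ext_lie[of "letters a" x y "letters b"] by (simp add: simps del: multi_ext.simps)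
    qed (simp_all add: simps)
  qed
  have "free_functional (?w a * s * q) = 0" for a
    by (rule clinear_eq_poly_mapping[OF clinear_compose[OF lin clinear_mult_free(1)] z words])
  then show ?thesis
    by (intro clinear_eq_poly_mapping[OF _ z, of "\<lambda>p. free_functional (p * s * q)" p])
      (simp_all add: clinear_iff distrib_right free_algebra_scaleC_mult_left clinear_add[OF lin]
        clinear_scaleC[OF lin])
qed

definition uea_functional :: "'a uea \<Rightarrow> complex" where
  "uea_functional u = free_functional (rep_uea u)"

lemma uea_functional_abs: "uea_functional (abs_uea p) = free_functional p"
proof -
  have lin: "clinear free_functional" unfolding free_functional_def by (rule clinear_lin_ext)
  have "cong_mod (ideal_gen uea_rels) (rep_uea (abs_uea p)) p"
    by (rule Quotient3_rep_abs[OF Quotient3_uea equivp_reflp[OF equivp_cong_mod_ideal]])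
  then have "rep_uea (abs_uea p) - p \<in> cspan {p * s * q | p s q. s \<in> uea_rels}"
    by (simp add: cong_mod_def ideal_gen_def)
  then have "free_functional (rep_uea (abs_uea p) - p) = 0"
    by (rule clinear_vanish_span[OF lin, rotated]) (auto simp: free_functional_rels)
  then show ?thesis by (simp add: uea_functional_def clinear_diff[OF lin])
qed

lemma clinear_uea_functional: "clinear uea_functional"
proof (rule clinearI)
  have lin: "clinear free_functional" unfolding free_functional_def by (rule clinear_lin_ext)
  fix u v :: "'a uea" and c
  obtain p q where "u = abs_uea p" "v = abs_uea q" using abs_uea_surj by blast
  then show "uea_functional (u + v) = uea_functional u + uea_functional v"
    "uea_functional (c *\<^sub>C u) = c *\<^sub>C uea_functional u"
    by (simp_all add: plus_uea.abs_eq scaleC_uea.abs_eq uea_functional_abs clinear_add[OF lin]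
        clinear_scaleC[OF lin])
qed

lemma uea_functional_word: "uea_functional (prod_list (map uea_of xs)) = multi_ext xs straighten"
proof -
  have "prod_list (map uea_of xs) = abs_uea (Poly_Mapping.single (Word xs) 1)"
    by (simp add: abs_uea_eval_free eval_free_lin_ext)
  then show ?thesis by (simp add: uea_functional_abs free_functional_def)
qed

text \<open>By transitivity and totality, a word without an adjacent descent is sorted for all pairs
  of positions.\<close>

lemma descent_cases:
  obtains "sorted_wrt (\<lambda>a b. \<not> lt b a) w" | u b c v where "w = u @ b # c # v" "lt c b"
proof -
  have "sorted_wrt (\<lambda>a b. \<not> lt b a) w \<or> (\<exists>u b c v. w = u @ b # c # v \<and> lt c b)"
  proof (induction w)
    case (Cons x xs)
    then show ?case
    proof (elim disjE)
      assume sorted: "sorted_wrt (\<lambda>a b. \<not> lt b a) xs"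
      show ?thesis
      proof (cases xs)
        case (Cons y ys)
        show ?thesis
        proof (cases "lt y x")
          case True
          then show ?thesis using Cons by (metis append_Nil)
        next
          case False
          have "\<not> lt z x" if "z \<in> set ys" for z
          proof
            assume "lt z x"
            moreover have "\<not> lt z y" using sorted Cons that by simp
            ultimately show False using False lt_total lt_trans by metis
          qed
          with False sorted Cons show ?thesis by simp
        qed
      qed simp
    next
      assume "\<exists>u b c v. xs = u @ b # c # v \<and> lt c b"
      then show ?thesis by (metis append_Cons)
    qed
  qed simp
  with that show thesis by blast
qed

lemma straighten_sorted_wrt:
  assumes "sorted_wrt (\<lambda>a b. \<not> lt b a) w"
  shows "straighten w = \<phi>0 w"
proof (rule straighten_sorted)
  fix d
  from assms show "\<not> is_descent w d" by (auto simp: is_descent_def sorted_wrt_append)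
qed

end

section \<open>Multiplicative initial values\<close>

context lie_basis
begin

text \<open>The hypotheses say that C spans a subalgebra on which \<zeta> is a character. They are
  applied twice, to a basis of P and to a basis of the abelian subalgebra T.\<close>

context
  fixes \<zeta> :: "'a \<Rightarrow> complex" and C :: "'a set"
  assumes \<zeta>: "clinear \<zeta>" and \<phi>0: "\<And>w. \<phi>0 w = prod_list (map \<zeta> w)" and CB: "C \<subseteq> B"
    and vanish: "\<And>p q. p \<in> C \<Longrightarrow> q \<in> C \<Longrightarrow> \<zeta> (lie p q) = 0"
    and closed: "\<And>p q b. p \<in> C \<Longrightarrow> q \<in> C \<Longrightarrow> coord (lie p q) b \<noteq> 0 \<Longrightarrow> b \<in> C"
begin

text \<open>The tail s may be in any order: swapping two of its letters does not change the product
  of values, and their bracket stays in the span of C, where \<zeta> kills it. With empty w this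
  computes words in C alone.\<close>

lemma straighten_prod:
  assumes "sorted_wrt (\<lambda>a b. \<not> lt b a) w" "set w \<subseteq> B" "set s \<subseteq> C"
    "\<And>a p. a \<in> set w \<Longrightarrow> p \<in> C \<Longrightarrow> lt a p"
  shows "straighten (w @ s) = prod_list (map \<zeta> (w @ s))"
  using assms(3)
proof (induction s rule: wf_induct[OF wf_measures[of "[length, inversions]"]])
  case (1 s)
  show ?case
  proof (cases rule: descent_cases[of s])
    case 1
    then have "sorted_wrt (\<lambda>a b. \<not> lt b a) (w @ s)"
      using assms(1,4) "1.prems" by (auto simp: sorted_wrt_append dest: lt_asym)
    then show ?thesis by (rule trans[OF straighten_sorted_wrt \<phi>0])
  next
    case (2 u b c v)
    then have uv: "set u \<subseteq> C" "set v \<subseteq> C" "b \<in> C" "c \<in> C" using "1.prems" by auto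
    have "straighten ((w @ u) @ b # c # v) = rewritten (w @ u) b c v"
      by (rule straighten_descent) (use assms(2) uv CB in auto)
    moreover have "straighten (w @ u @ c # b # v) = prod_list (map \<zeta> (w @ u @ c # b # v))"
      using "1.IH"[rule_format, of "u @ c # b # v"] inversions_swap[OF 2(2)] uv 2(1) by simp
    moreover have "basis_ext (\<lambda>e. straighten (w @ u @ e # v)) (lie b c) = 0"
    proof -
      let ?k = "prod_list (map \<zeta> (w @ u)) * prod_list (map \<zeta> v)"
      have "basis_ext (\<lambda>e. straighten (w @ u @ e # v)) (lie b c) = basis_ext (\<lambda>e. \<zeta> e * ?k) (lie b c)"
      proof (rule basis_ext_cong)
        fix e assume "coord (lie b c) e \<noteq> 0"
        then have "e \<in> C" using closed uv by blast
        then show "straighten (w @ u @ e # v) = \<zeta> e * ?k"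
          using "1.IH"[rule_format, of "u @ e # v"] uv 2(1) by (simp add: mult_ac)
      qed
      also have "\<dots> = \<zeta> (lie b c) * ?k"
        by (simp only: basis_ext_mult basis_ext_clinear[OF \<zeta>])
      finally show ?thesis using vanish uv by simp
    qed
    ultimately show ?thesis using 2(1) by (simp add: rewritten_def mult_ac)
  qed
qed

lemma multi_ext_prod:
  assumes "\<And>x b. x \<in> set xs \<Longrightarrow> coord x b \<noteq> 0 \<Longrightarrow> b \<in> C"
  shows "multi_ext xs straighten = prod_list (map \<zeta> xs)"
proof -
  have "multi_ext xs straighten = multi_ext xs (\<lambda>w. prod_list (map \<zeta> w))"
    by (rule multi_ext_cong[OF assms]) (use straighten_prod[of "[]"] in auto)
  also have "\<dots> = prod_list (map \<zeta> xs)"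
  proof -
    have "multi_ext xs (\<lambda>w. k * prod_list (map \<zeta> w)) = k * prod_list (map \<zeta> xs)" for k
    proof (induction xs arbitrary: k)
      case (Cons x xs)
      have "multi_ext (x # xs) (\<lambda>w. k * prod_list (map \<zeta> w))
          = basis_ext (\<lambda>b. multi_ext xs (\<lambda>w. (k * \<zeta> b) * prod_list (map \<zeta> w))) x"
        by (simp add: mult.assoc)
      also have "\<dots> = basis_ext (\<lambda>b. \<zeta> b * (k * prod_list (map \<zeta> xs))) x"
        by (simp only: Cons.IH) (simp add: mult_ac)
      finally show ?case by (simp only: basis_ext_mult basis_ext_clinear[OF \<zeta>]) (simp add: mult_ac)
    qed simp
    from this[of 1] show ?thesis by simp
  qed
  finally show ?thesis .
qed

text \<open>Below, \<open>C\<close> comes last in the order, so that a sorted word ends in its letters from \<open>C\<close>.\<close>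

lemma straighten_snoc:
  assumes order: "\<And>a p. a \<in> B - C \<Longrightarrow> p \<in> C \<Longrightarrow> lt a p" and "set u \<subseteq> B" "p \<in> C"
  shows "straighten (u @ [p]) = straighten u * \<zeta> p"
  using assms(2)
proof (induction u rule: wf_induct[OF wf_measures[of "[length, inversions]"]])
  case (1 w)
  show ?case
  proof (cases rule: descent_cases[of w])
    case 1
    let ?u = "takeWhile (\<lambda>x. x \<notin> C) w" and ?v = "dropWhile (\<lambda>x. x \<notin> C) w"
    have w: "w = ?u @ ?v" by simp
    have u: "set ?u \<subseteq> B - C" using "1.prems" by (auto dest: set_takeWhileD)
    have v: "set ?v \<subseteq> C"
    proof (cases ?v)
      case (Cons x xs)
      then have x: "x \<in> C" by (simp add: dropWhile_eq_Cons_conv)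
      have "y \<in> C" if "y \<in> set xs" for y
      proof (rule ccontr)
        assume "y \<notin> C"
        moreover have "y \<in> set w" using that Cons w by (metis Un_iff list.set_intros(2) set_append)
        ultimately have "lt y x" using order "1.prems" x by blast
        moreover have "sorted_wrt (\<lambda>a b. \<not> lt b a) (x # xs)"
          using 1 w Cons by (metis sorted_wrt_append)
        ultimately show False using that by simp
      qed
      then show ?thesis using x Cons by auto
    qed (simp only: list.set empty_subsetI)
    have sorted: "sorted_wrt (\<lambda>a b. \<not> lt b a) ?u"
      using 1 w by (metis sorted_wrt_append)
    have lt: "lt a p" if "a \<in> set ?u" "p \<in> C" for a p using order u that by blast
    have "straighten (?u @ ?v) = prod_list (map \<zeta> (?u @ ?v))"
      "straighten (?u @ (?v @ [p])) = prod_list (map \<zeta> (?u @ (?v @ [p])))"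
      by (rule straighten_prod[OF sorted]; use u v assms(3) lt in auto)+
    then have "straighten w = prod_list (map \<zeta> w)" "straighten (w @ [p]) = prod_list (map \<zeta> (w @ [p]))"
      unfolding append_assoc[symmetric] w[symmetric] by simp_all
    then show ?thesis by simp
  next
    case (2 u b c v)
    \<comment> \<open>Appending p preserves the descent, so both words are rewritten at the same
      place and the induction hypothesis applies term by term.\<close>
    have "straighten (u @ b # c # v) = rewritten u b c v"
      by (rule straighten_descent) (use 2(1) "1.prems" in auto)
    moreover have "straighten (u @ b # c # (v @ [p])) = rewritten u b c (v @ [p])"
      by (rule straighten_descent) (use 2(1) "1.prems" CB assms(3) in auto)
    moreover have "straighten ((u @ c # b # v) @ [p]) = straighten (u @ c # b # v) * \<zeta> p"
      using "1.IH"[rule_format, of "u @ c # b # v"] inversions_swap[OF 2(2)] 2(1) "1.prems" by simp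
    moreover have "basis_ext (\<lambda>e. straighten (u @ e # v @ [p])) (lie b c)
        = basis_ext (\<lambda>e. straighten (u @ e # v) * \<zeta> p) (lie b c)"
    proof (rule basis_ext_cong)
      fix e assume "coord (lie b c) e \<noteq> 0"
      then have "e \<in> B" by (rule coord_in)
      then show "straighten (u @ e # v @ [p]) = straighten (u @ e # v) * \<zeta> p"
        using "1.IH"[rule_format, of "u @ e # v"] 2(1) "1.prems" by simp
    qed
    ultimately show ?thesis using 2(1) by (simp add: rewritten_def basis_ext_mult distrib_right)
  qed
qed

text \<open>This is the property that makes the functional compatible with tensoring over the
  enveloping algebra of P.\<close>

lemma uea_functional_right:
  assumes "\<And>a p. a \<in> B - C \<Longrightarrow> p \<in> C \<Longrightarrow> lt a p" "\<And>b. coord p b \<noteq> 0 \<Longrightarrow> b \<in> C"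
  shows "uea_functional (u * uea_of p) = uea_functional u * \<zeta> p"
proof (rule clinear_eq_on_span[OF _ _ _ uea_span])
  show "clinear (\<lambda>u. uea_functional (u * uea_of p))"
    by (rule clinear_compose[OF clinear_uea_functional clinear_times_left[OF clinear_ident]])
  show "clinear (\<lambda>u. uea_functional u * \<zeta> p)" by (intro clinear_times_left clinear_uea_functional)
  fix x :: "'a uea" assume "x \<in> range (\<lambda>xs. prod_list (map uea_of xs))"
  then obtain xs where x: "x = prod_list (map uea_of xs)" by blast
  have "multi_ext (xs @ [p]) straighten = multi_ext xs (\<lambda>a. straighten a * \<zeta> p)"
    unfolding multi_ext_append
  proof (rule multi_ext_cong_basis)
    fix a assume a: "set a \<subseteq> B"
    have "multi_ext [p] (\<lambda>b. straighten (a @ b)) = basis_ext (\<lambda>b. \<zeta> b * straighten a) p"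
      unfolding multi_ext.simps
      by (rule basis_ext_cong) (use straighten_snoc assms a in \<open>simp add: mult.commute\<close>)
    then show "multi_ext [p] (\<lambda>b. straighten (a @ b)) = straighten a * \<zeta> p"
      by (simp only: basis_ext_mult basis_ext_clinear[OF \<zeta>] mult.commute)
  qed
  then show "uea_functional (x * uea_of p) = uea_functional x * \<zeta> p"
    using uea_functional_word[of "xs @ [p]"] uea_functional_word[of xs] by (simp add: x multi_ext_mult)
qed

end

end

text \<open>Placing C last makes straightening collect the letters of the subalgebra at the right
  end of a word, next to the inducing vector.\<close>

lemma strict_linear_order_exists:
  "\<exists>lt :: 'a \<Rightarrow> 'a \<Rightarrow> bool. (\<forall>a. \<not> lt a a) \<and> (\<forall>a b c. lt a b \<longrightarrow> lt b c \<longrightarrow> lt a c) \<and>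
    (\<forall>a b. a \<noteq> b \<longrightarrow> lt a b \<or> lt b a) \<and> (\<forall>a p. a \<notin> C \<longrightarrow> p \<in> C \<longrightarrow> lt a p)"
proof -
  obtain r :: "'a rel" where "well_order_on UNIV r" using well_order_on by blast
  then have r: "trans r" "antisym r" "total r" "refl r"
    by (auto simp: order_on_defs)
  define lt where "lt a b \<longleftrightarrow> (a \<notin> C \<and> b \<in> C) \<or> ((a \<in> C \<longleftrightarrow> b \<in> C) \<and> a \<noteq> b \<and> (a, b) \<in> r)" for a b
  have "lt a b \<Longrightarrow> lt b c \<Longrightarrow> lt a c" for a b c
    using r unfolding lt_def by (metis antisymD transD)
  moreover have "a \<noteq> b \<Longrightarrow> lt a b \<or> lt b a" for a b
    using r(3) unfolding lt_def total_on_def by blast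
  ultimately show ?thesis
    by (intro exI[of _ lt]) (auto simp: lt_def)
qed

section \<open>Bases adapted to two subspaces\<close>

lemma independent_Un_subspaces:
  assumes "cvec.independent X" "cvec.independent Y" "cspan X \<inter> cspan Y = {0}"
  shows "cvec.independent (X \<union> Y)"
proof
  assume "cvec.dependent (X \<union> Y)"
  then obtain S u v where S: "finite S" "S \<subseteq> X \<union> Y" "(\<Sum>w\<in>S. u w *\<^sub>C w) = 0" "v \<in> S" "u v \<noteq> 0"
    unfolding cvec.dependent_explicit by blast
  let ?x = "\<Sum>w\<in>S \<inter> X. u w *\<^sub>C w" and ?y = "\<Sum>w\<in>S - X. u w *\<^sub>C w"
  have sum: "?x + ?y = 0"
    using S(1,3) by (metis sum.Int_Diff)
  have x: "?x \<in> cspan X" by (intro cvec.span_sum cvec.span_scale cvec.span_base) blast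
  have y: "?y \<in> cspan Y" by (intro cvec.span_sum cvec.span_scale cvec.span_base) (use S(2) in blast)
  have "?x = - ?y" using sum by (simp add: eq_neg_iff_add_eq_0)
  then have "?x \<in> cspan X \<inter> cspan Y" using x cvec.span_neg[OF y] by simp
  then have "?x = 0" "?y = 0" using assms(3) sum by auto
  moreover have "u v = 0" if "v \<in> X"
    by (rule cvec.independentD[OF assms(1), of "S \<inter> X"]) (use S calculation that in auto)
  moreover have "u v = 0" if "v \<notin> X"
    by (rule cvec.independentD[OF assms(2), of "S - X"]) (use S calculation that in auto)
  ultimately show False using S(5) by blast
qed

lemma independent_basis_of_subspace:
  assumes "cvec.subspace P"
  obtains X where "X \<subseteq> P" "cvec.independent X" "cspan X = P"
proof -
  obtain X where "X \<subseteq> P" "cvec.independent X" "P \<subseteq> cspan X"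
    using cvec.maximal_independent_subset by blast
  moreover from this have "cspan X \<subseteq> P" using assms by (simp add: cvec.span_minimal)
  ultimately show thesis using that by blast
qed

text \<open>The functional that witnesses that a module induced from the character \<open>\<zeta>\<close> of the
  subalgebra \<open>P\<close> does not collapse on words in the abelian subalgebra \<open>T\<close>.\<close>

theorem induced_functional_exists:
  fixes \<zeta> :: "'a::lie_bracket \<Rightarrow> complex" and P T :: "'a set"
  assumes lie: "\<And>y. clinear (\<lambda>x. lie x (y :: 'a))" "\<And>x. clinear (\<lambda>y. lie x (y :: 'a))"
      "\<And>x y. lie y x = - lie x (y :: 'a)"
      "\<And>x y z. lie x (lie y z) = lie (lie x y) z + lie y (lie x (z :: 'a))"
    and \<zeta>: "clinear \<zeta>"
    and P: "cvec.subspace P" "\<And>p q. p \<in> P \<Longrightarrow> q \<in> P \<Longrightarrow> lie p q \<in> P"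
      "\<And>p q. p \<in> P \<Longrightarrow> q \<in> P \<Longrightarrow> \<zeta> (lie p q) = 0"
    and T: "cvec.subspace T" "\<And>x y. x \<in> T \<Longrightarrow> y \<in> T \<Longrightarrow> lie x y = 0" and PT: "P \<inter> T = {0}"
  obtains \<Phi> :: "'a uea \<Rightarrow> complex" where "clinear \<Phi>"
    "\<And>u p. p \<in> P \<Longrightarrow> \<Phi> (u * uea_of p) = \<Phi> u * \<zeta> p"
    "\<And>xs. set xs \<subseteq> T \<Longrightarrow> \<Phi> (prod_list (map uea_of xs)) = prod_list (map \<zeta> xs)"
proof -
  obtain X where X: "X \<subseteq> P" "cvec.independent X" "cspan X = P"
    using P(1) by (rule independent_basis_of_subspace)
  obtain Y where Y: "Y \<subseteq> T" "cvec.independent Y" "cspan Y = T"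
    using T(1) by (rule independent_basis_of_subspace)
  have "cvec.independent (X \<union> Y)"
    by (rule independent_Un_subspaces) (use X Y PT in auto)
  \<comment> \<open>Since B contains bases of both P and T, the coordinates of an element of either
    subspace are supported in X or in Y respectively.\<close>
  then obtain B where B: "X \<union> Y \<subseteq> B" "B \<subseteq> UNIV" "cvec.independent B" "UNIV \<subseteq> cspan B"
    by (rule cvec.maximal_independent_subset_extend[of "X \<union> Y" UNIV, OF subset_UNIV])
  obtain lt :: "'a \<Rightarrow> 'a \<Rightarrow> bool" where lt: "\<And>a. \<not> lt a a" "\<And>a b c. lt a b \<Longrightarrow> lt b c \<Longrightarrow> lt a c"
    "\<And>a b. a \<noteq> b \<Longrightarrow> lt a b \<or> lt b a" "\<And>a p. a \<notin> X \<Longrightarrow> p \<in> X \<Longrightarrow> lt a p"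
    using strict_linear_order_exists[of X] by blast
  have spanB: "cspan B = UNIV" using B(4) by auto
  interpret lie_basis B lt "\<lambda>w. prod_list (map \<zeta> w)"
    by (rule lie_basis.intro) (fact lie(1) lie(2) lie(3) lie(4) B(3) spanB lt(1) lt(2) lt(3))+
  have coord_sub: "b \<in> Z" if "Z \<subseteq> B" "x \<in> cspan Z" "coord x b \<noteq> 0" for Z x b
  proof -
    have "cvec.representation B x = cvec.representation Z x"
      by (rule cvec.representation_extend[OF B(3) that(2,1)])
    then show ?thesis using that(3) unfolding coord_def by (metis cvec.representation_ne_zero)
  qed
  have closedX: "b \<in> X" if "p \<in> X" "q \<in> X" "coord (lie p q) b \<noteq> 0" for p q b
  proof -
    have "lie p q \<in> cspan X" using P(2)[of p q] X that by auto
    then show ?thesis using coord_sub[of X] that(3) B(1) by blast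
  qed
  have vanishX: "\<zeta> (lie p q) = 0" if "p \<in> X" "q \<in> X" for p q
    using P(3) X(1) that by blast
  have zeroY: "lie p q = 0" if "p \<in> Y" "q \<in> Y" for p q
    using T(2) Y(1) that by blast
  have coord_0: "coord 0 b = 0" for b
    unfolding coord_def by (simp add: cvec.representation_zero)
  show thesis
  proof (rule that[of uea_functional])
    show "clinear uea_functional" by (rule clinear_uea_functional)
    have XB: "X \<subseteq> B" and YB: "Y \<subseteq> B" using B(1) by auto
    show "uea_functional (u * uea_of p) = uea_functional u * \<zeta> p" if "p \<in> P" for u p
    proof (rule uea_functional_right[OF \<zeta> refl XB vanishX closedX])
      show "lt a p" if "a \<in> B - X" "p \<in> X" for a p using lt(4) that by blast
      show "b \<in> X" if "coord p b \<noteq> 0" for b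
        using coord_sub[OF XB _ that] X(3) \<open>p \<in> P\<close> by simp
    qed
    show "uea_functional (prod_list (map uea_of xs)) = prod_list (map \<zeta> xs)" if "set xs \<subseteq> T" for xs
      unfolding uea_functional_word
    proof (rule multi_ext_prod[OF \<zeta> refl YB])
      show "\<zeta> (lie p q) = 0" if "p \<in> Y" "q \<in> Y" for p q
        using zeroY[OF that] clinear_0[OF \<zeta>] by simp
      show "b \<in> Y" if "p \<in> Y" "q \<in> Y" "coord (lie p q) b \<noteq> 0" for p q b
        using that(3) unfolding zeroY[OF that(1,2)] coord_0 by simp
      show "b \<in> Y" if "x \<in> set xs" "coord x b \<noteq> 0" for x b
        using coord_sub[OF YB _ that(2)] that(1) Y(3) \<open>set xs \<subseteq> T\<close> by blast
    qed
  qed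
qed

section \<open>Generalized Verma modules\<close>

lemma clinear_Rep_parabolic: "clinear (Rep_parabolic :: 'l::{finite,linorder} parabolic \<Rightarrow> _)"
  by (simp add: clinear_iff plus_parabolic.rep_eq scaleC_parabolic.rep_eq)

lemma lie_hom_parabolic_incl:
  "lie_hom (\<lambda>x :: 'l::{finite,linorder} parabolic. uea_of (Rep_parabolic x))"
  unfolding lie_hom_def
  by (simp add: uea_of_lie lie_parabolic.rep_eq clinear_compose[OF clinear_uea_of clinear_Rep_parabolic])

text \<open>The cocycle pairs degree n with degree -n. In nonnegative degrees this leaves n = 0,
  where its coefficient n vanishes; hence c acting by k defines a character.\<close>

lemma c_coeff_lie_nonneg:
  fixes x y :: "'l::{finite,linorder} affine"
  assumes "Poly_Mapping.keys (loop x) \<subseteq> {0..}" "Poly_Mapping.keys (loop y) \<subseteq> {0..}"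
  shows "c_coeff (lie x y) = 0"
proof -
  have "of_int n * sp_form (Poly_Mapping.lookup (loop x) n) (Poly_Mapping.lookup (loop y) (- n)) = 0" for n
  proof (cases "n > 0")
    case True
    then have "- n \<notin> Poly_Mapping.keys (loop y)" using assms(2) by auto
    then show ?thesis by (simp add: in_keys_iff sp_form_0)
  next
    case False
    then have "n = 0 \<or> n \<notin> Poly_Mapping.keys (loop x)" using assms(1) by auto
    then show ?thesis by (auto simp: in_keys_iff sp_form_0)
  qed
  then have "loop_cocycle (loop x) (loop y) = 0"
    unfolding loop_cocycle_def by (intro sum.neutral) blast
  then show ?thesis by (simp add: lie_affine_def)
qed

lemma lie_hom_vk: "lie_hom (\<lambda>x :: 'l::{finite,linorder} parabolic. k * c_coeff (Rep_parabolic x))"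
proof -
  have "c_coeff (Rep_parabolic (lie x y)) = 0" for x y :: "'l parabolic"
    unfolding lie_parabolic.rep_eq by (rule c_coeff_lie_nonneg) (use Rep_parabolic in auto)
  moreover have "clinear (\<lambda>x :: 'l parabolic. k * c_coeff (Rep_parabolic x))"
    by (rule clinear_times_right[OF clinear_compose[OF clinear_c_coeff clinear_Rep_parabolic]])
  ultimately show ?thesis by (simp add: lie_hom_def)
qed

section \<open>Classes modulo the tensor product relations\<close>

definition verma_rels :: "complex \<Rightarrow> 'l::{finite,linorder} verma_pre set" where
  "verma_rels k = tensor_rels (\<lambda>u p. u * parabolic_incl p) (vk_act k)"

definition verma_class :: "complex \<Rightarrow> 'l::{finite,linorder} verma_pre \<Rightarrow> 'l verma_pre set" where
  "verma_class k w = verma_eq k `` {w}"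

lemma verma_eq_iff: "(v, w) \<in> verma_eq k \<longleftrightarrow> v - w \<in> cspan (verma_rels k)"
  by (simp add: verma_eq_def cong_mod_def verma_rels_def)

lemma equiv_verma_eq: "equiv UNIV (verma_eq k)"
proof (rule equivI)
  have eqv: "equivp (cong_mod (cspan (verma_rels k)))" by (rule equivp_cong_mod_span)
  have eq: "(v, w) \<in> verma_eq k \<longleftrightarrow> cong_mod (cspan (verma_rels k)) v w" for v w
    by (simp add: verma_eq_iff cong_mod_def)
  show "verma_eq k \<subseteq> UNIV \<times> UNIV" by simp
  show "refl (verma_eq k)" unfolding refl_on_def eq using equivp_reflp[OF eqv] by blast
  show "sym (verma_eq k)" unfolding sym_def eq using equivp_symp[OF eqv] by blast
  show "trans (verma_eq k)" unfolding trans_def eq using equivp_transp[OF eqv] by blast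
qed

lemma verma_class_eq_iff: "verma_class k v = verma_class k w \<longleftrightarrow> v - w \<in> cspan (verma_rels k)"
  unfolding verma_class_def verma_eq_iff[symmetric] by (rule eq_equiv_class_iff[OF equiv_verma_eq]) auto

text \<open>The module operations are unions over representatives; this collapses such a union for a
  linear map that respects the relations.\<close>

lemma verma_class_map:
  assumes "clinear f" "\<And>r. r \<in> verma_rels k \<Longrightarrow> f r \<in> cspan (verma_rels k)"
  shows "(\<Union>w\<in>verma_class k v. verma_eq k `` {f w}) = verma_class k (f v)"
proof -
  have sub: "f x \<in> cspan (verma_rels k)" if "x \<in> cspan (verma_rels k)" for x
    using that
    by (induction rule: cvec.span_induct_alt)
      (simp_all add: clinear_0[OF assms(1)] clinear_add[OF assms(1)] clinear_scaleC[OF assms(1)]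
        cvec.span_zero cvec.span_add cvec.span_scale assms(2))
  have "verma_eq k `` {f w} = verma_class k (f v)" if "w \<in> verma_class k v" for w
  proof -
    have "v - w \<in> cspan (verma_rels k)" using that by (simp add: verma_class_def verma_eq_iff)
    then have "f v - f w \<in> cspan (verma_rels k)"
      using sub clinear_diff[OF assms(1)] by metis
    then show ?thesis by (metis verma_class_def verma_class_eq_iff)
  qed
  moreover have "v \<in> verma_class k v"
    by (simp add: verma_class_def verma_eq_iff cvec.span_zero)
  ultimately show ?thesis by blast
qed

lemma verma_pre_act_lin_ext: "verma_pre_act u = lin_ext (\<lambda>(u', z). Poly_Mapping.single (u * u', z) 1)"
  by (auto simp: fun_eq_iff verma_pre_act_def lin_ext_def scaleC_single intro!: sum.cong)

lemma clinear_verma_pre_act: "clinear (verma_pre_act u)"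
  unfolding verma_pre_act_lin_ext by (rule clinear_lin_ext)

lemma verma_pre_act_single:
  "verma_pre_act u (Poly_Mapping.single (u', z) c) = Poly_Mapping.single (u * u', z) c"
  by (simp add: verma_pre_act_lin_ext scaleC_single)

lemma verma_pre_act_rels: "r \<in> verma_rels k \<Longrightarrow> verma_pre_act u r \<in> verma_rels k"
  unfolding verma_rels_def tensor_rels_def
  by (elim UnE CollectE exE conjE; simp add: clinear_diff[OF clinear_verma_pre_act]
      clinear_scaleC[OF clinear_verma_pre_act] verma_pre_act_single distrib_left scaleC_mult_right
      mult.assoc[symmetric]; blast)

lemma verma_act_class: "verma_act k u (verma_class k v) = verma_class k (verma_pre_act u v)"
  unfolding verma_act_def
  by (rule verma_class_map[OF clinear_verma_pre_act]) (simp add: verma_pre_act_rels cvec.span_base)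

lemma verma_scale_class: "verma_scale k a (verma_class k v) = verma_class k (a *\<^sub>C v)"
  unfolding verma_scale_def
  by (rule verma_class_map) (simp_all add: clinear_const_scaleC[OF clinear_ident] cvec.span_base cvec.span_scale)

lemma verma_class_in: "verma_class k v \<in> verma k"
  unfolding verma_def verma_class_def by (rule quotientI) simp

text \<open>The left ideal of all \<open>u\<close> with \<open>u \<cdot> 1 = 0\<close> in the generalized Verma module.\<close>

definition vac_null :: "complex \<Rightarrow> 'l::{finite,linorder} affine uea set" where
  "vac_null k = {u. Poly_Mapping.single (u, 1) 1 \<in> cspan (verma_rels k)}"

lemma verma_class_single_linear:
  "verma_class k (Poly_Mapping.single (u + v, z) 1) =
    verma_class k (Poly_Mapping.single (u, z) 1 + Poly_Mapping.single (v, z) 1)"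
  "verma_class k (Poly_Mapping.single (c *\<^sub>C u, z) 1) = verma_class k (c *\<^sub>C Poly_Mapping.single (u, z) 1)"
  "verma_class k (Poly_Mapping.single (u, c *\<^sub>C z) 1) = verma_class k (c *\<^sub>C Poly_Mapping.single (u, z) 1)"
  "verma_class k (Poly_Mapping.single (u * parabolic_incl p, z) 1) =
    verma_class k (Poly_Mapping.single (u, vk_act k p z) 1)"
proof -
  let ?s = "\<lambda>u z. Poly_Mapping.single (u, z) 1"
  have "?s (u + v) z - ?s u z - ?s v z \<in> verma_rels k"
    "?s (c *\<^sub>C u) z - c *\<^sub>C ?s u z \<in> verma_rels k"
    "?s u (c *\<^sub>C z) - c *\<^sub>C ?s u z \<in> verma_rels k"
    "?s (u * parabolic_incl p) z - ?s u (vk_act k p z) \<in> verma_rels k"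
    unfolding verma_rels_def tensor_rels_def Un_iff mem_Collect_eq by metis+
  then show "verma_class k (?s (u + v) z) = verma_class k (?s u z + ?s v z)"
    "verma_class k (?s (c *\<^sub>C u) z) = verma_class k (c *\<^sub>C ?s u z)"
    "verma_class k (?s u (c *\<^sub>C z)) = verma_class k (c *\<^sub>C ?s u z)"
    "verma_class k (?s (u * parabolic_incl p) z) = verma_class k (?s u (vk_act k p z))"
    unfolding verma_class_eq_iff diff_diff_eq[symmetric] by (simp_all add: cvec.span_base)
qed

lemma vac_null_iff: "u \<in> vac_null k \<longleftrightarrow> verma_class k (Poly_Mapping.single (u, 1) 1) = verma_class k 0"
  by (simp add: vac_null_def verma_class_eq_iff)

lemma vac_null_add: "u \<in> vac_null k \<Longrightarrow> v \<in> vac_null k \<Longrightarrow> u + v \<in> vac_null k"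
  unfolding vac_null_iff verma_class_single_linear(1) unfolding verma_class_eq_iff diff_zero
  by (rule cvec.span_add)

lemma vac_null_scaleC: "u \<in> vac_null k \<Longrightarrow> c *\<^sub>C u \<in> vac_null k"
  unfolding vac_null_iff verma_class_single_linear(2) unfolding verma_class_eq_iff diff_zero
  by (rule cvec.span_scale)

lemma subspace_vac_null: "cvec.subspace (vac_null k)"
proof (rule cvec.subspaceI)
  have "verma_class k (Poly_Mapping.single (0 *\<^sub>C 0, 1) 1) = verma_class k 0"
    unfolding verma_class_single_linear(2) by simp
  then show "0 \<in> vac_null k" by (simp add: vac_null_iff)
qed (rule vac_null_add vac_null_scaleC; assumption)+

lemma vac_null_mult: "u \<in> vac_null k \<Longrightarrow> v * u \<in> vac_null k"
proof -
  assume "u \<in> vac_null k"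
  then have "verma_act k v (verma_class k (Poly_Mapping.single (u, 1) 1)) = verma_act k v (verma_class k 0)"
    by (simp add: vac_null_iff)
  then show ?thesis
    by (simp add: vac_null_iff verma_act_class verma_pre_act_single clinear_0[OF clinear_verma_pre_act])
qed

text \<open>An element of P moves across the tensor sign and acts there by its character, which can
  be pulled out as a scalar.\<close>

lemma vac_null_parabolic:
  "uea_of (Rep_parabolic p) - (k * c_coeff (Rep_parabolic p)) *\<^sub>C 1 \<in> vac_null k"
proof -
  let ?c = "k * c_coeff (Rep_parabolic p)" and ?S = "\<lambda>u. verma_class k (Poly_Mapping.single (u, 1) 1)"
  have incl: "parabolic_incl (uea_of p) = uea_of (Rep_parabolic p)"
    unfolding parabolic_incl_def by (rule uea_lift_of[OF lie_hom_parabolic_incl])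
  have act: "vk_act k (uea_of p) 1 = ?c *\<^sub>C 1"
    unfolding vk_act_def uea_lift_of[OF lie_hom_vk] by simp
  have "?S (1 * parabolic_incl (uea_of p)) = ?S (?c *\<^sub>C 1)"
    unfolding verma_class_single_linear(4) act unfolding verma_class_single_linear(2,3) ..
  then have "?S (uea_of (Rep_parabolic p)) = ?S (?c *\<^sub>C 1)"
    by (simp add: incl)
  moreover have "?S (u - v) = verma_class k 0" if "?S u = ?S v" for u v
  proof -
    have "?S ((u - v) + v) = ?S v" using that by simp
    then show ?thesis unfolding verma_class_single_linear(1) unfolding verma_class_eq_iff by simp
  qed
  ultimately show ?thesis unfolding vac_null_iff by blast
qed

lemma vac_null_affine:
  assumes "Poly_Mapping.keys (loop x) \<subseteq> {0..}"
  shows "uea_of x - (k * c_coeff x) *\<^sub>C 1 \<in> vac_null k"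
  using vac_null_parabolic[of "Abs_parabolic x" k] assms by (simp add: Abs_parabolic_inverse)

lemma verma_act_vacuum: "verma_act k u (vacuum k) = verma_class k (Poly_Mapping.single (u, 1) 1)"
  using verma_act_class[of k u "Poly_Mapping.single (1, 1) 1"]
  by (simp add: vacuum_def verma_class_def verma_pre_act_single)

lemma verma_act_act_vacuum: "verma_act k u (verma_act k v (vacuum k)) = verma_act k (u * v) (vacuum k)"
  by (simp add: verma_act_vacuum verma_act_class verma_pre_act_single)

lemma verma_act_vacuum_zero_iff: "verma_act k u (vacuum k) = verma_zero k \<longleftrightarrow> u \<in> vac_null k"
  by (simp add: verma_act_vacuum vac_null_iff verma_zero_def verma_class_def)

lemma verma_act_vacuum_eq:
  assumes "u - a *\<^sub>C v \<in> vac_null k"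
  shows "verma_act k u (vacuum k) = verma_scale k a (verma_act k v (vacuum k))"
proof -
  let ?S = "\<lambda>u. Poly_Mapping.single (u, 1) 1 :: 'a verma_pre"
  have "verma_class k (?S ((u - a *\<^sub>C v) + a *\<^sub>C v)) = verma_class k (a *\<^sub>C ?S v)"
  proof -
    have "verma_class k (?S (u - a *\<^sub>C v) + ?S (a *\<^sub>C v)) = verma_class k (?S (a *\<^sub>C v))"
      using assms unfolding verma_class_eq_iff by (simp add: vac_null_def)
    then show ?thesis unfolding verma_class_single_linear(1,2)[symmetric] .
  qed
  then show ?thesis by (simp add: verma_act_vacuum verma_scale_class)
qed

text \<open>\<Phi> extends to the formal tensors by sending (u, z) to z \<Phi>(u). The relation that
  moves p across the tensor sign requires the character property for all of U(P), which follows from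
  \<open>char\<close> by induction on p.\<close>

lemma not_in_vac_null:
  fixes \<Phi> :: "'l::{finite,linorder} affine uea \<Rightarrow> complex"
  assumes \<Phi>: "clinear \<Phi>"
    and char: "\<And>u x. Poly_Mapping.keys (loop x) \<subseteq> {0..} \<Longrightarrow> \<Phi> (u * uea_of x) = \<Phi> u * (k * c_coeff x)"
    and "\<Phi> u \<noteq> 0"
  shows "u \<notin> vac_null k"
proof
  define L where "L = lin_ext (\<lambda>(u, z). z * \<Phi> u)"
  have L: "clinear L" unfolding L_def by (rule clinear_lin_ext)
  have L_single: "L (Poly_Mapping.single (v, z) 1) = z * \<Phi> v" for v z
    by (simp add: L_def)
  have incl: "\<Phi> (v * parabolic_incl p) = \<Phi> v * uea_lift (\<lambda>x. k * c_coeff (Rep_parabolic x)) p" for v p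
  proof (induction p arbitrary: v rule: uea_induct)
    case one
    show ?case
      unfolding parabolic_incl_def
      by (simp add: uea_lift_1[OF lie_hom_parabolic_incl] uea_lift_1[OF lie_hom_vk])
  next
    case (gen x)
    show ?case
      unfolding parabolic_incl_def uea_lift_of[OF lie_hom_parabolic_incl] uea_lift_of[OF lie_hom_vk]
      by (rule char) (use Rep_parabolic[of x] in simp)
  next
    case (add p q)
    then show ?case
      unfolding parabolic_incl_def clinear_add[OF clinear_uea_lift[OF lie_hom_parabolic_incl]]
        clinear_add[OF clinear_uea_lift[OF lie_hom_vk]]
      by (simp add: distrib_left clinear_add[OF \<Phi>])
  next
    case (scale c p)
    then show ?case
      unfolding parabolic_incl_def clinear_scaleC[OF clinear_uea_lift[OF lie_hom_parabolic_incl]]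
        clinear_scaleC[OF clinear_uea_lift[OF lie_hom_vk]]
      by (simp add: scaleC_mult_right clinear_scaleC[OF \<Phi>] mult.left_commute)
  next
    case (mult p q)
    then show ?case
      unfolding parabolic_incl_def uea_lift_mult[OF lie_hom_parabolic_incl] uea_lift_mult[OF lie_hom_vk]
      by (simp add: mult.assoc[symmetric])
  qed
  have "L r = 0" if r: "r \<in> verma_rels k" for r
  proof -
    let ?s = "\<lambda>u z. Poly_Mapping.single (u, z) 1"
    note simps = clinear_diff[OF L] clinear_scaleC[OF L] L_single clinear_add[OF \<Phi>] clinear_scaleC[OF \<Phi>]
      incl vk_act_def distrib_left distrib_right
    from r consider u v z where "r = ?s (u + v) z - ?s u z - ?s v z"
      | u z z' where "r = ?s u (z + z') - ?s u z - ?s u z'"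
      | c u z where "r = ?s (c *\<^sub>C u) z - c *\<^sub>C ?s u z"
      | c u z where "r = ?s u (c *\<^sub>C z) - c *\<^sub>C ?s u z"
      | u p z where "r = ?s (u * parabolic_incl p) z - ?s u (vk_act k p z)"
      unfolding verma_rels_def tensor_rels_def by blast
    then show ?thesis by cases (simp_all add: simps)
  qed
  moreover assume "u \<in> vac_null k"
  ultimately have "L (Poly_Mapping.single (u, 1) 1) = 0"
    unfolding vac_null_def by (auto intro: clinear_vanish_span[OF L])
  then show False using assms(3) by (simp add: L_single)
qed

section \<open>Commutators with the root vectors of degree \<open>-1\<close>\<close>

abbreviation U_aa :: "int \<Rightarrow> 'l \<Rightarrow> 'l \<Rightarrow> 'l::{finite,linorder} affine uea" where
  "U_aa n i j \<equiv> uea_of (loop_elem (sp_of (Ann i) (Ann j)) n)"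

abbreviation U_ac :: "int \<Rightarrow> 'l \<Rightarrow> 'l \<Rightarrow> 'l::{finite,linorder} affine uea" where
  "U_ac n i j \<equiv> uea_of (loop_elem (sp_of (Ann i) (Cre j)) n)"

abbreviation U_cc :: "int \<Rightarrow> 'l \<Rightarrow> 'l \<Rightarrow> 'l::{finite,linorder} affine uea" where
  "U_cc n i j \<equiv> uea_of (loop_elem (sp_of (Cre i) (Cre j)) n)"

lemmas uea_of_simps = clinear_add[OF clinear_uea_of] clinear_scaleC[OF clinear_uea_of]
  clinear_0[OF clinear_uea_of] clinear_uminus[OF clinear_uea_of]
lemmas loop_elem_simps = clinear_add[OF clinear_loop_elem] clinear_scaleC[OF clinear_loop_elem]
  clinear_0[OF clinear_loop_elem] clinear_uminus[OF clinear_loop_elem]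

lemma uea_commute: "uea_of x * uea_of y = uea_of y * uea_of x + uea_of (lie x y)"
  using uea_of_lie[of x y] by (simp add: algebra_simps)

lemma U_aa_commute: "U_aa n i j * U_aa m p q = U_aa m p q * U_aa n i j"
  by (subst uea_commute) (simp add: lie_loop_elem lie_sp_of sp_form_sp_of loop_elem_simps uea_of_simps)

lemma U_ac_U_aa: "U_ac n p q * U_aa m i j - U_aa m i j * U_ac n p q =
    (if q = i then - U_aa (n + m) p j else 0) + (if q = j then - U_aa (n + m) p i else 0)"
  unfolding uea_of_lie
  by (simp add: lie_loop_elem lie_sp_of sp_form_sp_of loop_elem_simps uea_of_simps)

text \<open>The commutator consists of \<open>U_ac\<close> elements, which again fail to commute
  with the \<open>U_aa\<close>: this is the second order behaviour. The central term occurs only for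
  n = 1, with the factor -2 of the invariant form.\<close>

lemma U_cc_U_aa: "U_cc n p q * U_aa (- 1) i j - U_aa (- 1) i j * U_cc n p q =
    (if q = i then - 1 else 0) *\<^sub>C U_ac (n - 1) j p + (if p = i then - 1 else 0) *\<^sub>C U_ac (n - 1) j q
    + (if q = j then - 1 else 0) *\<^sub>C U_ac (n - 1) i p + (if p = j then - 1 else 0) *\<^sub>C U_ac (n - 1) i q
    + (if n = 1 then - 2 * ((if p = i then - 1 else 0) * (if q = j then - 1 else 0)
        + (if q = i then - 1 else 0) * (if p = j then - 1 else 0)) else 0) *\<^sub>C uea_of aff_c"
  unfolding uea_of_lie lie_loop_elem lie_sp_of sp_form_sp_of loop_elem_simps uea_of_simps symp.simps
    sp_of_commute[of "Cre _" "Ann _"]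
  by (cases "n = 1") simp_all

section \<open>Determinants in the root vectors of degree \<open>-1\<close>\<close>

text \<open>The double centralizer of the commuting elements \<open>X(-1)\<close> is a commutative ring containing
  them, in which products over finite sets are available.\<close>

definition centralizes_X :: "'l::{finite,linorder} affine uea \<Rightarrow> bool" where
  "centralizes_X v \<longleftrightarrow> (\<forall>i j. v * U_aa (- 1) i j = U_aa (- 1) i j * v)"

typedef (overloaded) 'l comm_uea =
  "{u :: 'l::{finite,linorder} affine uea. \<forall>v. centralizes_X v \<longrightarrow> u * v = v * u}"
  by (rule exI[of _ 1]) simp

setup_lifting type_definition_comm_uea

text \<open>The X(-1) lie in their own centralizer, so v commutes with them; thus v lies in the
  centralizer, with which u commutes.\<close>

lemma comm_uea_commute:
  assumes "\<forall>v. centralizes_X v \<longrightarrow> u * v = v * u" "\<forall>w. centralizes_X w \<longrightarrow> v * w = w * v"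
  shows "u * v = v * u"
proof -
  have "centralizes_X (U_aa (- 1) i j)" for i j :: 'a
    by (simp add: centralizes_X_def U_aa_commute)
  then have "centralizes_X v" using assms(2) by (simp add: centralizes_X_def)
  then show ?thesis using assms(1) by blast
qed

instantiation comm_uea :: ("{finite,linorder}") calgebra
begin
lift_definition zero_comm_uea :: "'a comm_uea" is 0 by simp
lift_definition one_comm_uea :: "'a comm_uea" is 1 by simp
lift_definition plus_comm_uea :: "'a comm_uea \<Rightarrow> 'a comm_uea \<Rightarrow> 'a comm_uea" is "(+)"
  by (simp add: distrib_left distrib_right)
lift_definition minus_comm_uea :: "'a comm_uea \<Rightarrow> 'a comm_uea \<Rightarrow> 'a comm_uea" is "(-)"
  by (simp add: left_diff_distrib right_diff_distrib)
lift_definition uminus_comm_uea :: "'a comm_uea \<Rightarrow> 'a comm_uea" is uminus by simp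
lift_definition times_comm_uea :: "'a comm_uea \<Rightarrow> 'a comm_uea \<Rightarrow> 'a comm_uea" is "(*)"
  by (metis mult.assoc)
lift_definition scaleC_comm_uea :: "complex \<Rightarrow> 'a comm_uea \<Rightarrow> 'a comm_uea" is scaleC
  by (simp add: scaleC_mult_left scaleC_mult_right)
instance
  by standard
    (transfer; simp add: algebra_simps scaleC_add_right scaleC_add_left scaleC_scaleC scaleC_one
      scaleC_mult_left scaleC_mult_right)+
end

instance comm_uea :: ("{finite,linorder}") "{comm_ring, comm_monoid_mult}"
proof
  fix a b c :: "'a comm_uea"
  show "a * b = b * a" by transfer (rule comm_uea_commute)
  show "(a + b) * c = a * c + b * c" by (rule distrib_right)
  show "1 * a = a" by simp
qed

lift_definition comm_X :: "'l \<Rightarrow> 'l \<Rightarrow> 'l::{finite,linorder} comm_uea" is "\<lambda>i j. U_aa (- 1) i j"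
  by (simp add: centralizes_X_def)

lemma comm_X_sym: "comm_X i j = comm_X j i"
  by transfer (simp add: sp_of_commute)

lemma clinear_Rep_comm_uea: "clinear Rep_comm_uea"
  by (simp add: clinear_iff plus_comm_uea.rep_eq scaleC_comm_uea.rep_eq)

lemmas Rep_comm_uea_simps = clinear_add[OF clinear_Rep_comm_uea] clinear_scaleC[OF clinear_Rep_comm_uea]
  clinear_0[OF clinear_Rep_comm_uea] clinear_uminus[OF clinear_Rep_comm_uea]
  clinear_diff[OF clinear_Rep_comm_uea] times_comm_uea.rep_eq one_comm_uea.rep_eq

lemma Rep_comm_uea_prod_list: "Rep_comm_uea (prod_list (map f xs)) = prod_list (map (\<lambda>x. Rep_comm_uea (f x)) xs)"
  by (induction xs) (simp_all add: Rep_comm_uea_simps)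

lemma Rep_comm_uea_commute: "Rep_comm_uea u * Rep_comm_uea v = Rep_comm_uea v * Rep_comm_uea u"
  using mult.commute[of u v] by (metis times_comm_uea.rep_eq)

section \<open>The determinant in the commutative ring\<close>

lemma idx_bij: "bij_betw idx {1..CARD('l)} (UNIV :: 'l::{finite,linorder} set)"
proof -
  let ?xs = "sorted_list_of_set (UNIV :: 'l set)"
  have "bij_betw (\<lambda>i. ?xs ! i) {..<length ?xs} (set ?xs)"
    by (rule bij_betw_nth) auto
  moreover have "bij_betw (\<lambda>i. i - 1) {1..CARD('l)} {..<CARD('l)}"
    by (rule bij_betwI[of _ _ _ Suc]) auto
  ultimately have "bij_betw ((\<lambda>i. ?xs ! i) \<circ> (\<lambda>i. i - 1)) {1..CARD('l)} UNIV"
    by (intro bij_betw_trans) auto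
  then show ?thesis by (simp add: idx_def[abs_def] comp_def)
qed

lemma idx_eq_iff:
  "i \<in> {1..CARD('l)} \<Longrightarrow> j \<in> {1..CARD('l)} \<Longrightarrow> (idx i :: 'l::{finite,linorder}) = idx j \<longleftrightarrow> i = j"
  using bij_betw_imp_inj_on[OF idx_bij] by (metis inj_on_eq_iff)

lemma idx_surj: obtains i where "i \<in> {1..CARD('l)}" "(x :: 'l::{finite,linorder}) = idx i"
  using bij_betw_imp_surj_on[OF idx_bij] by (metis UNIV_I imageE)

abbreviation Xm :: "nat \<Rightarrow> nat \<Rightarrow> 'l::{finite,linorder} comm_uea" where
  "Xm i j \<equiv> comm_X (idx i) (idx j)"

definition comm_det :: "nat \<Rightarrow> 'l::{finite,linorder} comm_uea" where
  "comm_det m = (\<Sum>\<sigma> | \<sigma> permutes {1..m}. of_int (sign \<sigma>) *\<^sub>C (\<Prod>i\<in>{1..m}. Xm i (\<sigma> i)))"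

lemma Rep_comm_det: "Rep_comm_uea (comm_det m) = Delta m"
proof -
  have "prod_list (map (\<lambda>i. Rep_comm_uea (Xm i (\<sigma> i))) [1..<m + 1]) =
      Rep_comm_uea (\<Prod>i\<in>{1..m}. Xm i (\<sigma> i) :: 'a comm_uea)" for \<sigma>
  proof -
    have "(\<Prod>i\<in>set [1..<m + 1]. Xm i (\<sigma> i) :: 'a comm_uea) = prod_list (map (\<lambda>i. Xm i (\<sigma> i)) [1..<m + 1])"
      by (rule prod.distinct_set_conv_list) simp
    moreover have "set [1..<m + 1] = {1..m}" by auto
    ultimately show ?thesis by (simp only: Rep_comm_uea_prod_list)
  qed
  then show ?thesis
    by (simp add: comm_det_def Delta_def clinear_sum[OF clinear_Rep_comm_uea]
        clinear_scaleC[OF clinear_Rep_comm_uea] comm_X.rep_eq X_plus_def)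
qed

lemma Delta_sum:
  "Delta m = (\<Sum>\<sigma> | \<sigma> permutes {1..m}. of_int (sign \<sigma>) *\<^sub>C Rep_comm_uea (\<Prod>i\<in>{1..m}. Xm i (\<sigma> i)))"
  unfolding Rep_comm_det[symmetric] comm_det_def clinear_sum[OF clinear_Rep_comm_uea]
    clinear_scaleC[OF clinear_Rep_comm_uea] ..

lemma Delta_commutator:
  "u * Delta m - Delta m * u = (\<Sum>\<sigma> | \<sigma> permutes {1..m}. of_int (sign \<sigma>) *\<^sub>C
    (u * Rep_comm_uea (\<Prod>i\<in>{1..m}. Xm i (\<sigma> i)) - Rep_comm_uea (\<Prod>i\<in>{1..m}. Xm i (\<sigma> i)) * u))"
  unfolding Delta_sum sum_distrib_left sum_distrib_right sum_subtractf[symmetric]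
  by (simp only: scaleC_mult_left scaleC_mult_right cvec.scale_right_diff_distrib)

text \<open>The Leibniz rule. Requiring the commutators to lie in the commutative subring allows the
  derivative of a factor to be moved to the front.\<close>

lemma commutator_prod:
  fixes x y :: "'i \<Rightarrow> 'l::{finite,linorder} comm_uea"
  assumes "finite A" "\<And>i. i \<in> A \<Longrightarrow> G * Rep_comm_uea (x i) - Rep_comm_uea (x i) * G = Rep_comm_uea (y i)"
  shows "G * Rep_comm_uea (\<Prod>i\<in>A. x i) - Rep_comm_uea (\<Prod>i\<in>A. x i) * G =
    Rep_comm_uea (\<Sum>i\<in>A. y i * (\<Prod>j\<in>A - {i}. x j))"
  using assms
proof (induction A rule: finite_induct)
  case empty
  then show ?case by (simp add: Rep_comm_uea_simps)
next
  case (insert a A)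
  let ?R = Rep_comm_uea and ?P = "\<Prod>i\<in>A. x i"
  have "(\<Sum>i\<in>insert a A. y i * (\<Prod>j\<in>insert a A - {i}. x j)) =
      y a * ?P + (\<Sum>i\<in>A. x a * (y i * (\<Prod>j\<in>A - {i}. x j)))"
  proof -
    have "y i * (\<Prod>j\<in>insert a A - {i}. x j) = x a * (y i * (\<Prod>j\<in>A - {i}. x j))" if "i \<in> A" for i
    proof -
      have "insert a A - {i} = insert a (A - {i})" "a \<notin> A - {i}" using insert.hyps that by auto
      then show ?thesis using insert.hyps(1) by (simp add: mult_ac)
    qed
    then show ?thesis using insert.hyps by (simp cong: sum.cong)
  qed
  also have "\<dots> = y a * ?P + x a * (\<Sum>i\<in>A. y i * (\<Prod>j\<in>A - {i}. x j))"
    by (simp add: sum_distrib_left)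
  finally have "?R (\<Sum>i\<in>insert a A. y i * (\<Prod>j\<in>insert a A - {i}. x j)) =
      (G * ?R (x a) - ?R (x a) * G) * ?R ?P + ?R (x a) * (G * ?R ?P - ?R ?P * G)"
    using insert by (simp add: Rep_comm_uea_simps)
  then show ?case using insert.hyps by (simp add: Rep_comm_uea_simps algebra_simps)
qed

lemma cvec_eq_neg_self: "x = - x \<Longrightarrow> x = (0 :: 'a::cvector)"
proof -
  assume "x = - x"
  then have "(2 :: complex) *\<^sub>C x = 0" by (metis scaleC_2 add.right_inverse)
  then show ?thesis by simp
qed

lemma sum_const_uminus: "finite C \<Longrightarrow> (\<Sum>c\<in>C. - x) = (- of_nat (card C)) *\<^sub>C (x :: 'a::cvector)"
  by (induction C rule: finite_induct) (simp_all add: scaleC_add_left cvec.scale_left_diff_distrib)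

text \<open>On the left, row q has been overwritten by row p. If p and q differ, two rows agree:
  composing \<sigma> with the transposition of p and q preserves the products and flips the signs,
  so the sum is its own negative.\<close>

lemma det_replace_row:
  fixes M :: "nat \<Rightarrow> nat \<Rightarrow> 'l::{finite,linorder} comm_uea"
  assumes I: "finite I" "p \<in> I" "q \<in> I"
  shows "(\<Sum>\<sigma> | \<sigma> permutes I. of_int (sign \<sigma>) *\<^sub>C (M p (\<sigma> q) * (\<Prod>j\<in>I - {q}. M j (\<sigma> j)))) =
    (if p = q then \<Sum>\<sigma> | \<sigma> permutes I. of_int (sign \<sigma>) *\<^sub>C (\<Prod>j\<in>I. M j (\<sigma> j)) else 0)"
proof (cases "p = q")
  case True
  then show ?thesis using I by (simp add: prod.remove[of I q])
next
  case False
  let ?f = "\<lambda>\<sigma>. of_int (sign \<sigma>) *\<^sub>C (M p (\<sigma> q) * (\<Prod>j\<in>I - {q}. M j (\<sigma> j)))"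
  let ?t = "transpose p q"
  have t: "?t permutes I" using I by (rule_tac permutes_swap_id) auto
  have f: "?f \<sigma> = of_int (sign \<sigma>) *\<^sub>C (M p (\<sigma> q) * (M p (\<sigma> p) * (\<Prod>j\<in>I - {q} - {p}. M j (\<sigma> j))))" for \<sigma>
    using I False by (simp add: prod.remove[of "I - {q}" p])
  have neg: "?f (\<sigma> \<circ> ?t) = - ?f \<sigma>" if "\<sigma> permutes I" for \<sigma>
  proof -
    have "sign (\<sigma> \<circ> ?t) = - sign \<sigma>"
      using permutes_imp_permutation[OF I(1) that] permutes_imp_permutation[OF I(1) t] False
      by (simp add: sign_compose sign_swap_id)
    moreover have "(\<Prod>j\<in>I - {q} - {p}. M j ((\<sigma> \<circ> ?t) j)) = (\<Prod>j\<in>I - {q} - {p}. M j (\<sigma> j))"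
      by (rule prod.cong) (auto simp: transpose_def)
    ultimately show ?thesis
      unfolding f by (simp add: mult_ac)
  qed
  have "sum ?f {\<sigma>. \<sigma> permutes I} = (\<Sum>\<sigma> | \<sigma> permutes I. ?f (\<sigma> \<circ> ?t))"
    by (rule sum.reindex_bij_witness[of _ "\<lambda>\<sigma>. \<sigma> \<circ> ?t" "\<lambda>\<sigma>. \<sigma> \<circ> ?t"])
      (use t in \<open>auto simp: o_assoc[symmetric] intro: permutes_compose\<close>)
  also have "\<dots> = - sum ?f {\<sigma>. \<sigma> permutes I}"
    unfolding sum_negf[symmetric] by (rule sum.cong[OF refl]) (use neg in blast)
  finally show ?thesis using False by (simp add: cvec_eq_neg_self)
qed

text \<open>Both the rows and the columns of the symmetric matrix are transformed, and each
  contributes -1 to the eigenvalue -2. The last hypothesis keeps the row that replaces row q inside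
  the m by m block.\<close>

lemma U_ac_comm_det:
  assumes p: "p \<in> {1..CARD('l)}" and q: "q \<in> {1..CARD('l)}" and m: "m \<le> CARD('l)"
    and "q \<le> m \<Longrightarrow> p \<le> m"
  shows "U_ac 0 (idx p) (idx q) * Delta m - Delta m * U_ac 0 (idx p) (idx q) =
    (if p = q \<and> q \<le> m then - 2 else 0) *\<^sub>C (Delta m :: 'l::{finite,linorder} affine uea)"
proof -
  let ?G = "U_ac 0 (idx p) (idx q) :: 'l affine uea" and ?I = "{1..m}" and ?R = Rep_comm_uea
  let ?y = "\<lambda>i j. (if q = i then - Xm p j else 0) + (if q = j then - Xm p i else 0) :: 'l comm_uea"
  let ?mono = "\<lambda>\<sigma>. \<Prod>i\<in>?I. Xm i (\<sigma> i) :: 'l comm_uea"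
  let ?row = "\<lambda>\<sigma>. Xm p (\<sigma> q) * (\<Prod>j\<in>?I - {q}. Xm j (\<sigma> j)) :: 'l comm_uea"
  have y: "?G * ?R (Xm i j) - ?R (Xm i j) * ?G = ?R (?y i j)" if "i \<in> ?I" "j \<in> ?I" for i j
  proof -
    have "i \<in> {1..CARD('l)}" "j \<in> {1..CARD('l)}" using that m by auto
    then show ?thesis using q by (simp add: comm_X.rep_eq U_ac_U_aa Rep_comm_uea_simps idx_eq_iff)
  qed
  have mono: "?G * ?R (?mono \<sigma>) - ?R (?mono \<sigma>) * ?G =
      ?R (if q \<le> m then - ?row \<sigma> - ?row (inv \<sigma>) else 0)" if \<sigma>: "\<sigma> permutes ?I" for \<sigma>
  proof -
    have in_I: "\<sigma> i \<in> ?I \<longleftrightarrow> i \<in> ?I" for i using permutes_in_image[OF \<sigma>] .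
    have inv_inj: "inv \<sigma> i = inv \<sigma> j \<longleftrightarrow> i = j" for i j using permutes_inverses(1)[OF \<sigma>] by metis
    have "?G * ?R (?mono \<sigma>) - ?R (?mono \<sigma>) * ?G = ?R (\<Sum>i\<in>?I. ?y i (\<sigma> i) * (\<Prod>j\<in>?I - {i}. Xm j (\<sigma> j)))"
      by (rule commutator_prod) (use y in_I in auto)
    moreover have "(\<Sum>i\<in>?I. ?y i (\<sigma> i) * (\<Prod>j\<in>?I - {i}. Xm j (\<sigma> j))) =
        (\<Sum>i\<in>?I. if i = q then - ?row \<sigma> else 0)
        + (\<Sum>i\<in>?I. if i = inv \<sigma> q then - (Xm p (inv \<sigma> q) * (\<Prod>j\<in>?I - {inv \<sigma> q}. Xm j (\<sigma> j))) else 0)"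
      unfolding sum.distrib[symmetric] distrib_right
    proof (rule sum.cong[OF refl])
      fix i assume "i \<in> ?I"
      have iff: "q = \<sigma> i \<longleftrightarrow> i = inv \<sigma> q" using permutes_inverses[OF \<sigma>] by metis
      show "(if q = i then - Xm p (\<sigma> i) else 0) * (\<Prod>j\<in>?I - {i}. Xm j (\<sigma> j))
        + (if q = \<sigma> i then - Xm p i else 0) * (\<Prod>j\<in>?I - {i}. Xm j (\<sigma> j)) =
        (if i = q then - ?row \<sigma> else 0)
        + (if i = inv \<sigma> q then - (Xm p (inv \<sigma> q) * (\<Prod>j\<in>?I - {inv \<sigma> q}. Xm j (\<sigma> j))) else 0)"
        unfolding iff by auto
    qed
    \<comment> \<open>Reindexing by \<sigma> and using the symmetry of the matrix turns the column
      operation for \<sigma> into the row operation for its inverse, which has the same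
      sign.\<close>
    moreover have "(\<Prod>j\<in>?I - {inv \<sigma> q}. Xm j (\<sigma> j)) = (\<Prod>j\<in>?I - {q}. Xm j (inv \<sigma> j) :: 'l comm_uea)"
    proof (rule prod.reindex_bij_witness[of _ "inv \<sigma>" \<sigma>])
      show "Xm (\<sigma> j) (inv \<sigma> (\<sigma> j)) = (Xm j (\<sigma> j) :: 'l comm_uea)" for j
        using permutes_inverses[OF \<sigma>] by (simp add: comm_X_sym)
    qed (use permutes_inverses[OF \<sigma>] in_I permutes_in_image[OF permutes_inv[OF \<sigma>]] inv_inj in auto)
    moreover have "inv \<sigma> q \<in> ?I \<longleftrightarrow> q \<le> m"
      using permutes_in_image[OF permutes_inv[OF \<sigma>], of q] q by auto
    ultimately show ?thesis using q by auto
  qed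
  have "?G * Delta m - Delta m * ?G =
      (\<Sum>\<sigma> | \<sigma> permutes ?I. of_int (sign \<sigma>) *\<^sub>C (?G * ?R (?mono \<sigma>) - ?R (?mono \<sigma>) * ?G))"
    by (rule Delta_commutator)
  also have "\<dots> = ?R (\<Sum>\<sigma> | \<sigma> permutes ?I. of_int (sign \<sigma>) *\<^sub>C
      (if q \<le> m then - ?row \<sigma> - ?row (inv \<sigma>) else 0))"
    unfolding clinear_sum[OF clinear_Rep_comm_uea] clinear_scaleC[OF clinear_Rep_comm_uea]
    by (rule sum.cong[OF refl]) (use mono in simp)
  also have "(\<Sum>\<sigma> | \<sigma> permutes ?I. of_int (sign \<sigma>) *\<^sub>C (if q \<le> m then - ?row \<sigma> - ?row (inv \<sigma>) else 0)) =
      (if p = q \<and> q \<le> m then - 2 else 0) *\<^sub>C comm_det m"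
  proof (cases "q \<le> m")
    case True
    let ?S = "\<Sum>\<sigma> | \<sigma> permutes ?I. of_int (sign \<sigma>) *\<^sub>C ?row \<sigma>"
    have "(\<Sum>\<sigma> | \<sigma> permutes ?I. of_int (sign \<sigma>) *\<^sub>C ?row (inv \<sigma>)) =
        (\<Sum>\<sigma> | \<sigma> permutes ?I. of_int (sign (inv \<sigma>)) *\<^sub>C ?row (inv \<sigma>))"
      by (rule sum.cong) (use sign_inverse[OF permutes_imp_permutation[of ?I]] in auto)
    also have "\<dots> = ?S"
      by (rule sum.reindex_bij_witness[of _ inv inv]) (auto simp: permutes_inv permutes_inv_inv)
    finally have "(\<Sum>\<sigma> | \<sigma> permutes ?I. of_int (sign \<sigma>) *\<^sub>C (- ?row \<sigma> - ?row (inv \<sigma>))) = - ?S - ?S"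
      by (simp add: cvec.scale_right_diff_distrib sum_subtractf sum_negf)
    also have "?S = (if p = q then comm_det m else 0)"
      unfolding comm_det_def by (rule det_replace_row) (use True assms in auto)
    finally show ?thesis using True by (auto simp: scaleC_2)
  qed simp
  finally show ?thesis by (simp add: Rep_comm_uea_simps Rep_comm_det)
qed

section \<open>Annihilation by the positive part\<close>

lemma power_commutator:
  fixes G D :: "'r::calgebra"
  assumes "G * D - D * G = a *\<^sub>C D"
  shows "G * D ^ s = D ^ s * G + (of_nat s * a) *\<^sub>C D ^ s"
proof (induction s)
  case (Suc s)
  have GD: "G * D = D * G + a *\<^sub>C D" using assms by (simp add: diff_eq_eq add.commute)
  have "G * D ^ Suc s = (G * D) * D ^ s" by (simp add: mult.assoc)
  also have "\<dots> = D * (G * D ^ s) + a *\<^sub>C D ^ Suc s"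
    unfolding GD by (simp add: distrib_right mult.assoc scaleC_mult_left)
  also have "\<dots> = D ^ Suc s * G + (of_nat (Suc s) * a) *\<^sub>C D ^ Suc s"
    unfolding Suc by (simp add: distrib_left mult.assoc scaleC_mult_right scaleC_add_left distrib_right add_ac)
  finally show ?case .
qed simp

lemma vac_null_loop: "0 \<le> n \<Longrightarrow> uea_of (loop_elem x n) \<in> vac_null k"
  using vac_null_affine[of "loop_elem x n" k] by (simp add: loop_elem_def)

lemma vac_null_c: "uea_of aff_c - k *\<^sub>C 1 \<in> vac_null k"
  using vac_null_affine[of aff_c k] by (simp add: aff_c_def)

lemma uea_of_aff_c_commute: "uea_of aff_c * u = u * uea_of (aff_c :: 'l::{finite,linorder} affine)"
proof (induction u rule: uea_induct)
  case (gen x)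
  show ?case using uea_commute[of aff_c x] by (simp add: lie_aff_c uea_of_simps)
next
  case (mult u v)
  then show ?case by (metis mult.assoc)
qed (simp_all add: distrib_left distrib_right scaleC_mult_left scaleC_mult_right)

lemma vac_null_diff: "u \<in> vac_null k \<Longrightarrow> v \<in> vac_null k \<Longrightarrow> u - v \<in> vac_null k"
  by (rule cvec.subspace_diff[OF subspace_vac_null])

lemma vac_null_0: "0 \<in> vac_null k"
  by (rule cvec.subspace_0[OF subspace_vac_null])

lemma vac_null_eigen_power:
  assumes "G * D - D * G = a *\<^sub>C D" "G - b *\<^sub>C 1 \<in> vac_null k"
  shows "G * D ^ s - (of_nat s * a + b) *\<^sub>C D ^ s \<in> vac_null k"
proof -
  have "G * D ^ s - (of_nat s * a + b) *\<^sub>C D ^ s = D ^ s * (G - b *\<^sub>C 1)"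
    unfolding power_commutator[OF assms(1)]
    by (simp add: right_diff_distrib scaleC_mult_right scaleC_add_left)
  then show ?thesis using vac_null_mult[OF assms(2)] by simp
qed

text \<open>The cofactor of the (1,1) entry. Its permutations are kept as permutations of {1..m}
  fixing 1, so that they can be composed with transpositions of 1 and c in
  \<open>minor_sum\<close>.\<close>

definition comm_minor :: "nat \<Rightarrow> 'l::{finite,linorder} comm_uea" where
  "comm_minor m = (\<Sum>\<tau> | \<tau> permutes {1..m} \<and> \<tau> 1 = 1.
     of_int (sign \<tau>) *\<^sub>C (\<Prod>j\<in>{1..m} - {1}. Xm j (\<tau> j)))"

text \<open>Remove 1 from its cycle: with c the preimage of 1, the permutation \<tau> = \<sigma> o
  (1 c) fixes 1, sends c to \<sigma> 1 and has the opposite sign, while the monomial becomes that of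
  \<tau>. Each \<tau> arises from m - 1 choices of c.\<close>

lemma minor_sum:
  assumes "1 \<le> m"
  shows "(\<Sum>\<sigma> | \<sigma> permutes {1..m} \<and> \<sigma> 1 \<noteq> 1. of_int (sign \<sigma>) *\<^sub>C
      (Xm (\<sigma> 1) (inv \<sigma> 1) * (\<Prod>j\<in>{1..m} - {1} - {inv \<sigma> 1}. Xm j (\<sigma> j)))) =
    (- (of_nat m - 1)) *\<^sub>C (comm_minor m :: 'l::{finite,linorder} comm_uea)"
proof -
  let ?I = "{1..m}"
  let ?A = "{\<tau>. \<tau> permutes ?I \<and> \<tau> 1 = 1} \<times> (?I - {1})"
  let ?f = "\<lambda>\<sigma>. of_int (sign \<sigma>) *\<^sub>C
      (Xm (\<sigma> 1) (inv \<sigma> 1) * (\<Prod>j\<in>?I - {1} - {inv \<sigma> 1}. Xm j (\<sigma> j))) :: 'l comm_uea"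
  let ?M = "\<lambda>\<tau>. \<Prod>j\<in>?I - {1}. Xm j (\<tau> j) :: 'l comm_uea"
  let ?t = "\<lambda>c. transpose 1 c :: nat \<Rightarrow> nat"
  have t: "?t c permutes ?I" if "c \<in> ?I" for c
    by (rule permutes_swap_id) (use that assms in auto)
  have inv_comp: "inv (\<tau> \<circ> ?t c) 1 = c" if "\<tau> permutes ?I" "\<tau> 1 = 1" "c \<in> ?I" for \<tau> c
  proof -
    have "(\<tau> \<circ> ?t c) permutes ?I" using that t permutes_compose by blast
    moreover have "(\<tau> \<circ> ?t c) c = 1" using that(2) by simp
    ultimately show ?thesis by (metis permutes_inverses(2))
  qed
  have "(\<Sum>\<sigma> | \<sigma> permutes ?I \<and> \<sigma> 1 \<noteq> 1. ?f \<sigma>) = (\<Sum>(\<tau>, c)\<in>?A. - (of_int (sign \<tau>) *\<^sub>C ?M \<tau>))"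
  proof (rule sum.reindex_bij_witness[of _ "\<lambda>(\<tau>, c). \<tau> \<circ> ?t c" "\<lambda>\<sigma>. (\<sigma> \<circ> ?t (inv \<sigma> 1), inv \<sigma> 1)"])
    fix \<sigma> assume "\<sigma> \<in> {\<sigma>. \<sigma> permutes ?I \<and> \<sigma> 1 \<noteq> 1}"
    then have \<sigma>: "\<sigma> permutes ?I" "\<sigma> 1 \<noteq> 1" by auto
    let ?c = "inv \<sigma> 1"
    have c: "?c \<in> ?I" using permutes_in_image[OF permutes_inv[OF \<sigma>(1)], of 1] assms by simp
    have \<sigma>c: "\<sigma> ?c = 1" by (rule permutes_inverses(1)[OF \<sigma>(1)])
    have c1: "?c \<noteq> 1" using \<sigma>c \<sigma>(2) by metis
    show "(case (\<sigma> \<circ> ?t ?c, ?c) of (\<tau>, c) \<Rightarrow> \<tau> \<circ> ?t c) = \<sigma>"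
      by (simp add: o_assoc[symmetric])
    show "(\<sigma> \<circ> ?t ?c, ?c) \<in> ?A"
      using \<sigma> c c1 \<sigma>c permutes_compose[OF t[OF c] \<sigma>(1)] by simp
    have sgn: "sign (\<sigma> \<circ> ?t ?c) = - sign \<sigma>"
      using permutes_imp_permutation[OF _ \<sigma>(1)] permutes_imp_permutation[OF _ t[OF c]] c1
      by (simp add: sign_compose sign_swap_id)
    have "?M (\<sigma> \<circ> ?t ?c) = Xm ?c (\<sigma> 1) * (\<Prod>j\<in>?I - {1} - {?c}. Xm j ((\<sigma> \<circ> ?t ?c) j))"
      using c c1 by (subst prod.remove[of _ ?c]) auto
    also have "(\<Prod>j\<in>?I - {1} - {?c}. Xm j ((\<sigma> \<circ> ?t ?c) j)) = (\<Prod>j\<in>?I - {1} - {?c}. Xm j (\<sigma> j) :: 'l comm_uea)"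
      by (rule prod.cong) (auto simp: transpose_def)
    finally show "(case (\<sigma> \<circ> ?t ?c, ?c) of (\<tau>, c) \<Rightarrow> - (of_int (sign \<tau>) *\<^sub>C ?M \<tau>)) = ?f \<sigma>"
      by (simp only: prod.case sgn comm_X_sym[of "idx ?c" "idx (\<sigma> 1)"] of_int_minus cvec.scale_minus_left
          minus_minus)
  next
    fix b assume "b \<in> ?A"
    then obtain \<tau> c where b: "b = (\<tau>, c)" "\<tau> permutes ?I" "\<tau> 1 = 1" "c \<in> ?I" "c \<noteq> 1" by blast
    note inv_c = inv_comp[OF b(2,3,4)]
    show "(\<lambda>\<sigma>. (\<sigma> \<circ> ?t (inv \<sigma> 1), inv \<sigma> 1)) (case b of (\<tau>, c) \<Rightarrow> \<tau> \<circ> ?t c) = b"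
      by (simp only: b(1) prod.case inv_c) (simp add: o_assoc[symmetric])
    have "\<tau> c \<noteq> 1" using b(2,3,5) by (metis permutes_inverses(2))
    then show "(case b of (\<tau>, c) \<Rightarrow> \<tau> \<circ> ?t c) \<in> {\<sigma>. \<sigma> permutes ?I \<and> \<sigma> 1 \<noteq> 1}"
      using b permutes_compose[OF t[OF b(4)] b(2)] by simp
  qed
  also have "\<dots> = (\<Sum>\<tau> | \<tau> permutes ?I \<and> \<tau> 1 = 1. \<Sum>c\<in>?I - {1}. - (of_int (sign \<tau>) *\<^sub>C ?M \<tau>))"
    by (rule sum.cartesian_product[symmetric])
  also have "\<dots> = (- (of_nat m - 1)) *\<^sub>C comm_minor m"
  proof -
    have const: "(\<Sum>c\<in>?I - {1}. - x) = (- (of_nat m - 1)) *\<^sub>C x" for x :: "'l comm_uea"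
    proof -
      from sum_const_uminus[of "?I - {1}" x] show ?thesis using assms by (simp add: of_nat_diff cvec.scale_left_diff_distrib)
    qed
    show ?thesis unfolding const comm_minor_def by (simp only: cvec.scale_sum_right)
  qed
  finally show ?thesis .
qed

lemma commute_prod:
  fixes x :: "'i \<Rightarrow> 'l::{finite,linorder} comm_uea"
  assumes "finite A" "\<And>i. i \<in> A \<Longrightarrow> G * Rep_comm_uea (x i) = Rep_comm_uea (x i) * G"
  shows "G * Rep_comm_uea (\<Prod>i\<in>A. x i) = Rep_comm_uea (\<Prod>i\<in>A. x i) * G"
  using commutator_prod[of A G x "\<lambda>_. 0"] assms by (simp add: Rep_comm_uea_simps)

text \<open>The commutator of \<open>X\<^sub>-\<^sub>\<theta>(1)\<close> with one monomial of the determinant. The terms ending in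
  \<open>G b\<close> with \<open>b \<noteq> 1\<close> vanish on powers of the determinant.\<close>

lemma theta_monomial:
  fixes m :: nat and \<sigma> :: "nat \<Rightarrow> nat"
  defines "F \<equiv> U_cc 1 (idx 1) (idx 1) :: 'l::{finite,linorder} affine uea"
    and "G \<equiv> \<lambda>b. U_ac 0 (idx b) (idx 1) :: 'l affine uea"
    and "R \<equiv> Rep_comm_uea :: 'l comm_uea \<Rightarrow> 'l affine uea"
  assumes m: "1 \<le> m" "m \<le> CARD('l)" and \<sigma>: "\<sigma> permutes {1..m}"
  defines "T \<equiv> (\<Prod>i\<in>{1..m}. Xm i (\<sigma> i))"
  shows "\<sigma> 1 = 1 \<Longrightarrow> F * R T - R T * F =
      R (\<Prod>j\<in>{1..m} - {1}. Xm j (\<sigma> j)) * ((- 4) *\<^sub>C G 1 + (- 4) *\<^sub>C uea_of aff_c)"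
    and "\<sigma> 1 \<noteq> 1 \<Longrightarrow> F * R T - R T * F =
      (- 2) *\<^sub>C (R (Xm (inv \<sigma> 1) 1 * (\<Prod>j\<in>{1..m} - {1} - {inv \<sigma> 1}. Xm j (\<sigma> j))) * G (\<sigma> 1))
      + 2 *\<^sub>C R (Xm (\<sigma> 1) (inv \<sigma> 1) * (\<Prod>j\<in>{1..m} - {1} - {inv \<sigma> 1}. Xm j (\<sigma> j)))
      + (- 2) *\<^sub>C (R (Xm 1 (\<sigma> 1) * (\<Prod>j\<in>{1..m} - {1} - {inv \<sigma> 1}. Xm j (\<sigma> j))) * G (inv \<sigma> 1))"
proof -
  have idx: "(idx i :: 'l) = idx j \<longleftrightarrow> i = j" if "i \<in> {1..m}" "j \<in> {1..m}" for i j
    using idx_eq_iff[of i j, where 'l = 'l] that m by auto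
  have one: "1 \<in> {1..m}" using m by simp
  have in_I: "\<sigma> i \<in> {1..m} \<longleftrightarrow> i \<in> {1..m}" for i using permutes_in_image[OF \<sigma>] .
  have \<sigma>1: "\<sigma> j = 1 \<longleftrightarrow> j = inv \<sigma> 1" for j using permutes_inverses[OF \<sigma>] by metis
  have F_comm: "F * R (Xm i j) = R (Xm i j) * F" if "i \<in> {1..m} - {1}" "j \<in> {1..m} - {1}" for i j
  proof -
    have "(idx 1 :: 'l) \<noteq> idx i" "(idx 1 :: 'l) \<noteq> idx j" using that idx one by auto
    then have "F * R (Xm i j) - R (Xm i j) * F = 0"
      using U_cc_U_aa[of "idx 1 :: 'l" "idx 1" 1 "idx i" "idx j"]
      by (simp add: F_def R_def comm_X.rep_eq)
    then show ?thesis by simp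
  qed
  have G_comm: "G b * R (Xm i j) = R (Xm i j) * G b" if "i \<in> {1..m} - {1}" "j \<in> {1..m} - {1}" for b i j
  proof -
    have "(idx 1 :: 'l) \<noteq> idx i" "(idx 1 :: 'l) \<noteq> idx j" using that idx one by auto
    then have "G b * R (Xm i j) - R (Xm i j) * G b = 0"
      using U_ac_U_aa[of "idx b :: 'l" "idx 1" 0 "idx i" "idx j" "- 1"]
      by (simp add: G_def R_def comm_X.rep_eq)
    then show ?thesis by simp
  qed
  have R_mult: "R (u * v) = R u * R v" for u v by (simp add: R_def times_comm_uea.rep_eq)
  {
    assume 1: "\<sigma> 1 = 1"
    let ?M = "\<Prod>j\<in>{1..m} - {1}. Xm j (\<sigma> j) :: 'l comm_uea"
    have T: "T = Xm 1 1 * ?M"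
      unfolding T_def using one 1 by (subst prod.remove[of _ 1]) auto
    have inv1: "inv \<sigma> 1 = 1" using 1 \<sigma>1 by metis
    have sub: "\<sigma> j \<in> {1..m} - {1}" if "j \<in> {1..m} - {1}" for j
      using that in_I[of j] \<sigma>1[of j] inv1 by auto
    have FM: "F * R ?M = R ?M * F"
      unfolding R_def by (rule commute_prod) (use F_comm sub R_def in auto)
    have GM: "G 1 * R ?M = R ?M * G 1"
      unfolding R_def by (rule commute_prod) (use G_comm sub R_def in auto)
    \<comment> \<open>All index conditions of \<open>U_cc_U_aa\<close> hold: the four terms with
      coefficient -1 add up to -4, and the central coefficient is -2 (1 + 1).\<close>
    have FX: "F * R (Xm 1 1) - R (Xm 1 1) * F = (- 4) *\<^sub>C G 1 + (- 4) *\<^sub>C uea_of aff_c"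
      using U_cc_U_aa[of "idx 1 :: 'l" "idx 1" 1 "idx 1" "idx 1"]
      by (simp add: F_def R_def G_def comm_X.rep_eq scaleC_4)
    have "F * R T - R T * F = (F * R (Xm 1 1) - R (Xm 1 1) * F) * R ?M + R (Xm 1 1) * (F * R ?M - R ?M * F)"
      unfolding T R_mult by (simp add: algebra_simps)
    also have "\<dots> = R ?M * ((- 4) *\<^sub>C G 1 + (- 4) *\<^sub>C uea_of aff_c)"
      unfolding FX FM distrib_right distrib_left scaleC_mult_left scaleC_mult_right GM uea_of_aff_c_commute by simp
    finally show "F * R T - R T * F = R ?M * ((- 4) *\<^sub>C G 1 + (- 4) *\<^sub>C uea_of aff_c)" .
  }
  {
    assume 1: "\<sigma> 1 \<noteq> 1"
    let ?b = "\<sigma> 1" and ?c = "inv \<sigma> 1"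
    let ?M = "\<Prod>j\<in>{1..m} - {1} - {?c}. Xm j (\<sigma> j) :: 'l comm_uea"
    have \<sigma>c: "\<sigma> ?c = 1" by (rule permutes_inverses(1)[OF \<sigma>])
    have c: "?c \<in> {1..m} - {1}" 
    proof -
      have "?c \<in> {1..m}" using \<sigma>c in_I[of ?c] one by metis
      moreover have "?c \<noteq> 1" using \<sigma>c 1 by metis
      ultimately show ?thesis by blast
    qed
    have b: "?b \<in> {1..m} - {1}" using 1 in_I[of 1] one by simp
    have "T = Xm 1 ?b * (\<Prod>j\<in>{1..m} - {1}. Xm j (\<sigma> j))"
      unfolding T_def using one by (subst prod.remove[of _ 1]) auto
    also have "(\<Prod>j\<in>{1..m} - {1}. Xm j (\<sigma> j) :: 'l comm_uea) = Xm ?c 1 * ?M"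
      using c \<sigma>c by (subst prod.remove[of _ ?c]) auto
    finally have T: "T = Xm 1 ?b * (Xm ?c 1 * ?M)" .
    have sub: "\<sigma> j \<in> {1..m} - {1}" if "j \<in> {1..m} - {1} - {?c}" for j
      using that in_I[of j] \<sigma>1[of j] by auto
    have FM: "F * R ?M = R ?M * F"
      unfolding R_def by (rule commute_prod) (use F_comm sub R_def in auto)
    have GM: "G d * R ?M = R ?M * G d" for d
      unfolding R_def by (rule commute_prod) (use G_comm sub R_def in auto)
    have ne: "(idx 1 :: 'l) \<noteq> idx ?b" "(idx 1 :: 'l) \<noteq> idx ?c" using idx b c one by auto
    have FX1: "F * R (Xm 1 ?b) - R (Xm 1 ?b) * F = (- 2) *\<^sub>C G ?b"
      using U_cc_U_aa[of "idx 1 :: 'l" "idx 1" 1 "idx 1" "idx ?b"] ne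
      by (simp add: F_def R_def G_def comm_X.rep_eq scaleC_2)
    have FX2: "F * R (Xm ?c 1) - R (Xm ?c 1) * F = (- 2) *\<^sub>C G ?c"
      using U_cc_U_aa[of "idx 1 :: 'l" "idx 1" 1 "idx ?c" "idx 1"] ne
      by (simp add: F_def R_def G_def comm_X.rep_eq scaleC_2)
    \<comment> \<open>Moving \<open>G ?b\<close> to the right past the second entry involving index
      1 leaves this scalar-free term; multiplied by -2 it is the one that survives on powers of the
      determinant.\<close>
    have "G ?b * R (Xm ?c 1) - R (Xm ?c 1) * G ?b = - R (Xm ?b ?c)"
      using U_ac_U_aa[of "idx ?b :: 'l" "idx 1" 0 "idx ?c" "idx 1" "- 1"] ne
      by (simp add: R_def G_def comm_X.rep_eq)
    then have GX: "G ?b * R (Xm ?c 1) = R (Xm ?c 1) * G ?b - R (Xm ?b ?c)" by (simp add: algebra_simps)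
    have "F * R T - R T * F = (F * R (Xm 1 ?b) - R (Xm 1 ?b) * F) * R (Xm ?c 1) * R ?M
        + R (Xm 1 ?b) * (F * R (Xm ?c 1) - R (Xm ?c 1) * F) * R ?M
        + R (Xm 1 ?b) * R (Xm ?c 1) * (F * R ?M - R ?M * F)"
      unfolding T R_mult by (simp add: algebra_simps)
    also have "\<dots> = (- 2) *\<^sub>C ((G ?b * R (Xm ?c 1)) * R ?M) + (- 2) *\<^sub>C (R (Xm 1 ?b) * (G ?c * R ?M))"
      unfolding FX1 FX2 FM by (simp add: scaleC_mult_left scaleC_mult_right mult.assoc)
    also have "(G ?b * R (Xm ?c 1)) * R ?M = R (Xm ?c 1 * ?M) * G ?b - R (Xm ?b ?c * ?M)"
      by (simp only: GX R_mult left_diff_distrib mult.assoc GM)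
    also have "R (Xm 1 ?b) * (G ?c * R ?M) = R (Xm 1 ?b * ?M) * G ?c"
      unfolding GM R_mult by (simp add: mult.assoc)
    finally show "F * R T - R T * F = (- 2) *\<^sub>C (R (Xm ?c 1 * ?M) * G ?b)
      + 2 *\<^sub>C R (Xm ?b ?c * ?M) + (- 2) *\<^sub>C (R (Xm 1 ?b * ?M) * G ?c)"
      by (simp add: cvec.scale_right_diff_distrib)
  }
qed

lemma vac_null_U_ac_power:
  assumes "p \<in> {1..CARD('l)}" "q \<in> {1..CARD('l)}" "m \<le> CARD('l)" "q \<le> m \<Longrightarrow> p \<le> m"
  shows "U_ac 0 (idx p) (idx q) * Delta m ^ s - (of_nat s * (if p = q \<and> q \<le> m then - 2 else 0)) *\<^sub>C Delta m ^ s
    \<in> (vac_null k :: 'l::{finite,linorder} affine uea set)"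
  using vac_null_eigen_power[OF U_ac_comm_det[OF assms], of 0 k s] by (simp add: vac_null_loop)

text \<open>On \<open>Delta m ^ s\<close> applied to the vacuum,
  \<open>U_ac 0 (idx 1) (idx 1)\<close> acts by -2 s and c by k, so each monomial with \<sigma> 1 =
  1 contributes 8 s - 4 k. The reordering terms of the other monomials carry the factor 2 and sum to
  -2 (m - 1) times the minor.\<close>

lemma theta_step:
  assumes m: "1 \<le> m" "m \<le> CARD('l)"
  shows "U_cc 1 (idx 1) (idx 1) * Delta m ^ Suc s - Delta m * (U_cc 1 (idx 1) (idx 1) * Delta m ^ s)
    - (8 * of_nat s - 4 * k - 2 * (of_nat m - 1)) *\<^sub>C (Rep_comm_uea (comm_minor m) * Delta m ^ s)
    \<in> (vac_null k :: 'l::{finite,linorder} affine uea set)"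
proof -
  let ?F = "U_cc 1 (idx 1) (idx 1) :: 'l affine uea" and ?G = "\<lambda>b. U_ac 0 (idx b) (idx 1) :: 'l affine uea"
  let ?I = "{1..m}" and ?D = "Delta m ^ s :: 'l affine uea" and ?R = "Rep_comm_uea :: 'l comm_uea \<Rightarrow> _"
  let ?mono = "\<lambda>\<sigma>. \<Prod>i\<in>?I. Xm i (\<sigma> i) :: 'l comm_uea"
  let ?M1 = "\<lambda>\<sigma>. \<Prod>j\<in>?I - {1}. Xm j (\<sigma> j) :: 'l comm_uea"
  let ?M2 = "\<lambda>\<sigma>. Xm (\<sigma> 1) (inv \<sigma> 1) * (\<Prod>j\<in>?I - {1} - {inv \<sigma> 1}. Xm j (\<sigma> j)) :: 'l comm_uea"
  let ?a = "8 * of_nat s - 4 * k :: complex"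
  let ?val = "\<lambda>\<sigma>. if \<sigma> 1 = 1 then ?a *\<^sub>C ?M1 \<sigma> else 2 *\<^sub>C ?M2 \<sigma>"
  have G: "?G b * ?D \<in> vac_null k" if "b \<in> ?I" "b \<noteq> 1" for b
    using vac_null_U_ac_power[of b 1 m s k, where 'l = 'l] that m by simp
  have G1: "?G 1 * ?D - (- 2 * of_nat s) *\<^sub>C ?D \<in> vac_null k"
    using vac_null_U_ac_power[of 1 1 m s k, where 'l = 'l] m by (simp add: mult.commute)
  have c: "uea_of aff_c * ?D - k *\<^sub>C ?D \<in> vac_null k"
    using vac_null_eigen_power[of "uea_of aff_c" "Delta m" 0 k k s] vac_null_c[of k]
    by (simp add: uea_of_aff_c_commute)
  have mono: "(?F * ?R (?mono \<sigma>) - ?R (?mono \<sigma>) * ?F) * ?D - ?R (?val \<sigma>) * ?D \<in> vac_null k"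
    if \<sigma>: "\<sigma> permutes ?I" for \<sigma>
  proof (cases "\<sigma> 1 = 1")
    case True
    have "(?F * ?R (?mono \<sigma>) - ?R (?mono \<sigma>) * ?F) * ?D - ?R (?val \<sigma>) * ?D =
        ?R (?M1 \<sigma>) * ((- 4) *\<^sub>C (?G 1 * ?D - (- 2 * of_nat s) *\<^sub>C ?D)
          + (- 4) *\<^sub>C (uea_of aff_c * ?D - k *\<^sub>C ?D))"
      unfolding theta_monomial(1)[OF m \<sigma> True]
      using True
      by (simp add: Rep_comm_uea_simps distrib_left distrib_right right_diff_distrib left_diff_distrib mult.assoc
          scaleC_mult_left scaleC_mult_right cvec.scale_right_diff_distrib scaleC_scaleC
          cvec.scale_left_diff_distrib scaleC_add_right mult.commute[of k])
    then show ?thesis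
      using G1 c by (simp only:) (intro vac_null_mult vac_null_add vac_null_scaleC)
  next
    case False
    have in_I: "\<sigma> 1 \<in> ?I" "inv \<sigma> 1 \<in> ?I" "inv \<sigma> 1 \<noteq> 1"
      using permutes_in_image[OF \<sigma>, of 1] permutes_in_image[OF permutes_inv[OF \<sigma>], of 1] m False
        permutes_inverses(1)[OF \<sigma>, of 1] by auto
    let ?P = "\<Prod>j\<in>?I - {1} - {inv \<sigma> 1}. Xm j (\<sigma> j) :: 'l comm_uea"
    have "(?F * ?R (?mono \<sigma>) - ?R (?mono \<sigma>) * ?F) * ?D - ?R (?val \<sigma>) * ?D =
        (- 2) *\<^sub>C (?R (Xm (inv \<sigma> 1) 1 * ?P) * (?G (\<sigma> 1) * ?D))
        + (- 2) *\<^sub>C (?R (Xm 1 (\<sigma> 1) * ?P) * (?G (inv \<sigma> 1) * ?D))"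
      unfolding theta_monomial(2)[OF m \<sigma> False]
      using False
      by (simp add: clinear_scaleC[OF clinear_Rep_comm_uea] distrib_right mult.assoc left_diff_distrib
          scaleC_mult_left)
    then show ?thesis
      by (simp only: vac_null_add[OF vac_null_scaleC[OF vac_null_mult[OF G[OF in_I(1) False]]]
            vac_null_scaleC[OF vac_null_mult[OF G[OF in_I(2,3)]]]])
  qed
  have val: "(\<Sum>\<sigma> | \<sigma> permutes ?I. of_int (sign \<sigma>) *\<^sub>C ?val \<sigma>) =
      (8 * of_nat s - 4 * k - 2 * (of_nat m - 1)) *\<^sub>C comm_minor m"
  proof -
    have fin: "finite {\<sigma>. \<sigma> permutes ?I}" by (simp add: finite_permutations)
    have "(\<Sum>\<sigma> | \<sigma> permutes ?I. of_int (sign \<sigma>) *\<^sub>C ?val \<sigma>) =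
        (\<Sum>\<sigma>\<in>{\<sigma>. \<sigma> permutes ?I} \<inter> {\<sigma>. \<sigma> 1 = 1}. of_int (sign \<sigma>) *\<^sub>C ?val \<sigma>)
        + (\<Sum>\<sigma>\<in>{\<sigma>. \<sigma> permutes ?I} - {\<sigma>. \<sigma> 1 = 1}. of_int (sign \<sigma>) *\<^sub>C ?val \<sigma>)"
      by (rule sum.Int_Diff[OF fin])
    also have "(\<Sum>\<sigma>\<in>{\<sigma>. \<sigma> permutes ?I} \<inter> {\<sigma>. \<sigma> 1 = 1}. of_int (sign \<sigma>) *\<^sub>C ?val \<sigma>) = ?a *\<^sub>C comm_minor m"
      unfolding comm_minor_def cvec.scale_sum_right
      by (rule sum.cong) (auto simp: scaleC_scaleC mult.commute)
    also have "(\<Sum>\<sigma>\<in>{\<sigma>. \<sigma> permutes ?I} - {\<sigma>. \<sigma> 1 = 1}. of_int (sign \<sigma>) *\<^sub>C ?val \<sigma>) =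
        2 *\<^sub>C (\<Sum>\<sigma> | \<sigma> permutes ?I \<and> \<sigma> 1 \<noteq> 1. of_int (sign \<sigma>) *\<^sub>C ?M2 \<sigma>)"
      unfolding cvec.scale_sum_right
      by (rule sum.cong) (auto simp: scaleC_scaleC mult.commute)
    also have "\<dots> = (- 2 * (of_nat m - 1)) *\<^sub>C comm_minor m"
      unfolding minor_sum[OF m(1)] scaleC_scaleC by simp
    finally show ?thesis by (simp add: scaleC_add_left[symmetric])
  qed
  have "?F * Delta m ^ Suc s - Delta m * (?F * ?D)
      - (8 * of_nat s - 4 * k - 2 * (of_nat m - 1)) *\<^sub>C (?R (comm_minor m) * ?D)
    = (?F * Delta m - Delta m * ?F) * ?D - ?R (\<Sum>\<sigma> | \<sigma> permutes ?I. of_int (sign \<sigma>) *\<^sub>C ?val \<sigma>) * ?D"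
    unfolding val by (simp add: left_diff_distrib mult.assoc clinear_scaleC[OF clinear_Rep_comm_uea] scaleC_mult_left)
  also have "\<dots> = (\<Sum>\<sigma> | \<sigma> permutes ?I. of_int (sign \<sigma>) *\<^sub>C
      ((?F * ?R (?mono \<sigma>) - ?R (?mono \<sigma>) * ?F) * ?D - ?R (?val \<sigma>) * ?D))"
    unfolding Delta_commutator clinear_sum[OF clinear_Rep_comm_uea] clinear_scaleC[OF clinear_Rep_comm_uea]
      sum_distrib_right sum_subtractf[symmetric]
    by (simp only: scaleC_mult_left cvec.scale_right_diff_distrib[symmetric])
  also have "\<dots> \<in> vac_null k"
    by (intro cvec.subspace_sum[OF subspace_vac_null] vac_null_scaleC) (use mono in auto)
  finally show ?thesis .
qed

text \<open>Sums the coefficients of \<open>theta_step\<close> over s < n, with 8 (0 + ... + (n -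
  1)) = 4 n (n - 1). The minor commutes with \<open>Delta m\<close>, so all contributions become
  multiples of one vector.\<close>

lemma theta_power:
  assumes m: "1 \<le> m" "m \<le> CARD('l)"
  shows "U_cc 1 (idx 1) (idx 1) * Delta m ^ n
    - (4 * of_nat n * (of_nat n - 1) - of_nat n * (4 * k + 2 * (of_nat m - 1))) *\<^sub>C
      (Rep_comm_uea (comm_minor m) * Delta m ^ (n - 1))
    \<in> (vac_null k :: 'l::{finite,linorder} affine uea set)"
proof (induction n)
  case 0
  show ?case by (simp add: vac_null_loop)
next
  case (Suc s)
  let ?F = "U_cc 1 (idx 1) (idx 1) :: 'l affine uea" and ?D = "Delta m :: 'l affine uea"
  let ?C = "Rep_comm_uea (comm_minor m) :: 'l affine uea"
  let ?a = "8 * of_nat s - 4 * k - 2 * (of_nat m - 1) :: complex"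
  let ?k = "\<lambda>n. 4 * of_nat n * (of_nat n - 1) - of_nat n * (4 * k + 2 * (of_nat m - 1)) :: complex"
  have comm: "?D * ?C = ?C * ?D" unfolding Rep_comm_det[symmetric] by (rule Rep_comm_uea_commute)
  \<comment> \<open>At s = 0 the truncated exponent is harmless, because the coefficient vanishes
    there.\<close>
  have shift: "?k s *\<^sub>C (?D * (?C * ?D ^ (s - 1))) = ?k s *\<^sub>C (?C * ?D ^ s)"
  proof (cases s)
    case (Suc r)
    then show ?thesis by (simp add: mult.assoc[symmetric] comm)
  qed simp
  have k_eq: "?k (Suc s) = ?k s + ?a" by (simp add: algebra_simps)
  have "?F * ?D ^ Suc s - ?k (Suc s) *\<^sub>C (?C * ?D ^ (Suc s - 1)) =
      (?F * ?D ^ Suc s - ?D * (?F * ?D ^ s) - ?a *\<^sub>C (?C * ?D ^ s))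
      + ?D * (?F * ?D ^ s - ?k s *\<^sub>C (?C * ?D ^ (s - 1)))"
  proof -
    have "?D * (?F * ?D ^ s - ?k s *\<^sub>C (?C * ?D ^ (s - 1))) = ?D * (?F * ?D ^ s) - ?k s *\<^sub>C (?C * ?D ^ s)"
      by (subst right_diff_distrib) (simp only: scaleC_mult_right shift)
    moreover have "?k (Suc s) *\<^sub>C (?C * ?D ^ (Suc s - 1)) = ?k s *\<^sub>C (?C * ?D ^ s) + ?a *\<^sub>C (?C * ?D ^ s)"
      by (simp only: k_eq scaleC_add_left diff_Suc_1)
    moreover have "x - (y + z) = (x - u - z) + (u - y)" for x y z u :: "'l affine uea" by simp
    ultimately show ?thesis by (simp only:)
  qed
  also have "\<dots> \<in> vac_null k"
    by (intro vac_null_add vac_null_mult theta_step[OF m] Suc)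
  finally show ?case .
qed

lemma theta_singular:
  assumes "1 \<le> m" "m \<le> CARD('l)"
  shows "U_cc 1 (idx 1) (idx 1) * Delta m ^ n \<in> (vac_null (k_level m n) :: 'l::{finite,linorder} affine uea set)"
proof -
  have zero: "4 * of_nat n * (of_nat n - 1) - of_nat n * (4 * k_level m n + 2 * (of_nat m - 1)) = (0 :: complex)"
    by (simp add: k_level_def field_simps)
  show ?thesis
    using theta_power[OF assms, of n "k_level m n"] unfolding zero cvec.scale_zero_left diff_zero .
qed

section \<open>Vanishing for degree reasons on the subalgebra generated by the X(-1)\<close>

definition X_loops :: "'l::{finite,linorder} affine set" where
  "X_loops = {loop_elem (sp_of (Ann i) (Ann j)) (- 1) | i j. True}"

definition X_words :: "'l::{finite,linorder} affine uea set" where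
  "X_words = cspan {prod_list (map uea_of xs) | xs. set xs \<subseteq> X_loops}"

lemma X_words_mult:
  assumes "u \<in> X_words" "v \<in> X_words"
  shows "u * v \<in> X_words"
proof -
  let ?W = "{prod_list (map uea_of xs) | xs. set xs \<subseteq> X_loops} :: 'a affine uea set"
  have word: "w * v \<in> cspan ?W" if w: "w \<in> ?W" for w
    using assms(2) unfolding X_words_def
  proof (induction rule: cvec.span_induct_alt)
    case base
    show ?case by (simp add: cvec.span_zero)
  next
    case (step c x y)
    obtain xs ys where "w = prod_list (map uea_of xs)" "x = prod_list (map uea_of ys)"
      "set xs \<subseteq> X_loops" "set ys \<subseteq> X_loops" using w step(1) by blast
    then have "w * x = prod_list (map uea_of (xs @ ys))" "set (xs @ ys) \<subseteq> X_loops" by simp_all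
    then have "w * x \<in> ?W" by blast
    then show ?case
      using step(2) by (simp add: distrib_left scaleC_mult_right cvec.span_add cvec.span_scale cvec.span_base)
  qed
  show ?thesis
    using assms(1) unfolding X_words_def
    by (induction rule: cvec.span_induct_alt)
      (simp_all add: cvec.span_zero distrib_right scaleC_mult_left cvec.span_add cvec.span_scale word)
qed

lemma Delta_monomial:
  "prod_list (map (\<lambda>i. uea_of (loop_elem (X_plus (idx i) (idx (\<sigma> i))) (- 1))) is) =
    prod_list (map uea_of (map (\<lambda>i. loop_elem (X_plus (idx i) (idx (\<sigma> i))) (- 1)) is))"
  "set (map (\<lambda>i. loop_elem (X_plus (idx i) (idx (\<sigma> i))) (- 1)) is) \<subseteq> X_loops"
  by (auto simp: comp_def X_loops_def X_plus_def)

lemma Delta_in_X_words: "Delta m \<in> X_words"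
  unfolding Delta_def X_words_def
  by (intro cvec.span_sum cvec.span_scale cvec.span_base) (use Delta_monomial in blast)

lemma one_in_X_words: "1 \<in> X_words"
  unfolding X_words_def by (intro cvec.span_base CollectI exI[of _ "[]"]) simp

lemma Delta_power_in_X_words: "Delta m ^ n \<in> X_words"
  by (induction n) (simp_all add: one_in_X_words X_words_mult Delta_in_X_words)

text \<open>The three bounds form a chain. \<open>U_aa\<close> commutes with the letters; passing a
  letter turns \<open>U_ac\<close> of degree n into \<open>U_aa\<close> of degree n - 1, and
  \<open>U_cc\<close> of degree n into \<open>U_ac\<close> of degree n - 1, with no central term
  once n is at least 2.\<close>

lemma X_words_null:
  assumes "u \<in> X_words"
  shows "0 \<le> n \<Longrightarrow> U_aa n p q * u \<in> vac_null k"
    and "1 \<le> n \<Longrightarrow> U_ac n p q * u \<in> vac_null k"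
    and "2 \<le> n \<Longrightarrow> U_cc n p q * u \<in> vac_null k"
proof -
  have span: "v * u \<in> vac_null k"
    if "\<And>xs. set xs \<subseteq> X_loops \<Longrightarrow> v * prod_list (map uea_of xs) \<in> vac_null k" for v
    using assms unfolding X_words_def
    by (induction rule: cvec.span_induct_alt)
      (auto simp: vac_null_0 distrib_left scaleC_mult_right that intro!: vac_null_add vac_null_scaleC)
  have swap: "v * (x * w) \<in> vac_null k"
    if "v * w \<in> vac_null k" "(v * x - x * v) * w \<in> vac_null k" for v x w :: "'a affine uea"
    using vac_null_add[OF that(2) vac_null_mult[OF that(1), of x]] by (simp add: algebra_simps)
  have aa: "U_aa n p q * prod_list (map uea_of xs) \<in> vac_null k"
    if "set xs \<subseteq> X_loops" "0 \<le> n" for n and p q :: 'a and xs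
    using that(1)
  proof (induction xs)
    case (Cons x xs)
    then obtain i j where "x = loop_elem (sp_of (Ann i) (Ann j)) (- 1)" by (auto simp: X_loops_def)
    with Cons show ?case by (auto intro!: swap simp: U_aa_commute vac_null_0)
  qed (simp add: vac_null_loop that)
  have ac: "U_ac n p q * prod_list (map uea_of xs) \<in> vac_null k"
    if "set xs \<subseteq> X_loops" "1 \<le> n" for n and p q :: 'a and xs
    using that(1)
  proof (induction xs)
    case (Cons x xs)
    then obtain i j where x: "x = loop_elem (sp_of (Ann i) (Ann j)) (- 1)" by (auto simp: X_loops_def)
    have "(U_ac n p q * U_aa (- 1) i j - U_aa (- 1) i j * U_ac n p q) * prod_list (map uea_of xs) \<in> vac_null k"
      unfolding U_ac_U_aa distrib_right
    proof (rule vac_null_add)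
      have "- U_aa (n + - 1) a b * prod_list (map uea_of xs) \<in> vac_null k" for a b
        using cvec.subspace_neg[OF subspace_vac_null aa[of xs "n - 1" a b]] Cons.prems that(2) by simp
      then show "(if q = i then - U_aa (n + - 1) p j else 0) * prod_list (map uea_of xs) \<in> vac_null k"
        "(if q = j then - U_aa (n + - 1) p i else 0) * prod_list (map uea_of xs) \<in> vac_null k"
        by (simp_all add: vac_null_0)
    qed
    with Cons show ?case by (auto intro!: swap simp: x)
  qed (use that in \<open>simp add: vac_null_loop\<close>)
  have cc: "U_cc n p q * prod_list (map uea_of xs) \<in> vac_null k"
    if "set xs \<subseteq> X_loops" "2 \<le> n" for n and p q :: 'a and xs
    using that(1)
  proof (induction xs)
    case (Cons x xs)
    then obtain i j where x: "x = loop_elem (sp_of (Ann i) (Ann j)) (- 1)" by (auto simp: X_loops_def)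
    have E: "U_ac (n - 1) a b * prod_list (map uea_of xs) \<in> vac_null k" for a b
      using ac[of xs "n - 1"] Cons.prems that(2) by simp
    have "(U_cc n p q * U_aa (- 1) i j - U_aa (- 1) i j * U_cc n p q) * prod_list (map uea_of xs) \<in> vac_null k"
      unfolding U_cc_U_aa distrib_right scaleC_mult_left
      by (intro vac_null_add; (rule vac_null_scaleC[OF E] | use that(2) in \<open>simp add: vac_null_0\<close>))
    with Cons show ?case by (auto intro!: swap simp: x)
  qed (use that in \<open>simp add: vac_null_loop\<close>)
  show "0 \<le> n \<Longrightarrow> U_aa n p q * u \<in> vac_null k" by (rule span[OF aa])
  show "1 \<le> n \<Longrightarrow> U_ac n p q * u \<in> vac_null k" by (rule span[OF ac])
  show "2 \<le> n \<Longrightarrow> U_cc n p q * u \<in> vac_null k" by (rule span[OF cc])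
qed

lemma vac_null_lie:
  assumes "uea_of x * u \<in> vac_null k" "uea_of y * u \<in> vac_null k"
  shows "uea_of (lie x y) * u \<in> vac_null k"
  using vac_null_diff[OF vac_null_mult[OF assms(2), of "uea_of x"] vac_null_mult[OF assms(1), of "uea_of y"]]
  by (simp add: uea_of_lie[symmetric] left_diff_distrib mult.assoc)

lemma Delta_power_U_ac:
  assumes "p \<in> {1..CARD('l)}" "q \<in> {1..CARD('l)}" "p < q" "m \<le> CARD('l)"
  shows "U_ac 0 (idx p) (idx q) * Delta m ^ n \<in> (vac_null k :: 'l::{finite,linorder} affine uea set)"
  using vac_null_U_ac_power[OF assms(1,2,4), of n k] assms(3) by simp

text \<open>The elements annihilating a vector are closed under brackets. From X_{-2 eps_1}(1),
  brackets with X_{eps_1 - eps_j}(0), which are positive and annihilate the vector, lower each index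
  1 in turn to an arbitrary one.\<close>

lemma Delta_power_U_cc:
  fixes a b :: "'l::{finite,linorder}"
  assumes m: "1 \<le> m" "m \<le> CARD('l)"
  shows "U_cc 1 a b * Delta m ^ n \<in> vac_null (k_level m n)"
proof -
  let ?J = "vac_null (k_level m n) :: 'l affine uea set" and ?o = "idx 1 :: 'l"
  have E: "U_ac 0 ?o j * Delta m ^ n \<in> ?J" if "j \<noteq> ?o" for j
  proof -
    obtain q where q: "q \<in> {1..CARD('l)}" "j = idx q" using idx_surj .
    with that have "1 < q" by (cases "q = 1") auto
    then show ?thesis using Delta_power_U_ac[of 1 q m n] q m by simp
  qed
  have step: "uea_of (loop_elem (lie (sp_of (Ann ?o) (Cre j)) x) 1) * Delta m ^ n \<in> ?J"
    if "j \<noteq> ?o" "uea_of (loop_elem x 1) * Delta m ^ n \<in> ?J" for j x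
    using vac_null_lie[OF E[OF that(1)] that(2)] by (simp add: lie_loop_elem)
  have first: "U_cc 1 ?o ?o * Delta m ^ n \<in> ?J" by (rule theta_singular[OF m])
  have one: "U_cc 1 ?o j * Delta m ^ n \<in> ?J" for j
  proof (cases "j = ?o")
    case False
    have "lie (sp_of (Ann ?o) (Cre j)) (sp_of (Cre ?o) (Cre ?o)) = 2 *\<^sub>C sp_of (Cre ?o) (Cre j)"
      by (simp add: lie_sp_of scaleC_2 sp_of_commute[of "Cre j"])
    then have "2 *\<^sub>C (U_cc 1 ?o j * Delta m ^ n) \<in> ?J"
      using step[OF False first] by (simp add: loop_elem_simps uea_of_simps scaleC_mult_left)
    then have "(1/2) *\<^sub>C 2 *\<^sub>C (U_cc 1 ?o j * Delta m ^ n) \<in> ?J" by (rule vac_null_scaleC)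
    then show ?thesis by (simp add: scaleC_scaleC)
  qed (simp add: first[simplified])
  show ?thesis
  proof (cases "a = ?o \<or> b = ?o")
    case True
    then show ?thesis using one[of a] one[of b] sp_of_commute[of "Cre a" "Cre b"] by auto
  next
    case False
    then have "lie (sp_of (Ann ?o) (Cre a)) (sp_of (Cre ?o) (Cre b)) = sp_of (Cre a) (Cre b)"
      by (auto simp: lie_sp_of)
    then show ?thesis using step[OF _ one, of a b] False by simp
  qed
qed

lemma Delta_power_affine_pos:
  fixes y :: "'l::{finite,linorder} affine"
  assumes m: "1 \<le> m" "m \<le> CARD('l)" and "y \<in> affine_pos"
  shows "uea_of y * Delta m ^ n \<in> vac_null (k_level m n)"
proof -
  let ?J = "vac_null (k_level m n) :: 'l affine uea set"
  have sp: "uea_of (loop_elem (sp_of g h) i) * Delta m ^ n \<in> ?J" if "1 \<le> i" for g h i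
  proof (cases g; cases h)
    fix a b assume "g = Ann a" "h = Ann b"
    then show ?thesis using that by (simp add: X_words_null(1)[OF Delta_power_in_X_words])
  next
    fix a b assume "g = Ann a" "h = Cre b"
    then show ?thesis using that by (simp add: X_words_null(2)[OF Delta_power_in_X_words])
  next
    fix a b assume "g = Cre a" "h = Ann b"
    then show ?thesis
      using that
      by (simp add: X_words_null(2)[OF Delta_power_in_X_words] sp_of_commute[of "Cre _" "Ann _"])
  next
    fix a b assume "g = Cre a" "h = Cre b"
    then show ?thesis
      using that by (cases "i = 1")
        (simp_all add: X_words_null(3)[OF Delta_power_in_X_words] Delta_power_U_cc[OF m])
  qed
  have loop: "uea_of (loop_elem x i) * Delta m ^ n \<in> ?J" if "1 \<le> i" for x i
    using sp_span[of x]
    by (induction rule: cvec.span_induct_alt)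
      (auto simp: loop_elem_simps uea_of_simps distrib_right scaleC_mult_left vac_null_0 sp[OF that]
        intro!: vac_null_add vac_null_scaleC)
  from assms(3) obtain f where y: "y = Affine f 0 0" "Poly_Mapping.keys f \<subseteq> {1..}"
    unfolding affine_pos_def by blast
  have "uea_of y * Delta m ^ n =
      (\<Sum>i\<in>Poly_Mapping.keys f. uea_of (loop_elem (Poly_Mapping.lookup f i) i) * Delta m ^ n)"
    unfolding y(1) affine_expand by (simp add: clinear_sum[OF clinear_uea_of] sum_distrib_right)
  also have "\<dots> \<in> ?J"
    by (intro cvec.subspace_sum[OF subspace_vac_null] loop) (use y(2) in auto)
  finally show ?thesis .
qed

section \<open>Root spaces and positive roots\<close>

lemma sp_expand:
  fixes x :: "'l::finite sp"
  shows "x = (1/2) *\<^sub>C (\<Sum>g\<in>UNIV. \<Sum>h\<in>UNIV.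
    (gen_sign g * gen_sign h * sp_coord x (conj_gen g) (conj_gen h)) *\<^sub>C sp_of g h)"
proof (rule clinear_sp_eqI[of "\<lambda>x. x"])
  show "clinear (\<lambda>x :: 'l sp. x)" by (rule clinear_ident)
  show "clinear (\<lambda>x :: 'l sp. (1/2) *\<^sub>C (\<Sum>g\<in>UNIV. \<Sum>h\<in>UNIV.
    (gen_sign g * gen_sign h * sp_coord x (conj_gen g) (conj_gen h)) *\<^sub>C sp_of g h))"
    by (intro clinear_const_scaleC clinear_sumI clinear_scaleC_const clinear_times_right clinear_sp_coord)
  fix p q :: "'l weyl_gen"
  \<comment> \<open>The vector \<open>sp_of p q\<close> is reached at (p, q) and at (q, p), which
    accounts for the factor 1/2.\<close>
  have "(gen_sign g * gen_sign h * sp_coord (sp_of p q) (conj_gen g) (conj_gen h)) *\<^sub>C sp_of g h =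
      (if h = q then (if g = p then sp_of p q else 0) else 0)
      + (if h = p then (if g = q then sp_of p q else 0) else 0)" for g h
    by (cases p; cases q) (auto simp: sp_coord_sp_of symp_conj_gen sp_of_commute scaleC_2)
  then show "sp_of p q = (1/2) *\<^sub>C (\<Sum>g\<in>UNIV. \<Sum>h\<in>UNIV.
    (gen_sign g * gen_sign h * sp_coord (sp_of p q) (conj_gen g) (conj_gen h)) *\<^sub>C sp_of g h)"
    by (simp add: sum.distrib scaleC_2[symmetric] scaleC_scaleC)
qed

lemma sp_coord_lie_cartan_h:
  "sp_coord (lie (cartan_h i) x) g h = (- gen_weight g i - gen_weight h i) * sp_coord x g h"
proof (rule clinear_sp_eqI[of "\<lambda>x. sp_coord (lie (cartan_h i) x) g h"])
  show "clinear (\<lambda>x. sp_coord (lie (cartan_h i) x) g h)"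
    by (rule clinear_compose[OF clinear_sp_coord clinear_lie_sp(2)])
  show "clinear (\<lambda>x. (- gen_weight g i - gen_weight h i) * sp_coord x g h)"
    by (intro clinear_times_right clinear_sp_coord)
  have w: "symp p g \<noteq> 0 \<Longrightarrow> gen_weight p i = - gen_weight g i" for p g :: "'a weyl_gen"
    by (cases p; cases g) (auto split: if_splits)
  fix p q
  show "sp_coord (lie (cartan_h i) (sp_of p q)) g h =
      (- gen_weight g i - gen_weight h i) * sp_coord (sp_of p q) g h"
    unfolding lie_cartan_h_sp_of clinear_scaleC[OF clinear_sp_coord] sp_coord_sp_of
    using w[of p g] w[of q h] w[of q g] w[of p h]
    by (cases "symp p g = 0"; cases "symp q h = 0"; cases "symp q g = 0"; cases "symp p h = 0") auto
qed

lemma gen_weight_conj_gen: "gen_weight (conj_gen g) i = - gen_weight g i"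
  by (cases g) auto

text \<open>A root space is defined as a joint eigenspace. Each coordinate in
  \<open>sp_expand\<close> is itself scaled by the weight of its basis vector, so the coordinates at
  vectors of a different weight vanish.\<close>

lemma root_space_span:
  fixes x :: "'l::{finite,linorder} sp"
  assumes "x \<in> root_space \<alpha>"
  shows "x \<in> cspan {sp_of g h | g h. \<forall>i. gen_weight g i + gen_weight h i = \<alpha> i}"
proof -
  have "(gen_sign g * gen_sign h * sp_coord x (conj_gen g) (conj_gen h)) *\<^sub>C sp_of g h
      \<in> cspan {sp_of g h | g h. \<forall>i. gen_weight g i + gen_weight h i = \<alpha> i}" for g h
  proof (cases "\<forall>i. gen_weight g i + gen_weight h i = \<alpha> i")
    case True
    then show ?thesis by (intro cvec.span_scale cvec.span_base) blast
  next
    case False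
    then obtain i where i: "gen_weight g i + gen_weight h i \<noteq> \<alpha> i" by blast
    have "lie (cartan_h i) x = \<alpha> i *\<^sub>C x" using assms by (simp add: root_space_def)
    then have "\<alpha> i * sp_coord x (conj_gen g) (conj_gen h) =
        (gen_weight g i + gen_weight h i) * sp_coord x (conj_gen g) (conj_gen h)"
      using sp_coord_lie_cartan_h[of i x "conj_gen g" "conj_gen h"]
      by (simp add: clinear_scaleC[OF clinear_sp_coord] gen_weight_conj_gen)
    with i have "sp_coord x (conj_gen g) (conj_gen h) = 0" by auto
    then show ?thesis by (simp add: cvec.span_zero)
  qed
  then show ?thesis
    by (subst sp_expand) (rule cvec.span_scale, intro cvec.span_sum)
qed

text \<open>A linear criterion satisfied by the simple roots: the partial sums of eps_i - eps_{i+1}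
  are 0 or 1, and those of twice the last eps are 0 or 2. It excludes negative roots without
  enumerating the positive ones.\<close>

lemma positive_root_partial_sum:
  fixes \<alpha> :: "'l::{finite,linorder} weight"
  assumes "positive_root \<alpha>" "r \<in> {1..CARD('l)}"
  shows "0 \<le> Re (\<Sum>s\<in>{1..r}. \<alpha> (idx s))"
proof -
  obtain c :: "nat \<Rightarrow> nat" where c: "\<alpha> = (\<lambda>j. \<Sum>i=1..CARD('l). of_nat (c i) * simple_root i j)"
    using assms(1) unfolding positive_root_def by blast
  have eps: "(\<Sum>s\<in>{1..r}. eps (idx i :: 'l) (idx s)) = (if i \<le> r then 1 else 0)" if "i \<in> {1..CARD('l)}" for i
  proof -
    have "(\<Sum>s\<in>{1..r}. eps (idx i :: 'l) (idx s)) = (\<Sum>s\<in>{1..r}. if s = i then 1 else 0)"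
      by (rule sum.cong) (use that assms(2) idx_eq_iff[where 'l = 'l] in \<open>auto simp: eps_def\<close>)
    then show ?thesis using that by simp
  qed
  have simple: "0 \<le> Re (\<Sum>s\<in>{1..r}. simple_root i (idx s :: 'l))" if "i \<in> {1..CARD('l)}" for i
  proof (cases "i < CARD('l)")
    case True
    then have "(\<Sum>s\<in>{1..r}. simple_root i (idx s :: 'l)) =
        (if i \<le> r then 1 else 0) - (if i + 1 \<le> r then 1 else 0)"
      using eps[of i] eps[of "i + 1"] that by (simp add: simple_root_def sum_subtractf)
    then show ?thesis by simp
  next
    case False
    then have "(\<Sum>s\<in>{1..r}. simple_root i (idx s :: 'l)) = 2 * (if CARD('l) \<le> r then 1 else 0)"
      using eps[of "CARD('l)"] that by (simp add: simple_root_def sum_distrib_left[symmetric])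
    then show ?thesis by simp
  qed
  have "(\<Sum>s\<in>{1..r}. \<alpha> (idx s)) = (\<Sum>i=1..CARD('l). of_nat (c i) * (\<Sum>s\<in>{1..r}. simple_root i (idx s :: 'l)))"
    unfolding c sum_distrib_left by (rule sum.swap)
  also have "Re \<dots> = (\<Sum>i=1..CARD('l). real (c i) * Re (\<Sum>s\<in>{1..r}. simple_root i (idx s :: 'l)))"
    by simp
  also have "\<dots> \<ge> 0" by (intro sum_nonneg mult_nonneg_nonneg simple) auto
  finally show ?thesis .
qed

lemma Delta_power_n_plus:
  fixes x :: "'l::{finite,linorder} sp"
  assumes m: "m \<le> CARD('l)" and "x \<in> n_plus"
  shows "uea_of (loop_elem x 0) * Delta m ^ n \<in> vac_null k"
proof -
  let ?J = "vac_null k :: 'l affine uea set"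
  have mixed: "U_ac 0 a b * Delta m ^ n \<in> ?J"
    if \<alpha>: "positive_root \<alpha>" "\<alpha> = (\<lambda>i. gen_weight (Ann a) i + gen_weight (Cre b) i)" for a b :: 'l and \<alpha>
  proof -
    obtain p where p: "p \<in> {1..CARD('l)}" "a = idx p" using idx_surj .
    obtain q where q: "q \<in> {1..CARD('l)}" "b = idx q" using idx_surj .
    \<comment> \<open>Cutting off at q counts the entry -1 of eps_p - eps_q, which has to be
      compensated by an entry +1 at some p up to q.\<close>
    have "(\<Sum>s\<in>{1..q}. \<alpha> (idx s)) = (\<Sum>s\<in>{1..q}. (if s = p then 1 else 0) - (if s = q then 1 else 0))"
      by (rule sum.cong) (use p q idx_eq_iff[where 'l = 'l] in \<open>auto simp: \<alpha>(2) eps_def\<close>)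
    also have "\<dots> = (if p \<le> q then 1 else 0) - 1"
      using p q by (simp add: sum_subtractf)
    finally have "p \<le> q"
      using positive_root_partial_sum[OF \<alpha>(1) q(1)] by (simp split: if_splits)
    moreover have "p \<noteq> q"
      using \<alpha> p q by (auto simp: positive_root_def)
    ultimately show ?thesis using Delta_power_U_ac[OF p(1) q(1) _ m, of n k] p(2) q(2) by simp
  qed
  have gens: "uea_of (loop_elem (sp_of g h) 0) * Delta m ^ n \<in> ?J"
    if \<alpha>: "positive_root \<alpha>" "\<forall>i. gen_weight g i + gen_weight h i = \<alpha> i" for \<alpha> g h
  proof (cases g; cases h)
    fix a b assume "g = Ann a" "h = Ann b"
    then show ?thesis by (simp add: X_words_null(1)[OF Delta_power_in_X_words])
  next
    fix a b assume "g = Ann a" "h = Cre b"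
    then show ?thesis using mixed[OF \<alpha>(1), of a b] \<alpha>(2) by (simp add: fun_eq_iff)
  next
    fix a b assume "g = Cre a" "h = Ann b"
    then show ?thesis
      using mixed[OF \<alpha>(1), of b a] \<alpha>(2) by (simp add: fun_eq_iff sp_of_commute[of "Cre a"] algebra_simps)
  next
    fix a b assume gh: "g = Cre a" "h = Cre b"
    \<comment> \<open>The sum of all coordinates of -(eps_a + eps_b) is -2, so no such weight is a
      positive root.\<close>
    have "(\<Sum>s\<in>{1..CARD('l)}. f (idx s)) = (\<Sum>i\<in>UNIV. f i)" for f :: "'l \<Rightarrow> complex"
      by (rule sum.reindex_bij_betw[OF idx_bij])
    then have "(\<Sum>s\<in>{1..CARD('l)}. \<alpha> (idx s)) = (\<Sum>i\<in>UNIV. - eps a i - eps b i)"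
      using \<alpha>(2) gh by (simp add: fun_eq_iff[symmetric] eq_commute[of _ "\<alpha> _"])
    also have "\<dots> = - 2" by (simp add: sum_subtractf sum_negf eps_def)
    finally show ?thesis using positive_root_partial_sum[OF \<alpha>(1), of "CARD('l)"] by simp
  qed
  let ?S = "{x. uea_of (loop_elem x 0) * Delta m ^ n \<in> ?J}"
  have S: "cvec.subspace ?S"
    by (rule cvec.subspaceI)
      (auto simp: loop_elem_simps uea_of_simps distrib_right scaleC_mult_left vac_null_0
        intro: vac_null_add vac_null_scaleC)
  have "root_space \<alpha> \<subseteq> ?S" if "positive_root \<alpha>" for \<alpha>
  proof
    fix y assume "y \<in> root_space \<alpha>"
    then have "y \<in> cspan {sp_of g h | g h. \<forall>i. gen_weight g i + gen_weight h i = \<alpha> i}"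
      by (rule root_space_span)
    moreover have "cspan {sp_of g h | g h. \<forall>i. gen_weight g i + gen_weight h i = \<alpha> i} \<subseteq> ?S"
      by (rule cvec.span_minimal[OF _ S]) (use gens[OF that] in blast)
    ultimately show "y \<in> ?S" by blast
  qed
  then have "n_plus \<subseteq> ?S"
    unfolding n_plus_def by (intro cvec.span_minimal[OF _ S]) blast
  then show ?thesis using assms(2) by blast
qed

section \<open>Weights and nonvanishing\<close>

lemma aff_d_Delta: "uea_of aff_d * Delta m - Delta m * uea_of aff_d =
    (- of_nat m) *\<^sub>C (Delta m :: 'l::{finite,linorder} affine uea)"
proof -
  let ?d = "uea_of aff_d :: 'l affine uea" and ?R = "Rep_comm_uea :: 'l comm_uea \<Rightarrow> _"
  let ?mono = "\<lambda>\<sigma>. \<Prod>i\<in>{1..m}. Xm i (\<sigma> i) :: 'l comm_uea"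
  have mono: "?d * ?R (?mono \<sigma>) - ?R (?mono \<sigma>) * ?d = (- of_nat m) *\<^sub>C ?R (?mono \<sigma>)" for \<sigma>
  proof -
    have "?d * ?R (?mono \<sigma>) - ?R (?mono \<sigma>) * ?d =
        ?R (\<Sum>i\<in>{1..m}. - Xm i (\<sigma> i) * (\<Prod>j\<in>{1..m} - {i}. Xm j (\<sigma> j)))"
      by (rule commutator_prod)
        (simp_all add: comm_X.rep_eq uea_of_lie lie_aff_d uea_of_simps Rep_comm_uea_simps)
    also have "(\<Sum>i\<in>{1..m}. - Xm i (\<sigma> i) * (\<Prod>j\<in>{1..m} - {i}. Xm j (\<sigma> j))) = (\<Sum>i\<in>{1..m}. - ?mono \<sigma>)"
    proof (rule sum.cong[OF refl])
      fix i assume "i \<in> {1..m}"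
      then show "- Xm i (\<sigma> i) * (\<Prod>j\<in>{1..m} - {i}. Xm j (\<sigma> j)) = - ?mono \<sigma>"
        using prod.remove[of "{1..m}" i "\<lambda>i. Xm i (\<sigma> i) :: 'l comm_uea"] by simp
    qed
    also have "\<dots> = (- of_nat m) *\<^sub>C ?mono \<sigma>"
      by (simp add: sum_const_uminus)
    finally show ?thesis by (simp add: Rep_comm_uea_simps)
  qed
  have "?d * Delta m - Delta m * ?d =
      (\<Sum>\<sigma> | \<sigma> permutes {1..m}. of_int (sign \<sigma>) *\<^sub>C (?d * ?R (?mono \<sigma>) - ?R (?mono \<sigma>) * ?d))"
    by (rule Delta_commutator)
  also have "\<dots> = (- of_nat m) *\<^sub>C Delta m"
    unfolding mono Delta_sum cvec.scale_sum_right by (simp only: scaleC_scaleC mult.commute)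
  finally show ?thesis .
qed

lemma cartan_Delta:
  fixes h :: "'l::{finite,linorder} sp"
  assumes "m \<le> CARD('l)" "h \<in> cartan"
  shows "\<exists>a. uea_of (loop_elem h 0) * Delta m - Delta m * uea_of (loop_elem h 0) = a *\<^sub>C Delta m"
  using assms(2) unfolding cartan_def
proof (induction rule: cvec.span_induct_alt)
  case base
  show ?case by (intro exI[of _ 0]) (simp add: loop_elem_simps uea_of_simps)
next
  case (step c x y)
  obtain b where b: "uea_of (loop_elem y 0) * Delta m - Delta m * uea_of (loop_elem y 0) = b *\<^sub>C Delta m"
    using step(2) by blast
  obtain i where i: "x = cartan_h i" using step(1) by blast
  obtain p where p: "p \<in> {1..CARD('l)}" "i = idx p" using idx_surj .
  obtain e where e: "U_ac 0 i i * Delta m - Delta m * U_ac 0 i i = e *\<^sub>C Delta m"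
    using U_ac_comm_det[OF p(1) p(1) assms(1)] p(2) by blast
  have "uea_of (loop_elem (c *\<^sub>C x + y) 0) * Delta m - Delta m * uea_of (loop_elem (c *\<^sub>C x + y) 0) =
      (- c) *\<^sub>C (U_ac 0 i i * Delta m - Delta m * U_ac 0 i i)
      + (uea_of (loop_elem y 0) * Delta m - Delta m * uea_of (loop_elem y 0))"
  proof -
    have "uea_of (loop_elem x 0) = - U_ac 0 i i"
      by (simp add: i cartan_h_def loop_elem_simps uea_of_simps)
    then have "uea_of (loop_elem (c *\<^sub>C x + y) 0) = (- c) *\<^sub>C U_ac 0 i i + uea_of (loop_elem y 0)"
      by (simp add: loop_elem_simps uea_of_simps)
    then show ?thesis
      by (simp only: distrib_left distrib_right scaleC_mult_left scaleC_mult_right cvec.scale_right_diff_distrib)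
        (simp add: algebra_simps)
  qed
  also have "\<dots> = (- c * e + b) *\<^sub>C Delta m"
    unfolding e b by (simp only: scaleC_scaleC scaleC_add_left)
  finally show ?case by blast
qed

lemma Delta_power_weight:
  fixes h :: "'l::{finite,linorder} affine"
  assumes m: "m \<le> CARD('l)" and "h \<in> affine_cartan"
  shows "\<exists>\<mu>. uea_of h * Delta m ^ n - \<mu> *\<^sub>C Delta m ^ n \<in> vac_null k"
proof -
  obtain x a b where h: "h = Affine (Poly_Mapping.single 0 x) a b" "x \<in> cartan"
    using assms(2) unfolding affine_cartan_def by blast
  have h': "h = loop_elem x 0 + a *\<^sub>C aff_c + b *\<^sub>C aff_d"
    by (simp add: h loop_elem_def aff_c_def aff_d_def plus_affine_def scaleC_affine_def)
  obtain e where e: "uea_of (loop_elem x 0) * Delta m - Delta m * uea_of (loop_elem x 0) = e *\<^sub>C Delta m"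
    using cartan_Delta[OF m h(2)] by blast
  have "uea_of h * Delta m - Delta m * uea_of h =
      (uea_of (loop_elem x 0) * Delta m - Delta m * uea_of (loop_elem x 0))
      + b *\<^sub>C (uea_of aff_d * Delta m - Delta m * uea_of aff_d)"
    unfolding h' uea_of_simps distrib_left distrib_right scaleC_mult_left scaleC_mult_right uea_of_aff_c_commute
    by (simp add: algebra_simps cvec.scale_right_diff_distrib)
  also have "\<dots> = (e + b * - of_nat m) *\<^sub>C Delta m"
    unfolding e aff_d_Delta scaleC_add_left scaleC_scaleC ..
  finally have comm: "uea_of h * Delta m - Delta m * uea_of h = (e + b * - of_nat m) *\<^sub>C Delta m" .
  have "uea_of h - (k * a) *\<^sub>C 1 \<in> vac_null k"
    using vac_null_affine[of h k] by (simp add: h)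
  from vac_null_eigen_power[OF comm this] show ?thesis by blast
qed

text \<open>Pairing the degree -1 component with X_{-2 eps_j} reads off its coefficient at X_{2
  eps_j}. The invariant form of these two vectors is -4, which explains the factor -1/4. On
  nonnegative degrees only the character c |-> k remains.\<close>

definition vac_char :: "complex \<Rightarrow> 'l::{finite,linorder} affine \<Rightarrow> complex" where
  "vac_char k x = (- 1/4) * (\<Sum>j\<in>UNIV. sp_form (Poly_Mapping.lookup (loop x) (- 1)) (sp_of (Cre j) (Cre j)))
     + k * c_coeff x"

lemma clinear_vac_char: "clinear (vac_char k)"
proof -
  have look: "clinear (\<lambda>x :: 'a affine. Poly_Mapping.lookup (loop x) (- 1))"
    by (simp add: clinear_iff plus_affine_def scaleC_affine_def lookup_add lookup_scaleC)
  show ?thesis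
    unfolding vac_char_def
    by (intro clinear_addI clinear_times_right clinear_sumI clinear_c_coeff clinear_compose[OF clinear_sp_form(1) look])
qed

lemma vac_char_X: "vac_char k (loop_elem (sp_of (Ann i) (Ann j)) (- 1)) = (if i = j then 1 else 0)"
proof -
  have "sp_form (sp_of (Ann i) (Ann j)) (sp_of (Cre a) (Cre a)) = (if a = i then (if i = j then - 4 else 0) else 0)"
    for a by (auto simp: sp_form_sp_of)
  then show ?thesis by (simp add: vac_char_def loop_elem_def)
qed

lemma Delta_power_not_null:
  assumes m: "m \<le> CARD('l)"
  shows "Delta m ^ n \<notin> (vac_null k :: 'l::{finite,linorder} affine uea set)"
proof -
  let ?P = "{x :: 'l affine. Poly_Mapping.keys (loop x) \<subseteq> {0..}}" and ?T = "cspan X_loops :: 'l affine set"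
  have P_lookup: "x \<in> ?P \<longleftrightarrow> (\<forall>n < 0. Poly_Mapping.lookup (loop x) n = 0)" for x
    by (auto simp: in_keys_iff subset_iff) (metis atLeast_iff linorder_not_le)
  have P: "cvec.subspace ?P"
    by (rule cvec.subspaceI; unfold P_lookup)
      (simp_all add: zero_affine_def plus_affine_def scaleC_affine_def lookup_add lookup_scaleC)
  have P_lie: "lie x y \<in> ?P" if "x \<in> ?P" "y \<in> ?P" for x y
    using Rep_parabolic[of "lie (Abs_parabolic x) (Abs_parabolic y)"] that
    by (simp add: lie_parabolic.rep_eq Abs_parabolic_inverse)
  have vac_char_P: "vac_char k x = k * c_coeff x" if "x \<in> ?P" for x
    using that unfolding P_lookup by (simp add: vac_char_def sp_form_0)
  have char_P: "vac_char k (lie p q) = 0" if "p \<in> ?P" "q \<in> ?P" for p q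
    using vac_char_P[OF P_lie[OF that]] c_coeff_lie_nonneg[of p q] that by simp
  have T_lie: "lie x y = 0" if "x \<in> ?T" "y \<in> ?T" for x y
  proof -
    have "lie x y = 0" if "x \<in> X_loops" "y \<in> X_loops" for x y :: "'l affine"
      using that by (auto simp: X_loops_def lie_loop_elem lie_sp_of sp_form_sp_of loop_elem_simps)
    then have "lie x y = 0" if "x \<in> X_loops" for x
      using clinear_vanish_span[OF clinear_lie_affine(2) _ \<open>y \<in> ?T\<close>] that by blast
    then show ?thesis using clinear_vanish_span[OF clinear_lie_affine(1) _ \<open>x \<in> ?T\<close>] by blast
  qed
  have T_form: "\<exists>z. x = loop_elem z (- 1)" if "x \<in> ?T" for x
    using that
  proof (induction rule: cvec.span_induct_alt)
    case base
    show ?case by (rule exI[of _ 0]) (simp add: loop_elem_simps)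
  next
    case (step c x y)
    then obtain u v where "x = loop_elem u (- 1)" "y = loop_elem v (- 1)" unfolding X_loops_def by blast
    then have "c *\<^sub>C x + y = loop_elem (c *\<^sub>C u + v) (- 1)" by (simp add: loop_elem_simps)
    then show ?case by blast
  qed
  have PT: "?P \<inter> ?T = {0}"
  proof -
    have "x = 0" if x: "x \<in> ?P" "x \<in> ?T" for x
    proof -
      obtain z where z: "x = loop_elem z (- 1)" using T_form[OF x(2)] by blast
      then have "z = 0" using x(1) unfolding P_lookup by (auto simp: loop_elem_def lookup_single dest: spec[of _ "- 1"])
      then show ?thesis by (simp add: z loop_elem_simps)
    qed
    then show ?thesis using cvec.subspace_0[OF P] cvec.span_zero[of X_loops] by blast
  qed
  obtain \<Phi> :: "'l affine uea \<Rightarrow> complex" where \<Phi>: "clinear \<Phi>"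
    "\<And>u p. p \<in> ?P \<Longrightarrow> \<Phi> (u * uea_of p) = \<Phi> u * vac_char k p"
    "\<And>xs. set xs \<subseteq> ?T \<Longrightarrow> \<Phi> (prod_list (map uea_of xs)) = prod_list (map (vac_char k) xs)"
    by (rule induced_functional_exists[OF clinear_lie_affine lie_affine_antisym lie_affine_jacobi
          clinear_vac_char P P_lie char_P cvec.subspace_span T_lie PT])
      (assumption | rule that)+
  have word: "\<Phi> (prod_list (map uea_of xs)) = prod_list (map (vac_char k) xs)" if "set xs \<subseteq> X_loops" for xs
    by (rule \<Phi>(3)) (use that cvec.span_superset in blast)
  \<comment> \<open>Multiplicativity holds on the subalgebra generated by the X(-1), where
    \<open>\<Phi>\<close> of a word is a product over its letters.\<close>
  have mult: "\<Phi> (u * v) = \<Phi> u * \<Phi> v" if "u \<in> X_words" "v \<in> X_words" for u v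
  proof -
    let ?W = "{prod_list (map uea_of xs) | xs. set xs \<subseteq> X_loops} :: 'l affine uea set"
    have left: "\<Phi> (w * v) = \<Phi> w * \<Phi> v" if "w \<in> ?W" for w
    proof (rule clinear_eq_on_span[of "\<lambda>v. \<Phi> (w * v)" "\<lambda>v. \<Phi> w * \<Phi> v" ?W])
      show "clinear (\<lambda>v. \<Phi> (w * v))" by (rule clinear_compose[OF \<Phi>(1) clinear_times_right[OF clinear_ident]])
      show "clinear (\<lambda>v. \<Phi> w * \<Phi> v)" by (rule clinear_times_right[OF \<Phi>(1)])
      fix v assume "v \<in> ?W"
      then obtain xs ys where xs: "w = prod_list (map uea_of xs)" "v = prod_list (map uea_of ys)"
        "set xs \<subseteq> X_loops" "set ys \<subseteq> X_loops" using \<open>w \<in> ?W\<close> by blast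
      then show "\<Phi> (w * v) = \<Phi> w * \<Phi> v" using word[of "xs @ ys"] word[of xs] word[of ys] by simp
    qed (use \<open>v \<in> X_words\<close> in \<open>simp add: X_words_def\<close>)
    show ?thesis
    proof (rule clinear_eq_on_span[of "\<lambda>u. \<Phi> (u * v)" "\<lambda>u. \<Phi> u * \<Phi> v" ?W])
      show "clinear (\<lambda>u. \<Phi> (u * v))" by (rule clinear_compose[OF \<Phi>(1) clinear_times_left[OF clinear_ident]])
      show "clinear (\<lambda>u. \<Phi> u * \<Phi> v)" by (rule clinear_times_left[OF \<Phi>(1)])
    qed (use left \<open>u \<in> X_words\<close> in \<open>simp_all add: X_words_def\<close>)
  qed
  \<comment> \<open>The determinant of the identity matrix: a permutation other than the identity
    moves some i, whose factor is then 0.\<close>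
  have "\<Phi> (Delta m) = (\<Sum>\<sigma> | \<sigma> permutes {1..m}. of_int (sign \<sigma>) * (if \<sigma> = id then 1 else 0))"
    unfolding Delta_def clinear_sum[OF \<Phi>(1)]
  proof (rule sum.cong[OF refl])
    fix \<sigma> assume "\<sigma> \<in> {\<sigma>. \<sigma> permutes {1..m}}"
    then have \<sigma>: "\<sigma> permutes {1..m}" by simp
    let ?w = "map (\<lambda>i. loop_elem (X_plus (idx i) (idx (\<sigma> i))) (- 1) :: 'l affine) [1..<m + 1]"
    have diag: "vac_char k (loop_elem (X_plus (idx i) (idx (\<sigma> i) :: 'l)) (- 1)) = (if i = \<sigma> i then 1 else 0)"
      if "i \<in> set [1..<m + 1]" for i
    proof -
      have "i \<in> {1..m}" "\<sigma> i \<in> {1..m}" using that permutes_in_image[OF \<sigma>, of i] by auto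
      then show ?thesis using m idx_eq_iff[of i "\<sigma> i", where 'l = 'l] by (simp add: X_plus_def vac_char_X)
    qed
    have "prod_list (map (vac_char k) ?w) = prod_list (map (\<lambda>i. if i = \<sigma> i then 1 else 0) [1..<m + 1])"
      unfolding map_map comp_def by (rule arg_cong[of _ _ prod_list], rule map_cong[OF refl], rule diag)
    also have "\<dots> = (\<Prod>i\<in>{1..m}. if i = \<sigma> i then 1 else 0)"
    proof -
      have "set [1..<m + 1] = {1..m}" by auto
      then show ?thesis using prod.distinct_set_conv_list[of "[1..<m + 1]"] by (metis distinct_upt)
    qed
    also have "\<dots> = (if \<sigma> = id then 1 else 0)"
    proof (cases "\<sigma> = id")
      case False
      then obtain i where "\<sigma> i \<noteq> i" by (auto simp: fun_eq_iff)
      moreover from this have "i \<in> {1..m}" using permutes_not_in[OF \<sigma>] by metis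
      ultimately show ?thesis using False by (auto intro!: prod_zero)
    qed simp
    finally show "\<Phi> (of_int (sign \<sigma>) *\<^sub>C
        prod_list (map (\<lambda>i. uea_of (loop_elem (X_plus (idx i) (idx (\<sigma> i))) (- 1))) [1..<m + 1])) =
        of_int (sign \<sigma>) * (if \<sigma> = id then 1 else 0)"
      unfolding clinear_scaleC[OF \<Phi>(1)] Delta_monomial(1) word[OF Delta_monomial(2)] by simp
  qed
  also have "\<dots> = 1"
  proof -
    have "(\<Sum>\<sigma> | \<sigma> permutes {1..m}. of_int (sign \<sigma>) * (if \<sigma> = id then 1 else 0 :: complex)) =
        (\<Sum>\<sigma> | \<sigma> permutes {1..m}. if \<sigma> = id then 1 else 0)"
      by (rule sum.cong) auto
    then show ?thesis by (simp add: finite_permutations permutes_id)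
  qed
  finally have Delta: "\<Phi> (Delta m) = 1" .
  have "\<Phi> (Delta m ^ n) = 1"
  proof (induction n)
    case 0
    show ?case using word[of "[]"] by simp
  next
    case (Suc n)
    then show ?case using mult[OF Delta_in_X_words Delta_power_in_X_words, of m m n] Delta by simp
  qed
  then show ?thesis
    by (intro not_in_vac_null[OF \<Phi>(1)]) (use \<Phi>(2) vac_char_P in auto)
qed

theorem theorem4p1:
  fixes m n :: nat
  assumes "1 \<le> m" "m \<le> CARD('l::{finite,linorder})" "1 \<le> n"
  shows "singular_vector (k_level m n)
    (verma_act (k_level m n) ((Delta m :: 'l affine uea) ^ n) (vacuum (k_level m n)))"
proof -
  let ?k = "k_level m n" and ?D = "(Delta m :: 'l affine uea) ^ n"
  have "\<forall>h\<in>affine_cartan. \<exists>a. uea_of h * ?D - a *\<^sub>C ?D \<in> vac_null ?k"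
    using Delta_power_weight[OF assms(2)] by blast
  then obtain \<mu> where "\<forall>h\<in>affine_cartan. uea_of h * ?D - \<mu> h *\<^sub>C ?D \<in> vac_null ?k"
    by metis
  then have "weight_vector ?k (verma_act ?k ?D (vacuum ?k))"
    unfolding weight_vector_def verma_act_act_vacuum using verma_act_vacuum_eq by blast
  moreover have "verma_act ?k ?D (vacuum ?k) \<in> verma ?k"
    unfolding verma_act_vacuum by (rule verma_class_in)
  ultimately show ?thesis
    unfolding singular_vector_def verma_act_act_vacuum verma_act_vacuum_zero_iff
    using Delta_power_not_null[OF assms(2)] Delta_power_n_plus[OF assms(2)]
      Delta_power_affine_pos[OF assms(1,2)] by blast
qed

end
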